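(* Let $F$ be an element of the second Wiener chaos with $\mathbb E(F^2)=1$, $\mathbb E(F^4)\ge9$, and $\mathbb E(F^{2r})\le\big((2r-1)!!\big)^2$ for some integer $r\ge3$. Then $F\overset{law}{=}N_1\times N_2$, where $N_1,N_2$ are independent $\mathscr N(0,1)$ random variables.
   Context: Let $W$ be an isonormal Gaussian process over a real separable Hilbert space $\mathfrak H$. The second Wiener chaos is $\mathscr H_2=\{I_2(f): f\in\mathfrak H^{\odot2}\}$ ($I_2$ the double Wiener integral). Equivalently, every $F\in\mathscr H_2$ can be written $F=\sum_{z\in\mathbb Z}\lambda_z(N_z^2-1)/\sqrt2$ with $(N_z)$ i.i.d. standard Gaussian and $\sum_z\lambda_z^2=\mathbb E(F^2)<\infty$. *)

theory Defs
  imports "HOL-Probability.Probability"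
begin

text \<open>
  The sort \<open>{real_inner, polish_space}\<close> (inner product, complete, second countable) is used for
  real separable Hilbert spaces; finite dimension is allowed.
\<close>

text \<open>The law \<open>N(\<mu>, \<sigma>\<^sup>2)\<close>, where \<open>\<sigma> = 0\<close> gives the Dirac mass at \<open>\<mu>\<close>.\<close>

definition normal_law :: "real \<Rightarrow> real \<Rightarrow> real measure" where
  "normal_law \<mu> \<sigma> =
    (if \<sigma> = 0 then return borel \<mu> else density lborel (normal_density \<mu> \<sigma>))"

locale isonormal_gaussian_process = prob_space M
  for M :: "'a measure" +
  fixes W :: "'h::{real_inner, polish_space} \<Rightarrow> 'a \<Rightarrow> real"
  assumes measurable_W: "\<And>h. W h \<in> borel_measurable M"
    and gaussian_W: "\<And>S c. finite S \<Longrightarrow>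
      \<exists>\<mu> \<sigma>. 0 \<le> \<sigma> \<and> distr M borel (\<lambda>\<omega>. \<Sum>h\<in>S. c h * W h \<omega>) = normal_law \<mu> \<sigma>"
    and centered_W: "\<And>h. expectation (W h) = 0"
    and covariance_W: "\<And>h k. expectation (\<lambda>\<omega>. W h \<omega> * W k \<omega>) = h \<bullet> k"

text \<open>
  The Hilbert tensor square of \<open>H\<close> is realised as the space of Hilbert-Schmidt bilinear forms on
  \<open>H\<close>: the tensor \<open>f\<close> is the form \<open>(x, y) \<mapsto> \<langle>f, x \<otimes> y\<rangle>\<close>, so \<open>h \<otimes> k\<close> is
  \<open>(x, y) \<mapsto> \<langle>h, x\<rangle> \<langle>k, y\<rangle>\<close>. The supremum below is the squared tensor norm
  \<open>\<Sum>i j. \<langle>f, e i \<otimes> e j\<rangle>\<^sup>2\<close> for any complete orthonormal system \<open>e\<close> of \<open>H\<close>.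
\<close>

definition tensor_sqnorm :: "('h::real_inner \<Rightarrow> 'h \<Rightarrow> real) \<Rightarrow> ennreal" where
  "tensor_sqnorm f =
    (SUP S\<in>{S. finite S \<and> pairwise orthogonal S \<and> (\<forall>e\<in>S. norm e = 1)}.
      ennreal (\<Sum>x\<in>S. \<Sum>y\<in>S. (f x y)\<^sup>2))"

definition symmetric_tensors :: "('h::{real_inner, polish_space} \<Rightarrow> 'h \<Rightarrow> real) set" where
  "symmetric_tensors =
    {f. bounded_bilinear f \<and> (\<forall>x y. f x y = f y x) \<and> tensor_sqnorm f < \<infinity>}"

text \<open>
  A list of pairs \<open>(c, h)\<close> stands for the elementary symmetric tensor \<open>\<Sum> c (h \<otimes> h)\<close>.
  Its double Wiener integral follows from \<open>I\<^sub>2 (h \<otimes> h) = W(h)\<^sup>2 - 1\<close> for unit vectors \<open>h\<close>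
  by homogeneity and linearity.
\<close>

definition elementary_tensor :: "(real \<times> 'h::real_inner) list \<Rightarrow> 'h \<Rightarrow> 'h \<Rightarrow> real" where
  "elementary_tensor cs x y = (\<Sum>(c, h)\<leftarrow>cs. c * ((h \<bullet> x) * (h \<bullet> y)))"

definition elementary_integral ::
    "('h::real_inner \<Rightarrow> 'a \<Rightarrow> real) \<Rightarrow> (real \<times> 'h) list \<Rightarrow> 'a \<Rightarrow> real" where
  "elementary_integral W cs \<omega> = (\<Sum>(c, h)\<leftarrow>cs. c * ((W h \<omega>)\<^sup>2 - (norm h)\<^sup>2))"

text \<open>
  \<open>double_wiener_integral M W f F\<close> means that \<open>F\<close> is a version of \<open>I\<^sub>2(f)\<close>. The integral is the
  extension from elementary tensors by the isometry \<open>E[I\<^sub>2(f)\<^sup>2] = 2 \<parallel>f\<parallel>\<^sup>2\<close>; by this isometry the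
  choice of the approximating sequence is immaterial.
\<close>

definition double_wiener_integral ::
    "'a measure \<Rightarrow> ('h::{real_inner, polish_space} \<Rightarrow> 'a \<Rightarrow> real) \<Rightarrow>
      ('h \<Rightarrow> 'h \<Rightarrow> real) \<Rightarrow> ('a \<Rightarrow> real) \<Rightarrow> bool" where
  "double_wiener_integral M W f F \<longleftrightarrow>
    F \<in> borel_measurable M \<and> integrable M (\<lambda>\<omega>. (F \<omega>)\<^sup>2) \<and>
    (\<exists>cs. (\<lambda>n. tensor_sqnorm (\<lambda>x y. f x y - elementary_tensor (cs n) x y)) \<longlonglongrightarrow> 0 \<and>
      (\<lambda>n. \<integral>\<omega>. (F \<omega> - elementary_integral W (cs n) \<omega>)\<^sup>2 \<partial>M) \<longlonglongrightarrow> 0)"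

definition second_wiener_chaos ::
    "'a measure \<Rightarrow> ('h::{real_inner, polish_space} \<Rightarrow> 'a \<Rightarrow> real) \<Rightarrow> ('a \<Rightarrow> real) set" where
  "second_wiener_chaos M W = {F. \<exists>f\<in>symmetric_tensors. double_wiener_integral M W f F}"

fun double_fact :: "nat \<Rightarrow> nat" where
  "double_fact 0 = 1"
| "double_fact (Suc 0) = 1"
| "double_fact (Suc (Suc n)) = Suc (Suc n) * double_fact n"

end

theory Submission
  imports Defs "HOL-Library.Diagonal_Subsequence"
begin

text \<open>
  A variable in the second chaos is an \<open>L\<^sup>2\<close> limit of forms \<open>\<Sum> \<lambda>\<^sub>e (N\<^sub>e\<^sup>2 - 1)\<close> with
  finitely many independent standard normals, because elementary tensors can be diagonalised. Their
  moments are polynomials with nonnegative coefficients in the power sums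
  \<open>p\<^sub>m = \<Sum> \<lambda>\<^sub>e\<^sup>m\<close>, \<open>m \<ge> 2\<close>, and they converge to the moments of the limit. The hypotheses
  become \<open>p\<^sub>2 \<rightarrow> 1/2\<close> and \<open>lim p\<^sub>4 \<ge> 1/8\<close>. The second one forces an eigenvalue with
  \<open>\<lambda>\<^sup>2 \<ge> 1/4\<close> in the limit, that is, at least half of the total mass \<open>p\<^sub>2\<close>. Up to a global sign it is
  positive and it dominates every odd power sum, so all odd \<open>p\<^sub>m\<close> are nonnegative; by log-convexity
  the even ones are at least \<open>2 (1/2)\<^sup>m\<close>. Hence every even moment is at least that of
  the eigenvalues \<open>\<plusminus>1/2\<close>, which is the law of \<open>N\<^sub>1 N\<^sub>2\<close>, and from the sixth
  moment on equality forces \<open>p\<^sub>3 = 0\<close>. This leaves only the eigenvalues \<open>1/2\<close> and \<open>-1/2\<close>.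
\<close>

section \<open>Finite-rank symmetric forms\<close>

text \<open>The obstacle is that the approximating forms share neither their eigenvectors nor the
  number of their eigenvalues, and the eigenvectors need not converge. So only scalars pass to the
  limit: the power sums and the largest eigenvalue, along a diagonal subsequence. The law is
  recovered without limiting normals: the two selected normals change with the index, but half the
  difference of their squares always has the same law, and characteristic functions are continuous
  in L2. The constants come from E(Y^2) = 2 p_2 and E(Y^4) = 12 p_2^2 + 48 p_4, where the values 1
  and 9 correspond to p_2 = 1/2 and p_4 = 1/8. Convergence of higher moments needs bounds that are
  uniform along the sequence. The recursion gives them as soon as p_2 is at most 1, so p_2 is
  settled before everything else. Once p_3 = 0 and the top eigenvalue is 1/2, the remaining squares
  sum to 1/4 and the remaining cubes to -1/8 in the limit. This is possible only if a single
  eigenvalue carries all the remaining mass.\<close>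

lemma orthonormal_basis_span:
  fixes S :: "'h::real_inner set"
  assumes "finite S"
  obtains C where "finite C" "pairwise orthogonal C" "\<And>e. e \<in> C \<Longrightarrow> norm e = 1" "span C = span S"
proof -
  obtain B where B: "finite B" "span B = span S" "pairwise orthogonal B"
    using basis_orthogonal[OF assms] by blast
  \<comment> \<open>The orthogonal set may contain 0, which cannot be normalised.\<close>
  define C where "C = (\<lambda>x. x /\<^sub>R norm x) ` (B - {0})"
  have "span C = span (B - {0})"
  proof (rule span_unique)
    show "C \<subseteq> span (B - {0})" unfolding C_def by (auto intro!: span_mul intro: span_base)
    fix T assume T: "C \<subseteq> T" "subspace T"
    show "span (B - {0}) \<subseteq> T"
    proof (rule span_minimal[OF _ T(2)], rule)
      fix x assume x: "x \<in> B - {0}"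
      hence "x /\<^sub>R norm x \<in> T" using T(1) by (auto simp: C_def)
      hence "norm x *\<^sub>R (x /\<^sub>R norm x) \<in> T" by (rule subspace_scale[OF T(2)])
      thus "x \<in> T" using x by simp
    qed
  qed (auto)
  moreover have "pairwise orthogonal C"
    using B(3) unfolding C_def pairwise_def by (auto simp: orthogonal_def)
  moreover have "\<And>e. e \<in> C \<Longrightarrow> norm e = 1"
    unfolding C_def by (auto simp: field_simps split: if_splits)
  moreover have "finite C" using B by (simp add: C_def)
  ultimately show ?thesis using that B(2) by simp
qed

text \<open>The ambient space may be infinite-dimensional, so being closed and bounded does not give
  compactness. The set is a finite sum of segments, each a continuous image of an interval.\<close>

lemma compact_bounded_combinations:
  fixes C :: "'h::real_normed_vector set"
  assumes "finite C"
  shows "compact {\<Sum>e\<in>C. a e *\<^sub>R e | a. \<forall>e. \<bar>a e\<bar> \<le> (1::real)}"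
  using assms
proof (induction C)
  case empty
  have "{\<Sum>e\<in>{}. a e *\<^sub>R e | a. \<forall>e. \<bar>a e\<bar> \<le> (1::real)} = {0::'h}"
    by (auto intro!: exI[of _ "\<lambda>_. 0"])
  thus ?case by simp
next
  case (insert x C)
  let ?K = "\<lambda>C. {\<Sum>e\<in>C. a e *\<^sub>R e | a. \<forall>e. \<bar>a e\<bar> \<le> (1::real)}"
  have "?K (insert x C) = {u + v | u v. u \<in> (\<lambda>t. t *\<^sub>R x) ` {-1..1} \<and> v \<in> ?K C}" (is "_ = ?R")
  proof
    show "?K (insert x C) \<subseteq> ?R"
    proof
      fix y assume "y \<in> ?K (insert x C)"
      then obtain a where a: "y = (\<Sum>e\<in>insert x C. a e *\<^sub>R e)" "\<forall>e. \<bar>a e\<bar> \<le> 1" by auto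
      hence "y = a x *\<^sub>R x + (\<Sum>e\<in>C. a e *\<^sub>R e)" using insert by simp
      moreover have "a x *\<^sub>R x \<in> (\<lambda>t. t *\<^sub>R x) ` {-1..1}" using a(2)[rule_format, of x] by (intro imageI) (auto simp: abs_le_iff)
      ultimately show "y \<in> ?R" using a(2) by blast
    qed
    show "?R \<subseteq> ?K (insert x C)"
    proof
      fix y assume "y \<in> ?R"
      then obtain t a where a: "y = t *\<^sub>R x + (\<Sum>e\<in>C. a e *\<^sub>R e)" "\<forall>e. \<bar>a e\<bar> \<le> 1" "\<bar>t\<bar> \<le> 1" by auto
      have "(\<Sum>e\<in>C. a e *\<^sub>R e) = (\<Sum>e\<in>C. (a(x := t)) e *\<^sub>R e)"
        using insert by (intro sum.cong) auto
      hence "y = (\<Sum>e\<in>insert x C. (a(x := t)) e *\<^sub>R e)" using a insert by simp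
      moreover have "\<forall>e. \<bar>(a(x := t)) e\<bar> \<le> 1" using a by auto
      ultimately show "y \<in> ?K (insert x C)" by blast
    qed
  qed
  moreover have "compact ((\<lambda>t. t *\<^sub>R x) ` {-1..1::real})"
    by (intro compact_continuous_image continuous_intros) auto
  ultimately show ?case using compact_sums[OF _ insert.IH] by simp
qed

text \<open>By Cauchy-Schwarz the coordinates of a unit vector lie in [-1, 1], so the sphere is a
  closed part of a compact box. This is what provides a maximiser of a quadratic form.\<close>

lemma compact_unit_sphere_span:
  fixes S :: "'h::real_inner set"
  assumes "finite S"
  shows "compact {x \<in> span S. norm x = 1}"
proof -
  obtain C where C: "finite C" "pairwise orthogonal C" "\<And>e. e \<in> C \<Longrightarrow> norm e = 1" "span C = span S"
    using orthonormal_basis_span[OF assms] by metis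
  let ?K = "{\<Sum>e\<in>C. a e *\<^sub>R e | a. \<forall>e. \<bar>a e\<bar> \<le> (1::real)}"
  have eq: "{x \<in> span S. norm x = 1} = ?K \<inter> sphere 0 1"
  proof (intro equalityI subsetI)
    fix x assume x: "x \<in> {x \<in> span S. norm x = 1}"
    have "x = (\<Sum>e\<in>C. (x \<bullet> e) *\<^sub>R e)"
      using orthonormal_basis_expand[OF C(2,3) _ C(1), of x] x C(4) by simp
    \<comment> \<open>The box bounds the coefficient function at every vector, hence the value 0 off
      \<open>C\<close>.\<close>
    also have "\<dots> = (\<Sum>e\<in>C. (if e \<in> C then x \<bullet> e else 0) *\<^sub>R e)" by (intro sum.cong) auto
    finally have "x = \<dots>" .
    moreover have "\<bar>if e \<in> C then x \<bullet> e else 0\<bar> \<le> 1" for e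
      using Cauchy_Schwarz_ineq2[of x e] x C(3) by auto
    ultimately have "\<exists>a. x = (\<Sum>e\<in>C. a e *\<^sub>R e) \<and> (\<forall>e. \<bar>a e\<bar> \<le> 1)"
      by (intro exI[of _ "\<lambda>e. if e \<in> C then x \<bullet> e else 0"]) auto
    hence "x \<in> ?K" by simp
    thus "x \<in> ?K \<inter> sphere 0 1" using x by simp
  next
    fix x assume "x \<in> ?K \<inter> sphere 0 1"
    thus "x \<in> {x \<in> span S. norm x = 1}"
      by (auto simp: C(4)[symmetric] intro!: span_sum span_mul intro: span_base)
  qed
  have "closed (sphere (0::'h) 1)"
    unfolding sphere_def by (intro closed_Collect_eq continuous_intros)
  thus ?thesis unfolding eq by (intro compact_Int_closed compact_bounded_combinations C(1))
qed

text \<open>First-order condition for the Rayleigh quotient: moving from \<open>v\<close> in the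
  direction \<open>y\<close> changes the form by a term linear in \<open>t\<close>, which a bound
  quadratic in \<open>t\<close> cannot absorb for small \<open>t\<close>.\<close>

lemma maximizer_orthogonal:
  fixes q :: "'h::real_inner \<Rightarrow> 'h \<Rightarrow> real"
  assumes q: "bounded_bilinear q" and sym: "\<And>x y. q x y = q y x"
    and V: "subspace V" and v: "v \<in> V" "norm v = 1"
    and max: "\<And>x. x \<in> V \<Longrightarrow> norm x = 1 \<Longrightarrow> q x x \<le> q v v"
    and y: "y \<in> V" "v \<bullet> y = 0"
  shows "q v y = 0"
proof (rule ccontr)
  interpret q: bounded_bilinear q by fact
  assume nz: "q v y \<noteq> 0"
  have hom: "q x x \<le> q v v * (x \<bullet> x)" if "x \<in> V" for x
  proof (cases "x = 0")
    case False
    have "q (x /\<^sub>R norm x) (x /\<^sub>R norm x) \<le> q v v"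
      using False that V by (intro max) (auto intro: subspace_scale)
    thus ?thesis using False
      by (simp add: q.scaleR_left q.scaleR_right field_simps power2_norm_eq_inner[symmetric] power2_eq_square)
  qed (simp add: q.zero_left)
  define D where "D = q v v * (y \<bullet> y) - q y y"
  have *: "2 * t * q v y \<le> t\<^sup>2 * D" for t
  proof -
    have "v + t *\<^sub>R y \<in> V" using V v y by (intro subspace_add subspace_scale)
    from hom[OF this] show ?thesis using v y
      by (simp add: q.add_left q.add_right q.scaleR_left q.scaleR_right inner_simps sym[of y v]
          power2_eq_square D_def algebra_simps inner_commute[of y v] norm_eq_1)
  qed
  show False
  proof (cases "D \<le> 0")
    case True
    have "2 * q v y * q v y \<le> (q v y)\<^sup>2 * D" using *[of "q v y"] by simp
    also have "\<dots> \<le> 0" using True by (simp add: mult_nonneg_nonpos)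
    finally show False using nz by (simp add: mult.assoc) (metis zero_less_mult_iff linorder_neqE_linordered_idom not_le)
  next
    case False
    \<comment> \<open>This \<open>t\<close> minimises \<open>t\<^sup>2 * D - 2 * t * q v y\<close>;
      the minimum \<open>- (q v y)\<^sup>2 / D\<close> is negative.\<close>
    have "2 * (q v y / D) * q v y \<le> (q v y / D)\<^sup>2 * D" by (rule *)
    also have "\<dots> = (q v y)\<^sup>2 / D" using False by (simp add: power2_eq_square)
    finally have "2 * ((q v y)\<^sup>2 / D) \<le> (q v y)\<^sup>2 / D" by (simp add: power2_eq_square)
    moreover have "(q v y)\<^sup>2 / D > 0" using False nz by simp
    ultimately show False by linarith
  qed
qed

text \<open>Spectral theorem on a finite-dimensional span: split off a maximiser of the form on the
  unit sphere and recurse on its orthogonal complement, to which the maximiser is also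
  q-orthogonal.\<close>

lemma orthonormal_diagonalization:
  fixes q :: "'h::real_inner \<Rightarrow> 'h \<Rightarrow> real"
  assumes q: "bounded_bilinear q" and sym: "\<And>x y. q x y = q y x" and "finite S"
  shows "\<exists>C. finite C \<and> pairwise orthogonal C \<and> (\<forall>e\<in>C. norm e = 1) \<and> span C = span S \<and>
    pairwise (\<lambda>x y. q x y = 0) C"
  using \<open>finite S\<close>
proof (induction "card S" arbitrary: S rule: less_induct)
  case less
  interpret q: bounded_bilinear q by fact
  let ?sphere = "{x \<in> span S. norm x = 1}"
  show ?case
  proof (cases "?sphere = {}")
    case True
    have "x = 0" if "x \<in> span S" for x
    proof (rule ccontr)
      assume "x \<noteq> 0"
      hence "x /\<^sub>R norm x \<in> ?sphere" using that by (auto intro: span_mul)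
      thus False using True by blast
    qed
    hence "span {} = span S" by (auto intro: span_zero)
    thus ?thesis by (intro exI[of _ "{}"]) (simp add: pairwise_def)
  next
    case False
    have "continuous_on ?sphere (\<lambda>x. q x x)"
      by (intro q.continuous_on continuous_on_id)
    then obtain v where v: "v \<in> span S" "norm v = 1"
      and max: "\<And>x. x \<in> span S \<Longrightarrow> norm x = 1 \<Longrightarrow> q x x \<le> q v v"
      using continuous_attains_sup[OF compact_unit_sphere_span[OF less.prems] False] by fastforce
    define V where "V = {x \<in> span S. v \<bullet> x = 0}"
    have V: "subspace V" unfolding V_def subspace_def
      by (auto simp: inner_simps intro: span_zero span_add span_mul)
    \<comment> \<open>The recursion needs a spanning set of \<open>V\<close> with fewer elements
      than \<open>S\<close>. A basis works: together with \<open>v\<close> it is independent inside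
      \<open>span S\<close>, so it has at most \<open>card S - 1\<close> elements.\<close>
    obtain B where B: "B \<subseteq> V" "independent B" "V \<subseteq> span B"
      using maximal_independent_subset[of V] by blast
    have spanB: "span B = V" using B V by (simp add: span_minimal subset_antisym)
    have "v \<notin> V" using v by (auto simp: V_def norm_eq_1)
    hence "independent (insert v B)" and vB: "v \<notin> B"
      using B spanB by (auto simp: independent_insert)
    moreover have "insert v B \<subseteq> span S" using v B by (auto simp: V_def)
    ultimately have "finite (insert v B) \<and> card (insert v B) \<le> card S"
      by (intro independent_span_bound[OF less.prems])
    hence "finite B" "card B < card S" using vB by auto
    from less.hyps[OF this(2) this(1)] obtain C where C: "finite C" "pairwise orthogonal C"
      "\<forall>e\<in>C. norm e = 1" "span C = V" "pairwise (\<lambda>x y. q x y = 0) C"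
      using spanB by auto
    have CV: "C \<subseteq> V" using C(4) span_superset by blast
    have "span (insert v C) = span S"
    proof
      show "span (insert v C) \<subseteq> span S"
        using CV v by (intro span_minimal) (auto simp: V_def)
      show "span S \<subseteq> span (insert v C)"
      proof
        fix x assume x: "x \<in> span S"
        have "x - (v \<bullet> x) *\<^sub>R v \<in> V" using x v
          by (auto simp: V_def inner_simps norm_eq_1 intro!: span_diff span_mul)
        hence "x - (v \<bullet> x) *\<^sub>R v \<in> span C" using C by simp
        thus "x \<in> span (insert v C)" by (auto simp: span_insert)
      qed
    qed
    moreover have "q v y = 0" if "y \<in> C" for y
      using maximizer_orthogonal[OF q sym subspace_span v max] that CV by (auto simp: V_def)
    hence "pairwise (\<lambda>x y. q x y = 0) (insert v C)"
      using C(5) sym by (auto simp: pairwise_insert)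
    moreover have "pairwise orthogonal (insert v C)"
      using C(2) CV by (intro pairwise_orthogonal_insert) (auto simp: V_def orthogonal_def)
    ultimately show ?thesis using C v by (intro exI[of _ "insert v C"]) auto
  qed
qed

section \<open>Jointly Gaussian families\<close>

context prob_space
begin

text \<open>Taking \<open>s = 0\<close> shows that \<open>m\<close> is the integral of
  \<open>w\<close>. If it is positive, \<open>w / m\<close> is a probability density under which
  \<open>X\<close> has the standard normal characteristic function, and Levy uniqueness applies; if
  it is 0, \<open>w\<close> vanishes almost everywhere.\<close>

lemma weighted_law_std_normal:
  fixes X w :: "'a \<Rightarrow> real"
  assumes [measurable]: "X \<in> borel_measurable M" "w \<in> borel_measurable M" and A: "A \<in> sets borel"
    and w: "\<And>\<omega>. 0 \<le> w \<omega>" "\<And>\<omega>. w \<omega> \<le> B"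
    and char: "\<And>s. (\<integral>\<omega>. complex_of_real (w \<omega>) * iexp (s * X \<omega>) \<partial>M) = complex_of_real (m * exp (- s\<^sup>2 / 2))"
  shows "(\<integral>\<omega>. w \<omega> * indicator A (X \<omega>) \<partial>M) = m * measure std_normal_distribution A"
proof -
  have int_w: "integrable M w" using w by (intro integrable_const_bound[of _ B]) auto
  have "complex_of_real (\<integral>\<omega>. w \<omega> \<partial>M) = complex_of_real m"
    using char[of 0] by (simp flip: integral_complex_of_real)
  hence m: "(\<integral>\<omega>. w \<omega> \<partial>M) = m" by (simp only: of_real_eq_iff)
  hence m0: "0 \<le> m" using w by (metis integral_nonneg_AE AE_I2)
  show ?thesis
  proof (cases "m = 0")
    case True
    hence "AE \<omega> in M. w \<omega> = 0" using integral_nonneg_eq_0_iff_AE[OF int_w] w m by simp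
    hence "(\<integral>\<omega>. w \<omega> * indicator A (X \<omega>) \<partial>M) = (\<integral>\<omega>. 0 \<partial>M)"
      using A by (intro integral_cong_AE) (auto elim!: eventually_mono)
    thus ?thesis using True by simp
  next
    case False
    hence m_pos: "0 < m" using m0 by simp
    define Q where "Q = density M (\<lambda>\<omega>. ennreal (w \<omega> / m))"
    have [measurable_cong]: "sets Q = sets M" by (simp add: Q_def)
    have "(\<integral>\<^sup>+\<omega>. ennreal (w \<omega> / m) \<partial>M) = ennreal (\<integral>\<omega>. w \<omega> / m \<partial>M)"
      using int_w w m0 by (intro nn_integral_eq_integral) auto
    also have "\<dots> = 1" using m m_pos by simp
    finally have "emeasure Q (space Q) = 1" by (simp add: Q_def emeasure_density cong: nn_integral_cong)
    hence Q: "prob_space Q" by (rule prob_spaceI)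
    interpret Q: prob_space Q by fact
    have Xd: "real_distribution (distr Q borel X)" by (intro Q.real_distribution_distr) simp
    have "char (distr Q borel X) = char std_normal_distribution"
    proof
      fix s
      have "char (distr Q borel X) s = (\<integral>\<omega>. iexp (s * X \<omega>) \<partial>Q)"
        unfolding char_def by (subst integral_distr) auto
      also have "\<dots> = (\<integral>\<omega>. (w \<omega> / m) *\<^sub>R iexp (s * X \<omega>) \<partial>M)"
        unfolding Q_def using w m0 by (subst integral_density) auto
      also have "\<dots> = (\<integral>\<omega>. complex_of_real (1 / m) * (complex_of_real (w \<omega>) * iexp (s * X \<omega>)) \<partial>M)"
        by (intro Bochner_Integration.integral_cong refl) (simp add: scaleR_conv_of_real)
      also have "\<dots> = complex_of_real (1 / m) * complex_of_real (m * exp (- s\<^sup>2 / 2))"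
        by (subst integral_mult_right_zero) (simp only: char)
      also have "\<dots> = complex_of_real (exp (- s\<^sup>2 / 2))" using m_pos by simp
      finally show "char (distr Q borel X) s = char std_normal_distribution s"
        by (simp add: char_std_normal_distribution)
    qed
    hence law: "distr Q borel X = std_normal_distribution"
      by (intro Levy_uniqueness Xd real_dist_normal_dist)
    have "measure std_normal_distribution A = (\<integral>x. indicator A x \<partial>distr Q borel X)"
      using A by (simp add: law)
    also have "\<dots> = (\<integral>\<omega>. indicator A (X \<omega>) \<partial>Q)" using A by (subst integral_distr) auto
    also have "\<dots> = (\<integral>\<omega>. (w \<omega> / m) *\<^sub>R indicator A (X \<omega>) \<partial>M)"
      unfolding Q_def using A w m0 by (subst integral_density) auto
    also have "\<dots> = (\<integral>\<omega>. w \<omega> * indicator A (X \<omega>) \<partial>M) / m" by simp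
    finally show ?thesis using m_pos by (simp add: field_simps)
  qed
qed

text \<open>
  The coordinates are converted from characters to indicators one at a time. The factor
  \<open>1 + cos\<close> or \<open>1 + sin\<close> keeps the weight nonnegative, so that the uniqueness theorem for
  probability measures on the line suffices.
\<close>

lemma jointly_std_normal_partial:
  fixes X :: "'i \<Rightarrow> 'a \<Rightarrow> real"
  assumes "finite I" and X [measurable]: "\<And>i. i \<in> I \<Longrightarrow> X i \<in> borel_measurable M"
    and char: "\<And>c. (\<integral>\<omega>. iexp (\<Sum>i\<in>I. c i * X i \<omega>) \<partial>M) = complex_of_real (exp (- (\<Sum>i\<in>I. (c i)\<^sup>2) / 2))"
    and "J \<subseteq> I" and A [measurable]: "\<And>i. i \<in> I \<Longrightarrow> A i \<in> sets borel"
  shows "(\<integral>\<omega>. complex_of_real (\<Prod>i\<in>J. indicator (A i) (X i \<omega>)) * iexp (\<Sum>i\<in>I - J. t i * X i \<omega>) \<partial>M) =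
    complex_of_real ((\<Prod>i\<in>J. measure std_normal_distribution (A i)) * exp (- (\<Sum>i\<in>I - J. (t i)\<^sup>2) / 2))"
proof -
  from finite_subset[OF \<open>J \<subseteq> I\<close> \<open>finite I\<close>] show ?thesis using \<open>J \<subseteq> I\<close>
  proof (induction J arbitrary: t rule: finite_induct)
    case empty
    show ?case using char[of t] by simp
  next
    case (insert j J)
    hence jI: "j \<in> I" and JI: "J \<subseteq> I" and IJ: "I - J = insert j (I - insert j J)" "finite (I - insert j J)"
      using \<open>finite I\<close> by auto
    have [measurable]: "i \<in> J \<Longrightarrow> X i \<in> borel_measurable M" "i \<in> J \<Longrightarrow> A i \<in> sets borel"
      "i \<in> I - insert j J \<Longrightarrow> X i \<in> borel_measurable M" for i
      using X A JI by auto
    have [measurable]: "X j \<in> borel_measurable M" "A j \<in> sets borel" using X A jI by auto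
    define Z T where "Z \<omega> = (\<Prod>i\<in>J. indicator (A i) (X i \<omega>) :: real)"
      and "T \<omega> = (\<Sum>i\<in>I - insert j J. t i * X i \<omega>)" for \<omega>
    define P D where "P = (\<Prod>i\<in>J. measure std_normal_distribution (A i))"
      and "D = exp (- (\<Sum>i\<in>I - insert j J. (t i)\<^sup>2) / 2)"
    have [measurable]: "Z \<in> borel_measurable M" "T \<in> borel_measurable M"
      unfolding Z_def T_def by measurable
    have Z: "0 \<le> Z \<omega>" "Z \<omega> \<le> 1" for \<omega>
      unfolding Z_def by (auto intro!: prod_nonneg prod_le_1 simp: indicator_def)
    \<comment> \<open>The frequency \<open>c\<close> of \<open>T\<close> is left free because
      \<open>trig\<close> needs the values 0, 1 and -1.\<close>
    have IH: "(\<integral>\<omega>. complex_of_real (Z \<omega>) * iexp (s * X j \<omega> + c * T \<omega>) \<partial>M) =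
        complex_of_real (P * (exp (- (c\<^sup>2 * (\<Sum>i\<in>I - insert j J. (t i)\<^sup>2)) / 2) * exp (- s\<^sup>2 / 2)))" for s c
    proof -
      define t' where "t' i = (if i = j then s else c * t i)" for i
      have "(\<Sum>i\<in>I - J. t' i * X i \<omega>) = s * X j \<omega> + c * T \<omega>" for \<omega>
        unfolding IJ(1) T_def using IJ(2) by (subst sum.insert) (auto simp: t'_def sum_distrib_left mult_ac intro!: sum.cong)
      moreover have "(\<Sum>i\<in>I - J. (t' i)\<^sup>2) = s\<^sup>2 + c\<^sup>2 * (\<Sum>i\<in>I - insert j J. (t i)\<^sup>2)"
        unfolding IJ(1) using IJ(2)
        by (subst sum.insert) (auto simp: t'_def sum_distrib_left power_mult_distrib intro!: sum.cong)
      moreover have "exp (- (s\<^sup>2 + x) / 2) = exp (- x / 2) * exp (- s\<^sup>2 / 2)" for x :: real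
        by (simp add: exp_add[symmetric] field_simps)
      ultimately show ?thesis using insert.IH[OF JI, of t'] by (simp only: Z_def P_def)
    qed
    have int: "integrable M (\<lambda>\<omega>. complex_of_real (Z \<omega>) * iexp (s * X j \<omega> + c * T \<omega>))" for s c
      by (intro integrable_const_bound[of _ 1]) (auto simp: norm_mult Z)
    \<comment> \<open>Euler's formulas write cosine and sine by the characters of frequency 1 and
      -1, so both weighted integrals reduce to \<open>IH\<close>.\<close>
    have trig: "complex_of_real (Z \<omega> * (1 + cos (T \<omega>))) * iexp (s * X j \<omega>) =
          complex_of_real (Z \<omega>) * iexp (s * X j \<omega> + 0 * T \<omega>)
          + (1/2) * (complex_of_real (Z \<omega>) * iexp (s * X j \<omega> + 1 * T \<omega>)
            + complex_of_real (Z \<omega>) * iexp (s * X j \<omega> + (-1) * T \<omega>))"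
      "complex_of_real (Z \<omega> * (1 + sin (T \<omega>))) * iexp (s * X j \<omega>) =
          complex_of_real (Z \<omega>) * iexp (s * X j \<omega> + 0 * T \<omega>)
          + (-\<i>/2) * (complex_of_real (Z \<omega>) * iexp (s * X j \<omega> + 1 * T \<omega>)
            - complex_of_real (Z \<omega>) * iexp (s * X j \<omega> + (-1) * T \<omega>))" for \<omega> s
      by (simp_all add: cos_of_real[symmetric] sin_of_real[symmetric] cos_exp_eq sin_exp_eq
          exp_add exp_diff exp_minus field_simps)
    have "(\<integral>\<omega>. (Z \<omega> * (1 + cos (T \<omega>))) * indicator (A j) (X j \<omega>) \<partial>M) = (P + P * D) * measure std_normal_distribution (A j)"
    proof (rule weighted_law_std_normal[of _ _ _ 2])
      show "(\<integral>\<omega>. complex_of_real (Z \<omega> * (1 + cos (T \<omega>))) * iexp (s * X j \<omega>) \<partial>M) =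
          complex_of_real ((P + P * D) * exp (- s\<^sup>2 / 2))" for s
        unfolding trig by (simp only: Bochner_Integration.integral_add Bochner_Integration.integral_diff
            integral_mult_right_zero int integrable_mult_right Bochner_Integration.integrable_add
            Bochner_Integration.integrable_diff IH) (simp add: D_def algebra_simps)
      show "0 \<le> Z \<omega> * (1 + cos (T \<omega>))" for \<omega>
        using Z(1)[of \<omega>] cos_ge_minus_one[of "T \<omega>"] by (intro mult_nonneg_nonneg) linarith+
      show "Z \<omega> * (1 + cos (T \<omega>)) \<le> 2" for \<omega>
        using mult_mono[of "Z \<omega>" 1 "1 + cos (T \<omega>)" 2] Z cos_ge_minus_one[of "T \<omega>"] by auto
    qed auto
    moreover have "(\<integral>\<omega>. (Z \<omega> * (1 + sin (T \<omega>))) * indicator (A j) (X j \<omega>) \<partial>M) = P * measure std_normal_distribution (A j)"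
    proof (rule weighted_law_std_normal[of _ _ _ 2])
      show "(\<integral>\<omega>. complex_of_real (Z \<omega> * (1 + sin (T \<omega>))) * iexp (s * X j \<omega>) \<partial>M) =
          complex_of_real (P * exp (- s\<^sup>2 / 2))" for s
        unfolding trig by (simp only: Bochner_Integration.integral_add Bochner_Integration.integral_diff
            integral_mult_right_zero int integrable_mult_right Bochner_Integration.integrable_add
            Bochner_Integration.integrable_diff IH) (simp add: algebra_simps)
      show "0 \<le> Z \<omega> * (1 + sin (T \<omega>))" for \<omega>
        using Z(1)[of \<omega>] sin_ge_minus_one[of "T \<omega>"] by (intro mult_nonneg_nonneg) linarith+
      show "Z \<omega> * (1 + sin (T \<omega>)) \<le> 2" for \<omega>
        using mult_mono[of "Z \<omega>" 1 "1 + sin (T \<omega>)" 2] Z sin_ge_minus_one[of "T \<omega>"] by auto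
    qed auto
    moreover have "(\<integral>\<omega>. Z \<omega> * indicator (A j) (X j \<omega>) \<partial>M) = P * measure std_normal_distribution (A j)"
    proof (rule weighted_law_std_normal[of _ _ _ 1])
      show "(\<integral>\<omega>. complex_of_real (Z \<omega>) * iexp (s * X j \<omega>) \<partial>M) = complex_of_real (P * exp (- s\<^sup>2 / 2))" for s
        using IH[of s 0] by simp
    qed (auto simp: Z)
    moreover have intb: "integrable M (\<lambda>\<omega>. Z \<omega> * g (T \<omega>) * indicator (A j) (X j \<omega>))"
      if [measurable]: "g \<in> borel_measurable borel" and "\<And>x. \<bar>g x\<bar> \<le> 1" for g :: "real \<Rightarrow> real"
    proof (intro integrable_const_bound[of _ 1] AE_I2)
      fix \<omega>
      have "\<bar>Z \<omega>\<bar> * \<bar>g (T \<omega>)\<bar> * \<bar>indicator (A j) (X j \<omega>)\<bar> \<le> 1 * 1 * 1"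
        using that(2) Z by (intro mult_mono) (auto simp: indicator_def)
      thus "norm (Z \<omega> * g (T \<omega>) * indicator (A j) (X j \<omega>)) \<le> 1" by (simp add: abs_mult)
    qed measurable
    note ints = intb[of cos] intb[of sin] intb[of "\<lambda>_. 1"]
    \<comment> \<open>Subtracting the integral with weight \<open>Z\<close> removes the added 1. The
      sine part is 0 because the prescribed characteristic function is real.\<close>
    ultimately have cs: "(\<integral>\<omega>. Z \<omega> * cos (T \<omega>) * indicator (A j) (X j \<omega>) \<partial>M) = P * D * measure std_normal_distribution (A j)"
      "(\<integral>\<omega>. Z \<omega> * sin (T \<omega>) * indicator (A j) (X j \<omega>) \<partial>M) = 0"
      by (simp_all add: algebra_simps)
    have eq: "complex_of_real (\<Prod>i\<in>insert j J. indicator (A i) (X i \<omega>)) * iexp (T \<omega>) =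
        complex_of_real (Z \<omega> * cos (T \<omega>) * indicator (A j) (X j \<omega>))
        + \<i> * complex_of_real (Z \<omega> * sin (T \<omega>) * indicator (A j) (X j \<omega>))" for \<omega>
      using insert.hyps by (simp add: Z_def cis_conv_exp[symmetric] cis.ctr complex_eq_iff)
    have "(\<integral>\<omega>. complex_of_real (\<Prod>i\<in>insert j J. indicator (A i) (X i \<omega>)) * iexp (T \<omega>) \<partial>M) =
        complex_of_real (P * D * measure std_normal_distribution (A j)) + \<i> * complex_of_real 0"
    proof -
      have ints': "integrable M (\<lambda>\<omega>. complex_of_real (Z \<omega> * cos (T \<omega>) * indicator (A j) (X j \<omega>)))"
        "integrable M (\<lambda>\<omega>. complex_of_real (Z \<omega> * sin (T \<omega>) * indicator (A j) (X j \<omega>)))"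
        using ints by (simp_all only: complex_of_real_integrable_eq) simp_all
      show ?thesis
        unfolding eq by (simp only: Bochner_Integration.integral_add ints' integrable_mult_right
            integral_mult_right_zero integral_complex_of_real cs)
    qed
    thus ?case using insert.hyps by (simp add: T_def P_def D_def mult_ac)
  qed
qed

text \<open>With \<open>J = I\<close> in the partial statement no character is left, so the
  probability of a box is a product of normal measures. Boxes with one nontrivial side give the
  marginals, and all boxes together give independence.\<close>

lemma jointly_std_normal:
  fixes X :: "'i \<Rightarrow> 'a \<Rightarrow> real"
  assumes "finite I" and X [measurable]: "\<And>i. i \<in> I \<Longrightarrow> X i \<in> borel_measurable M"
    and char: "\<And>c. (\<integral>\<omega>. iexp (\<Sum>i\<in>I. c i * X i \<omega>) \<partial>M) = complex_of_real (exp (- (\<Sum>i\<in>I. (c i)\<^sup>2) / 2))"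
  shows "\<And>i. i \<in> I \<Longrightarrow> distr M borel (X i) = std_normal_distribution"
    and "indep_vars (\<lambda>_. borel) X I"
proof -
  \<comment> \<open>For empty \<open>I\<close> the intersection would be \<open>UNIV\<close>, which
    need not be an event, so that case is kept apart.\<close>
  have box: "prob (\<Inter>i\<in>I. X i -` A i \<inter> space M) = (\<Prod>i\<in>I. measure std_normal_distribution (A i))"
    if A: "\<And>i. i \<in> I \<Longrightarrow> A i \<in> sets borel" and ne: "I \<noteq> {}" for A
  proof -
    have "complex_of_real (\<integral>\<omega>. (\<Prod>i\<in>I. indicator (A i) (X i \<omega>)) \<partial>M) =
        complex_of_real (\<Prod>i\<in>I. measure std_normal_distribution (A i))"
      using jointly_std_normal_partial[OF assms order_refl A, where t = "\<lambda>_. 0"]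
      by (subst integral_complex_of_real[symmetric]) simp
    hence "(\<integral>\<omega>. (\<Prod>i\<in>I. indicator (A i) (X i \<omega>)) \<partial>M) = (\<Prod>i\<in>I. measure std_normal_distribution (A i))"
      by (simp only: of_real_eq_iff)
    moreover have "(\<integral>\<omega>. (\<Prod>i\<in>I. indicator (A i) (X i \<omega>)) \<partial>M) =
        (\<integral>\<omega>. indicator (\<Inter>i\<in>I. X i -` A i \<inter> space M) \<omega> \<partial>M :: real)"
    proof (intro Bochner_Integration.integral_cong refl)
      fix \<omega> assume "\<omega> \<in> space M"
      thus "(\<Prod>i\<in>I. indicator (A i) (X i \<omega>)) = (indicator (\<Inter>i\<in>I. X i -` A i \<inter> space M) \<omega> :: real)"
        using \<open>finite I\<close> ne by (auto simp: indicator_def prod_zero_iff)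
    qed
    moreover have "(\<Inter>i\<in>I. X i -` A i \<inter> space M) \<in> events"
      using \<open>finite I\<close> ne measurable_sets[OF X A] by (intro sets.finite_INT) auto
    ultimately show ?thesis by simp
  qed
  interpret N: real_distribution std_normal_distribution by (rule real_dist_normal_dist)
  have N_UNIV: "measure std_normal_distribution UNIV = 1" using N.prob_space by simp
  show law: "distr M borel (X i) = std_normal_distribution" if i: "i \<in> I" for i
  proof (rule measure_eqI)
    fix A assume "A \<in> sets (distr M borel (X i))"
    hence A: "A \<in> sets borel" by simp
    have slab: "(\<Inter>k\<in>I. X k -` (if k = i then A else UNIV) \<inter> space M) = X i -` A \<inter> space M"
      using i by (auto split: if_splits)
    have "prob (\<Inter>k\<in>I. X k -` (if k = i then A else UNIV) \<inter> space M) =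
        (\<Prod>k\<in>I. measure std_normal_distribution (if k = i then A else UNIV))"
      by (rule box) (use A i in auto)
    hence "prob (X i -` A \<inter> space M) = (\<Prod>k\<in>I. measure std_normal_distribution (if k = i then A else UNIV))"
      by (simp only: slab)
    also have "\<dots> = (\<Prod>k\<in>I. if k = i then measure std_normal_distribution A else 1)"
      by (intro prod.cong) (auto simp: N_UNIV)
    also have "\<dots> = measure std_normal_distribution A" using i \<open>finite I\<close> by simp
    finally show "emeasure (distr M borel (X i)) A = emeasure std_normal_distribution A"
      using A X[OF i] by (simp add: emeasure_distr emeasure_eq_measure N.emeasure_eq_measure)
  qed simp
  show "indep_vars (\<lambda>_. borel) X I"
  proof (cases "I = {}")
    case True
    thus ?thesis unfolding indep_vars_def indep_sets_def by auto
  next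
    case False
    have "prob (\<Inter>i\<in>I. X i -` A i \<inter> space M) = (\<Prod>i\<in>I. prob (X i -` A i \<inter> space M))"
      if A: "A \<in> (\<Pi> i\<in>I. sets borel)" for A
    proof -
      have "prob (X i -` A i \<inter> space M) = measure std_normal_distribution (A i)" if "i \<in> I" for i
        using law[OF that, symmetric] A that X[OF that] by (auto simp: measure_distr Pi_iff)
      thus ?thesis using box[of A] A False by (auto simp: Pi_iff)
    qed
    thus ?thesis
      by (subst indep_vars_finite[where E = "\<lambda>_. sets borel"])
        (use False \<open>finite I\<close> in \<open>auto simp: Int_stable_def sets.sigma_sets_eq[of borel, simplified]\<close>)
  qed
qed

end

section \<open>The moment recursion\<close>

text \<open>
  The \<open>n\<close>-th moment over \<open>n!\<close> of a variable with cumulants \<open>\<kappa>\<^sub>1 = 0\<close> and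
  \<open>\<kappa>\<^sub>k\<^sub>+\<^sub>1 = 2\<^sup>k k! p\<^sub>k\<^sub>+\<^sub>1\<close> for \<open>k \<ge> 1\<close>, such as
  \<open>\<Sum> \<lambda>\<^sub>e (N\<^sub>e\<^sup>2 - 1)\<close> with \<open>p\<^sub>m = \<Sum> \<lambda>\<^sub>e\<^sup>m\<close>.
\<close>

fun moment_coeff :: "(nat \<Rightarrow> real) \<Rightarrow> nat \<Rightarrow> real" where
  "moment_coeff p 0 = 1"
| "moment_coeff p (Suc n) = (\<Sum>k=1..n. 2 ^ k * p (Suc k) * moment_coeff p (n - k)) / real (Suc n)"

declare moment_coeff.simps(2) [simp del]

lemma Suc_mult_moment_coeff:
  "real (Suc n) * moment_coeff p (Suc n) = (\<Sum>k=1..n. 2 ^ k * p (Suc k) * moment_coeff p (n - k))"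
  by (simp add: moment_coeff.simps(2))

lemma moment_coeff_2: "moment_coeff p 2 = p 2"
  by (simp add: numeral_2_eq_2 moment_coeff.simps(2))

lemma moment_coeff_4: "moment_coeff p 4 = (p 2)\<^sup>2 / 2 + 2 * p 4"
proof -
  have one: "moment_coeff p (Suc 0) = 0" by (simp add: moment_coeff.simps(2))
  have "moment_coeff p 4 = (\<Sum>k=1..3. 2 ^ k * p (Suc k) * moment_coeff p (3 - k)) / 4"
    using moment_coeff.simps(2)[of p 3] by simp
  also have "{1..3} = {1, 2, 3::nat}" by auto
  finally show ?thesis by (simp add: moment_coeff_2 one power2_eq_square add_divide_distrib) (simp add: numeral_2_eq_2)
qed

text \<open>The recursion determines the sequence. Rescaled coefficients, the closed form for the
  product law and the actual moments are all identified in this way.\<close>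

lemma moment_coeff_unique:
  assumes "a 0 = 1"
    and "\<And>n. real (Suc n) * a (Suc n) = (\<Sum>k=1..n. 2 ^ k * p (Suc k) * a (n - k))"
  shows "a n = moment_coeff p n"
proof (induction n rule: less_induct)
  case (less n)
  show ?case
  proof (cases n)
    case (Suc m)
    have "(\<Sum>k=1..m. 2 ^ k * p (Suc k) * a (m - k)) =
        (\<Sum>k=1..m. 2 ^ k * p (Suc k) * moment_coeff p (m - k))"
      using less Suc by (intro sum.cong) auto
    hence "real (Suc m) * a (Suc m) = real (Suc m) * moment_coeff p (Suc m)"
      unfolding assms(2) Suc_mult_moment_coeff .
    thus ?thesis using Suc by (simp del: of_nat_Suc)
  qed (simp add: assms(1))
qed

text \<open>The coefficient is homogeneous of weight \<open>n\<close> when \<open>p m\<close> has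
  weight \<open>m\<close>. The case \<open>c = -1\<close> lets the signs of all eigenvalues be
  flipped without changing an even moment.\<close>

lemma moment_coeff_scale: "moment_coeff (\<lambda>m. c ^ m * p m) n = c ^ n * moment_coeff p n"
proof (rule moment_coeff_unique[symmetric])
  fix n
  have "real (Suc n) * (c ^ Suc n * moment_coeff p (Suc n)) =
      c ^ Suc n * (\<Sum>k=1..n. 2 ^ k * p (Suc k) * moment_coeff p (n - k))"
    by (subst mult.left_commute, subst Suc_mult_moment_coeff) (rule refl)
  also have "\<dots> = (\<Sum>k=1..n. 2 ^ k * (c ^ Suc k * p (Suc k)) * (c ^ (n - k) * moment_coeff p (n - k)))"
    unfolding sum_distrib_left
  proof (intro sum.cong refl)
    fix k assume "k \<in> {1..n}"
    hence "c ^ Suc n = c ^ Suc k * c ^ (n - k)" by (simp only: power_add[symmetric]) simp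
    thus "c ^ Suc n * (2 ^ k * p (Suc k) * moment_coeff p (n - k)) =
        2 ^ k * (c ^ Suc k * p (Suc k)) * (c ^ (n - k) * moment_coeff p (n - k))"
      by (simp only: mult_ac)
  qed
  finally show "real (Suc n) * (c ^ Suc n * moment_coeff p (Suc n)) = \<dots>" .
qed simp

text \<open>The recursion averages \<open>n - 1\<close> terms over \<open>n\<close>, each bounded by
  a power of 2. This takes the place of hypercontractivity: a bound on the second power sum controls
  every moment uniformly along a sequence.\<close>

lemma abs_moment_coeff_le:
  assumes "\<And>m. m \<ge> 2 \<Longrightarrow> \<bar>p m\<bar> \<le> 1"
  shows "\<bar>moment_coeff p n\<bar> \<le> 2 ^ n"
proof (induction n rule: less_induct)
  case (less n)
  show ?case
  proof (cases n)
    case (Suc m)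
    have "\<bar>\<Sum>k=1..m. 2 ^ k * p (Suc k) * moment_coeff p (m - k)\<bar> \<le> (\<Sum>k=1..m. 2 ^ m)"
    proof (rule order_trans[OF sum_abs], rule sum_mono)
      fix k assume k: "k \<in> {1..m}"
      have "\<bar>2 ^ k * p (Suc k) * moment_coeff p (m - k)\<bar> \<le> 2 ^ k * 1 * 2 ^ (m - k)"
        unfolding abs_mult using k Suc less assms by (intro mult_mono) auto
      also have "\<dots> = 2 ^ m" using k by (simp flip: power_add)
      finally show "\<bar>2 ^ k * p (Suc k) * moment_coeff p (m - k)\<bar> \<le> 2 ^ m" .
    qed
    also have "\<dots> \<le> real (Suc m) * 2 ^ Suc m" by (simp add: algebra_simps)
    finally show ?thesis using Suc by (simp add: moment_coeff.simps(2) divide_simps mult.commute)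
  qed simp
qed

lemma tendsto_moment_coeff:
  assumes "\<And>m. m \<ge> 2 \<Longrightarrow> ((\<lambda>x. p x m) \<longlongrightarrow> \<pi> m) F"
  shows "((\<lambda>x. moment_coeff (p x) n) \<longlongrightarrow> moment_coeff \<pi> n) F"
proof (induction n rule: less_induct)
  case (less n)
  show ?case
  proof (cases n)
    case (Suc m)
    show ?thesis unfolding Suc moment_coeff.simps
      using less Suc assms by (intro tendsto_intros) auto
  qed simp
qed

text \<open>The power sums of the eigenvalues \<open>1/2\<close> and \<open>-1/2\<close> of the product of two normals.\<close>

definition product_powersum :: "nat \<Rightarrow> real" where
  "product_powersum m = (1/2) ^ m + (-1/2) ^ m"

lemma product_powersum_even [simp]: "product_powersum (2 * k) = 2 / 4 ^ k"
  and product_powersum_odd [simp]: "odd m \<Longrightarrow> product_powersum m = 0"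
  by (simp_all add: product_powersum_def power_mult power_divide power_minus_odd)

lemma product_powersum_nonneg: "0 \<le> product_powersum m"
  by (cases "even m") (auto elim!: evenE)

text \<open>The right side is E((N1 N2)^(2k)) / (2k)!. For odd \<open>j\<close> the factor
  \<open>2 ^ j * product_powersum (Suc j)\<close> is 1 and for even \<open>j\<close> it is 0. So the
  recursion says that \<open>real (2 * k + 2) * a (2 * k + 2)\<close> is the sum of the earlier even
  terms, which is the summed form of the two-term relation \<open>a_step\<close>.\<close>

lemma moment_coeff_product_even:
  "moment_coeff product_powersum (2 * k) = (real (double_fact (2 * k - 1)))\<^sup>2 / fact (2 * k)"
proof -
  \<comment> \<open>At \<open>n = 0\<close> truncated subtraction gives
    \<open>double_fact 0 = 1\<close>, the usual value of (-1)!!.\<close>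
  define a where "a n = (if even n then (real (double_fact (n - 1)))\<^sup>2 / fact n else 0)" for n
  have a_step: "real (2 * k + 2) * a (2 * k + 2) = real (2 * k + 1) * a (2 * k)" for k
  proof (cases k)
    case (Suc j)
    define u v D f where "u = real (2 * k + 2)" and "v = real (2 * k + 1)"
      and "D = real (double_fact (2 * k - 1))" and "f = (fact (2 * k) :: real)"
    have "double_fact (2 * k + 2 - 1) = (2 * k + 1) * double_fact (2 * k - 1)" using Suc by simp
    hence "real (double_fact (2 * k + 2 - 1)) = v * D" unfolding v_def D_def by (metis of_nat_mult)
    moreover have "fact (2 * k + 2) = u * v * f" by (simp add: u_def v_def f_def algebra_simps)
    ultimately have "real (2 * k + 2) * a (2 * k + 2) = u * ((v * D)\<^sup>2 / (u * v * f))"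
      by (simp add: a_def u_def)
    also have "\<dots> = v * (D\<^sup>2 / f)" by (simp add: power_mult_distrib power2_eq_square u_def v_def)
    also have "\<dots> = real (2 * k + 1) * a (2 * k)" by (simp add: a_def v_def D_def f_def)
    finally show ?thesis .
  qed (simp add: a_def)
  have "a n = moment_coeff product_powersum n" for n
  proof (rule moment_coeff_unique)
    fix n
    have a_sum: "real (2 * k + 2) * a (2 * k + 2) = (\<Sum>j\<le>k. a (2 * j))" for k
    proof (induction k)
      case 0 show ?case by (simp add: a_def)
    next
      case (Suc k)
      have "real (2 * Suc k + 2) * a (2 * Suc k + 2) = real (2 * k + 2) * a (2 * k + 2) + a (2 * k + 2)"
        using a_step[of "Suc k"] by (simp add: algebra_simps)
      thus ?case using Suc by simp
    qed
    show "real (Suc n) * a (Suc n) = (\<Sum>k=1..n. 2 ^ k * product_powersum (Suc k) * a (n - k))"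
    proof (cases "odd n")
      case False
      have "product_powersum (Suc k) * a (n - k) = 0" if "k \<le> n" for k
        using False that by (cases "even k") (auto simp: a_def)
      hence "(\<Sum>k=1..n. 2 ^ k * product_powersum (Suc k) * a (n - k)) = 0"
        by (intro sum.neutral) (simp add: mult.assoc)
      thus ?thesis using False by (simp add: a_def)
    next
      case True
      then obtain k where k: "n = 2 * k + 1" by (auto elim: oddE)
      \<comment> \<open>The surviving indices are the odd ones, written as \<open>n - 2 * i\<close>
        so that the other factor becomes \<open>a (2 * i)\<close>.\<close>
      have "(\<Sum>j=1..n. 2 ^ j * product_powersum (Suc j) * a (n - j)) = (\<Sum>j\<in>(\<lambda>i. n - 2 * i) ` {..k}. 2 ^ j * product_powersum (Suc j) * a (n - j))"
      proof (rule sum.mono_neutral_right)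
        show "\<forall>j\<in>{1..n} - (\<lambda>i. n - 2 * i) ` {..k}. 2 ^ j * product_powersum (Suc j) * a (n - j) = 0"
        proof
          fix j assume j: "j \<in> {1..n} - (\<lambda>i. n - 2 * i) ` {..k}"
          have "even j"
          proof (rule ccontr)
            assume "odd j"
            then obtain i where i: "j = 2 * i + 1" by (auto elim: oddE)
            hence "j = n - 2 * (k - i)" "k - i \<le> k" using j k by auto
            thus False using j by blast
          qed
          thus "2 ^ j * product_powersum (Suc j) * a (n - j) = 0" by simp
        qed
      qed (use k in auto)
      also have "\<dots> = (\<Sum>i\<le>k. 2 ^ (n - 2 * i) * product_powersum (Suc (n - 2 * i)) * a (n - (n - 2 * i)))"
        using k by (subst sum.reindex) (auto simp: inj_on_def)
      also have "\<dots> = (\<Sum>i\<le>k. a (2 * i))"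
      proof (intro sum.cong refl)
        fix i assume i: "i \<in> {..k}"
        have "Suc (n - 2 * i) = 2 * (k - i + 1)" "n - (n - 2 * i) = 2 * i" using i k by auto
        moreover have "n - 2 * i = 2 * (k - i) + 1" using i k by auto
        hence "(2::real) ^ (n - 2 * i) = 2 * 4 ^ (k - i)" by (simp add: power_mult)
        ultimately show "2 ^ (n - 2 * i) * product_powersum (Suc (n - 2 * i)) * a (n - (n - 2 * i)) = a (2 * i)"
          by (simp only: product_powersum_even) (simp add: field_simps)
      qed
      finally show ?thesis using a_sum[of k] k by simp
    qed
  qed (simp add: a_def)
  from this[of "2 * k"] show ?thesis by (simp add: a_def)
qed

text \<open>All coefficients of the recursion are nonnegative, so an entrywise comparison of
  nonnegative power sums propagates by induction.\<close>

lemma moment_coeff_mono: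
  assumes "\<And>m. m \<ge> 2 \<Longrightarrow> 0 \<le> q m" "\<And>m. m \<ge> 2 \<Longrightarrow> q m \<le> p m"
  shows "0 \<le> moment_coeff q n" "moment_coeff q n \<le> moment_coeff p n"
proof -
  have p_nonneg: "0 \<le> p m" if "m \<ge> 2" for m using assms[OF that] by linarith
  have "0 \<le> moment_coeff q n \<and> moment_coeff q n \<le> moment_coeff p n"
  proof (induction n rule: less_induct)
    case (less n)
    show ?case
    proof (cases n)
      case (Suc m)
      have "0 \<le> (\<Sum>k=1..m. 2 ^ k * q (Suc k) * moment_coeff q (m - k))"
        using less Suc assms(1) by (intro sum_nonneg mult_nonneg_nonneg) auto
      moreover have "(\<Sum>k=1..m. 2 ^ k * q (Suc k) * moment_coeff q (m - k)) \<le>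
          (\<Sum>k=1..m. 2 ^ k * p (Suc k) * moment_coeff p (m - k))"
        using less Suc assms p_nonneg by (intro sum_mono mult_mono mult_nonneg_nonneg) auto
      ultimately show ?thesis unfolding Suc moment_coeff.simps by (intro conjI divide_right_mono divide_nonneg_nonneg) auto
    qed simp
  qed
  thus "0 \<le> moment_coeff q n" "moment_coeff q n \<le> moment_coeff p n" by auto
qed

text \<open>A quantitative form of monotonicity: the \<open>k\<close>-th summand of the recursion
  keeps its surplus while the others are only compared. It is applied with \<open>k = 2\<close>,
  where the surplus is \<open>4 * p 3\<close> times an earlier coefficient.\<close>

lemma moment_coeff_step_lower:
  assumes "\<And>m. m \<ge> 2 \<Longrightarrow> 0 \<le> q m" "\<And>m. m \<ge> 2 \<Longrightarrow> q m \<le> p m" "1 \<le> k" "k \<le> n"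
  shows "real (Suc n) * moment_coeff q (Suc n) + 2 ^ k * (p (Suc k) - q (Suc k)) * moment_coeff p (n - k)
    \<le> real (Suc n) * moment_coeff p (Suc n)"
proof -
  have mono: "0 \<le> moment_coeff q j" "moment_coeff q j \<le> moment_coeff p j" for j
    using moment_coeff_mono[of q p j] assms by auto
  have p_nonneg: "0 \<le> p m" if "m \<ge> 2" for m using assms(1,2)[OF that] by linarith
  let ?f = "\<lambda>p k. 2 ^ k * p (Suc k) * moment_coeff p (n - k)"
  have nn: "0 \<le> moment_coeff p j" for j using mono[of j] by linarith
  have "(\<Sum>i\<in>{1..n} - {k}. ?f q i) \<le> (\<Sum>i\<in>{1..n} - {k}. ?f p i)"
    using assms mono nn p_nonneg by (intro sum_mono mult_mono mult_nonneg_nonneg) auto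
  moreover have "?f q k + 2 ^ k * (p (Suc k) - q (Suc k)) * moment_coeff p (n - k) \<le> ?f p k"
  proof -
    have "2 ^ k * q (Suc k) * moment_coeff q (n - k) \<le> 2 ^ k * q (Suc k) * moment_coeff p (n - k)"
      using assms mono by (intro mult_left_mono) auto
    thus ?thesis by (simp add: algebra_simps)
  qed
  moreover have "(\<Sum>i=1..n. ?f p' i) = ?f p' k + (\<Sum>i\<in>{1..n} - {k}. ?f p' i)" for p'
    using assms(3,4) by (intro sum.remove) auto
  ultimately show ?thesis unfolding Suc_mult_moment_coeff by (simp only:)
qed

text \<open>The cube term contributes through \<open>\<kappa>\<^sub>3 \<kappa>\<^sub>3\<close>, which needs at least the sixth moment.\<close>

lemma moment_coeff_product_rigid:
  assumes le: "\<And>m. m \<ge> 2 \<Longrightarrow> product_powersum m \<le> p m"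
    and "3 \<le> r" and top: "moment_coeff p (2 * r) \<le> moment_coeff product_powersum (2 * r)"
  shows "p 3 \<le> 0"
proof (rule ccontr)
  assume "\<not> p 3 \<le> 0"
  have ps3: "product_powersum (Suc 2) = 0" by simp
  have step: "real (Suc n) * moment_coeff product_powersum (Suc n) + 4 * p 3 * moment_coeff p (n - 2)
      \<le> real (Suc n) * moment_coeff p (Suc n)" if "2 \<le> n" for n
    using moment_coeff_step_lower[of product_powersum p 2 n] product_powersum_nonneg le that
    by (simp add: ps3 del: of_nat_Suc)
  have mono: "0 \<le> moment_coeff product_powersum j" "moment_coeff product_powersum j \<le> moment_coeff p j" for j
    using moment_coeff_mono[of product_powersum p j] product_powersum_nonneg le by auto
  \<comment> \<open>Each use of \<open>step\<close> raises the index by 3. A positive coefficient at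
    \<open>2 * r - 6\<close> makes the one at \<open>2 * r - 3\<close> positive, and that makes the
    comparison at \<open>2 * r\<close> strict. Starting at a nonnegative index is where
    \<open>3 \<le> r\<close> enters.\<close>
  have "moment_coeff product_powersum (2 * (r - 3)) > 0"
  proof -
    have "double_fact k > 0" for k by (induction k rule: double_fact.induct) auto
    thus ?thesis unfolding moment_coeff_product_even by simp
  qed
  hence "moment_coeff p (2 * (r - 3)) > 0" using mono(2)[of "2 * (r - 3)"] by linarith
  moreover have "2 * (r - 3) = 2 * r - 4 - 2" by simp
  ultimately have "0 < 4 * p 3 * moment_coeff p (2 * r - 4 - 2)" using \<open>\<not> p 3 \<le> 0\<close> by simp
  moreover have "0 \<le> real (Suc (2 * r - 4)) * moment_coeff product_powersum (Suc (2 * r - 4))"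
    using mono(1) by simp
  ultimately have "0 < real (Suc (2 * r - 4)) * moment_coeff p (Suc (2 * r - 4))"
    using step[of "2 * r - 4"] \<open>3 \<le> r\<close> by linarith
  hence "0 < moment_coeff p (Suc (2 * r - 4))" by (simp add: zero_less_mult_iff)
  moreover have "Suc (2 * r - 4) = 2 * r - 1 - 2" using \<open>3 \<le> r\<close> by simp
  ultimately have "0 < 4 * p 3 * moment_coeff p (2 * r - 1 - 2)" using \<open>\<not> p 3 \<le> 0\<close> by simp
  hence "real (Suc (2 * r - 1)) * moment_coeff product_powersum (Suc (2 * r - 1)) <
      real (Suc (2 * r - 1)) * moment_coeff p (Suc (2 * r - 1))"
    using step[of "2 * r - 1"] \<open>3 \<le> r\<close> by linarith
  thus False using top \<open>3 \<le> r\<close> by (simp del: of_nat_Suc)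
qed

section \<open>Limiting eigenvalues\<close>

lemma diagonal_convergent_subsequence:
  fixes u :: "nat \<Rightarrow> nat \<Rightarrow> real"
  assumes bound: "\<And>n i. \<bar>u n i\<bar> \<le> B"
  obtains s where "strict_mono s" "\<And>i. convergent (\<lambda>k. u (s k) i)"
proof -
  interpret subseqs "\<lambda>i s. convergent (\<lambda>k. u (s k) i)"
  proof
    fix i and s :: "nat \<Rightarrow> nat" assume "strict_mono s"
    have "bounded (range (\<lambda>k. u (s k) i))"
      using bound by (intro boundedI[of _ B]) auto
    then obtain l r where "strict_mono (r :: nat \<Rightarrow> nat)" "((\<lambda>k. u (s k) i) \<circ> r) \<longlonglongrightarrow> l"
      using bounded_imp_convergent_subsequence by blast
    thus "\<exists>r. strict_mono r \<and> convergent (\<lambda>k. u ((s \<circ> r) k) i)"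
      by (auto simp: convergent_def o_def)
  qed
  have "convergent (\<lambda>k. u (diagseq k) i)" for i
  proof -
    have "convergent (\<lambda>k. u ((diagseq \<circ> (+) (Suc i)) k) i)"
    proof (rule diagseq_holds)
      fix r s :: "nat \<Rightarrow> nat" and n
      assume "strict_mono r" and c: "convergent (\<lambda>k. u (s k) n)"
      thus "convergent (\<lambda>k. u ((s \<circ> r) k) n)"
        using convergent_subseq_convergent[OF c] by (simp add: o_def)
    qed
    \<comment> \<open>The diagonal is a subsequence of the one chosen for coordinate
      \<open>i\<close> only from index \<open>Suc i\<close> on.\<close>
    hence "convergent (\<lambda>k. u (diagseq (k + Suc i)) i)" by (simp add: o_def add.commute)
    thus ?thesis by (subst (asm) convergent_ignore_initial_segment)
  qed
  thus ?thesis using subseq_diagseq that by blast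
qed

text \<open>Every other eigenvalue has modulus at most \<open>\<rho>\<close>, the square root of the
  remaining mass, so the other \<open>m\<close>-th powers sum to at least
  \<open>- (\<rho> ^ (m - 2) * \<rho> ^ 2)\<close>. For odd \<open>m\<close> the worst case is a
  single negative eigenvalue \<open>- \<rho>\<close>.\<close>

lemma odd_powersum_lower:
  fixes l :: "'b \<Rightarrow> real"
  assumes "finite C" "e \<in> C" "3 \<le> m"
  shows "l e ^ m - sqrt ((\<Sum>f\<in>C. l f ^ 2) - l e ^ 2) ^ m \<le> (\<Sum>f\<in>C. l f ^ m)"
proof -
  let ?R = "\<Sum>f\<in>C - {e}. l f ^ 2"
  define \<rho> where "\<rho> = sqrt ?R"
  have R: "?R = (\<Sum>f\<in>C. l f ^ 2) - l e ^ 2" using assms by (simp add: sum_diff1)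
  have \<rho>: "0 \<le> \<rho>" "\<rho> ^ 2 = ?R" unfolding \<rho>_def by (auto intro: sum_nonneg)
  obtain j where j: "m = Suc (Suc j)" using assms(3) by (metis add_2_eq_Suc le_Suc_ex numeral_3_eq_3 plus_nat.simps(2))
  have "- (\<rho> ^ j * l f ^ 2) \<le> l f ^ m" if f: "f \<in> C - {e}" for f
  proof -
    have "l f ^ 2 \<le> \<rho> ^ 2" unfolding \<rho>(2) using f assms(1) by (intro member_le_sum) auto
    hence "\<bar>l f\<bar> \<le> \<rho>" using \<rho>(1) abs_le_square_iff[of "l f" \<rho>] by simp
    hence "\<bar>l f\<bar> ^ j * l f ^ 2 \<le> \<rho> ^ j * l f ^ 2" by (intro mult_right_mono power_mono) auto
    moreover have "\<bar>l f ^ m\<bar> = \<bar>l f\<bar> ^ j * l f ^ 2" unfolding j by (simp add: power_abs power2_eq_square abs_mult)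
    ultimately show ?thesis by linarith
  qed
  hence "(\<Sum>f\<in>C - {e}. - (\<rho> ^ j * l f ^ 2)) \<le> (\<Sum>f\<in>C - {e}. l f ^ m)" by (rule sum_mono)
  moreover have "(\<Sum>f\<in>C - {e}. - (\<rho> ^ j * l f ^ 2)) = - (\<rho> ^ j * \<rho> ^ 2)"
    unfolding \<rho>(2) by (simp add: sum_negf sum_distrib_left)
  moreover have "(\<Sum>f\<in>C - {e}. l f ^ m) = (\<Sum>f\<in>C. l f ^ m) - l e ^ m" using assms by (simp add: sum_diff1)
  ultimately show ?thesis unfolding R[symmetric] \<rho>_def[symmetric] j by (simp add: power2_eq_square mult_ac)
qed

lemma powersum_log_convex:
  fixes l :: "'b \<Rightarrow> real"
  shows "(\<Sum>f\<in>C. l f ^ (2 * k + 2))\<^sup>2 \<le> (\<Sum>f\<in>C. l f ^ (2 * k)) * (\<Sum>f\<in>C. l f ^ (2 * k + 4))"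
proof -
  have "(\<Sum>f\<in>C. l f ^ k * l f ^ (k + 2))\<^sup>2 \<le> (\<Sum>f\<in>C. (l f ^ k)\<^sup>2) * (\<Sum>f\<in>C. (l f ^ (k + 2))\<^sup>2)"
    by (rule Cauchy_Schwarz_ineq_sum)
  moreover have "l f ^ k * l f ^ (k + 2) = l f ^ (2 * k + 2)" "(l f ^ k)\<^sup>2 = l f ^ (2 * k)"
    "(l f ^ (k + 2))\<^sup>2 = l f ^ (2 * k + 4)" for f
    by (simp_all add: power_mult power_add power2_eq_square power_mult_distrib numeral_eq_Suc mult_ac)
  ultimately show ?thesis by (simp only:)
qed

lemma abs_powersum_le:
  fixes l :: "'b \<Rightarrow> real"
  assumes "finite C" "(\<Sum>f\<in>C. l f ^ 2) \<le> 1" "2 \<le> m"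
  shows "\<bar>\<Sum>f\<in>C. l f ^ m\<bar> \<le> 1"
proof -
  obtain j where j: "m = j + 2" using assms(3) by (metis add.commute le_Suc_ex)
  have "\<bar>\<Sum>f\<in>C. l f ^ m\<bar> \<le> (\<Sum>f\<in>C. l f ^ 2)"
  proof (rule order_trans[OF sum_abs], rule sum_mono)
    fix f assume f: "f \<in> C"
    have "l f ^ 2 \<le> (\<Sum>f\<in>C. l f ^ 2)" using f assms(1) by (intro member_le_sum) auto
    hence "\<bar>l f\<bar> \<le> 1" using assms(2) abs_square_le_1[of "l f"] by linarith
    hence "\<bar>l f\<bar> ^ j * l f ^ 2 \<le> 1 * l f ^ 2" by (intro mult_right_mono) (auto intro: power_le_one)
    thus "\<bar>l f ^ m\<bar> \<le> l f ^ 2" unfolding j by (simp only: power_add abs_mult power_abs) simp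
  qed
  thus ?thesis using assms(2) by linarith
qed

text \<open>Log-convexity makes the ratios of consecutive even terms nondecreasing, and the first
  ratio is at least 1/4. The induction carries the lower bound together with the ratio bound,
  because the former supplies the positivity needed for cancelling.\<close>

lemma even_limit_lower:
  fixes \<pi> :: "nat \<Rightarrow> real"
  assumes "\<pi> 2 = 1/2" "\<pi> 4 \<ge> 1/8"
    and convex: "\<And>k. k \<ge> 1 \<Longrightarrow> (\<pi> (2 * k + 2))\<^sup>2 \<le> \<pi> (2 * k) * \<pi> (2 * k + 4)"
    and "k \<ge> 1"
  shows "product_powersum (2 * k) \<le> \<pi> (2 * k)"
proof -
  have "product_powersum (2 * k) \<le> \<pi> (2 * k) \<and> \<pi> (2 * k) \<le> 4 * \<pi> (2 * k + 2)"
    using \<open>k \<ge> 1\<close>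
  proof (induction k rule: dec_induct)
    case base
    show ?case using assms(1,2) by (simp only: product_powersum_even) (simp add: numeral_eq_Suc)
  next
    case (step k)
    have pos: "product_powersum (2 * k) > 0" by simp
    have a: "product_powersum (2 * Suc k) \<le> \<pi> (2 * Suc k)"
    proof -
      have "2 / 4 ^ k \<le> 4 * \<pi> (2 * k + 2)"
        using step.IH unfolding product_powersum_even by linarith
      thus ?thesis by (simp only: product_powersum_even) (simp add: field_simps)
    qed
    have "\<pi> (2 * k + 2) * \<pi> (2 * k + 2) \<le> \<pi> (2 * k) * \<pi> (2 * k + 4)"
      using convex step.hyps by (simp add: power2_eq_square)
    hence "\<pi> (2 * k) * \<pi> (2 * k + 2) \<le> 4 * (\<pi> (2 * k) * \<pi> (2 * k + 4))"
      using mult_right_mono[of "\<pi> (2 * k)" "4 * \<pi> (2 * k + 2)" "\<pi> (2 * k + 2)"] step.IH pos by linarith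
    hence "\<pi> (2 * k + 2) \<le> 4 * \<pi> (2 * k + 4)" using step.IH pos
      by (metis mult.left_commute mult_le_cancel_left_pos less_le_trans)
    moreover have "2 * Suc k = 2 * k + 2" "2 * Suc k + 2 = 2 * k + 4" by auto
    ultimately show ?case using a by (simp only:)
  qed
  thus ?thesis ..
qed

text \<open>The hypothesis on \<open>e\<close> normalises the sign: an eigenvalue of largest modulus
  is nonnegative. This yields the comparison required by \<open>moment_coeff_product_rigid\<close>.
  The pair of eigenvalues is then extracted from the limits of the top eigenvalue and of the second
  and third power sums.\<close>

lemma limiting_eigenvalues_signed:
  fixes l :: "nat \<Rightarrow> 'b \<Rightarrow> real"
    and C :: "nat \<Rightarrow> 'b set" and p :: "nat \<Rightarrow> nat \<Rightarrow> real"
  assumes p_def: "\<And>n m. p n m = (\<Sum>f\<in>C n. l n f ^ m)"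
    and fin: "\<And>n. finite (C n)" and e: "\<And>n. e n \<in> C n" "\<And>n f. f \<in> C n \<Longrightarrow> \<bar>l n f\<bar> \<le> l n (e n)"
    and p2_le: "\<And>n. p n 2 \<le> 1"
    and p2: "(\<lambda>n. p n 2) \<longlonglongrightarrow> 1/2" and p4: "(\<lambda>n. p n 4) \<longlonglongrightarrow> L" "1/8 \<le> L"
    and top: "(\<lambda>n. moment_coeff (p n) (2 * r)) \<longlonglongrightarrow> B" "B \<le> moment_coeff product_powersum (2 * r)" "3 \<le> r"
  obtains s e' where "strict_mono s" "eventually (\<lambda>k. e' k \<in> C (s k) - {e (s k)}) sequentially"
    "(\<lambda>k. l (s k) (e (s k))) \<longlonglongrightarrow> 1/2" "(\<lambda>k. l (s k) (e' k)) \<longlonglongrightarrow> -1/2"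
    "(\<lambda>k. \<Sum>f\<in>C (s k) - {e (s k), e' k}. l (s k) f ^ 2) \<longlonglongrightarrow> 0"
proof -
  define x where "x n = l n (e n)" for n
  have x0: "0 \<le> x n" for n using e(2)[OF e(1)[of n]] by (simp add: x_def)
  have x2: "x n ^ 2 \<le> p n 2" for n unfolding p_def x_def using e fin by (intro member_le_sum) auto
  hence x1: "x n \<le> 1" for n using p2_le[of n] x2[of n] x0[of n] by (metis abs_of_nonneg abs_square_le_1 order_trans)
  \<comment> \<open>One array for the diagonal argument: coordinate 0 holds the top eigenvalue, the
    others the power sums. The first power sum is a trace, which the mass does not bound, so 0
    stands in coordinate 1.\<close>
  define u where "u n i = (if i = 0 then x n else if i = 1 then 0 else p n i)" for n i
  have "\<bar>u n i\<bar> \<le> 1" for n i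
    using x0[of n] x1[of n] abs_powersum_le[OF fin p2_le[unfolded p_def], of i n] by (auto simp: u_def p_def)
  then obtain s where s: "strict_mono s" and conv: "\<And>i. convergent (\<lambda>k. u (s k) i)"
    using diagonal_convergent_subsequence by metis
  define \<xi> where "\<xi> = lim (\<lambda>k. x (s k))"
  define \<pi> where "\<pi> m = lim (\<lambda>k. p (s k) m)" for m
  have \<xi>: "(\<lambda>k. x (s k)) \<longlonglongrightarrow> \<xi>" using conv[of 0] by (simp add: u_def \<xi>_def convergent_LIMSEQ_iff)
  have \<pi>: "(\<lambda>k. p (s k) m) \<longlonglongrightarrow> \<pi> m" if "m \<ge> 2" for m
    using conv[of m] that by (simp add: u_def \<pi>_def convergent_LIMSEQ_iff)
  note sub = LIMSEQ_subseq_LIMSEQ[OF _ s, unfolded o_def]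
  have \<pi>2: "\<pi> 2 = 1/2" using LIMSEQ_unique[OF \<pi> sub[OF p2]] by simp
  have \<pi>4: "\<pi> 4 \<ge> 1/8" using LIMSEQ_unique[OF \<pi> sub[OF p4(1)]] p4(2) by simp
  \<comment> \<open>Since \<open>x n\<close> is the largest modulus, a fourth power is at most
    \<open>x n ^ 2\<close> times the square. In the limit this reads 1/8 \<le>
    \<open>\<xi> ^ 2 / 2\<close>.\<close>
  have p4_le: "p n 4 \<le> x n ^ 2 * p n 2" for n
  proof -
    have "l n f ^ 4 \<le> x n ^ 2 * l n f ^ 2" if "f \<in> C n" for f
    proof -
      have "l n f ^ 2 \<le> x n ^ 2" using e(2)[OF that] x0[of n] abs_le_square_iff[of "l n f" "x n"] by (simp add: x_def)
      hence "l n f ^ 2 * l n f ^ 2 \<le> x n ^ 2 * l n f ^ 2" by (intro mult_right_mono) auto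
      thus ?thesis by (simp flip: power_add)
    qed
    thus ?thesis unfolding p_def sum_distrib_left by (intro sum_mono)
  qed
  have "\<pi> 4 \<le> \<xi> ^ 2 * \<pi> 2"
    by (rule LIMSEQ_le[OF \<pi> tendsto_mult[OF tendsto_power[OF \<xi>] \<pi>]]) (use p4_le in auto)
  hence "(1/2) ^ 2 \<le> \<xi> ^ 2" using \<pi>2 \<pi>4 by (simp add: power2_eq_square)
  moreover have \<xi>0: "0 \<le> \<xi>" using \<xi> x0 by (intro LIMSEQ_le_const[OF \<xi>]) auto
  ultimately have \<xi>_ge: "1/2 \<le> \<xi>" using power2_le_imp_le by blast
  \<comment> \<open>The square root of the mass left beside the top eigenvalue. As
    \<open>\<xi> ^ 2\<close> is at least half of 1/2, it follows that
    \<open>\<rho> \<le> \<xi>\<close>, which makes the bound \<open>odd_lower\<close>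
    nonnegative.\<close>
  define \<rho> where "\<rho> = sqrt (1/2 - \<xi> ^ 2)"
  have \<rho>_lim: "(\<lambda>k. sqrt (p (s k) 2 - x (s k) ^ 2)) \<longlonglongrightarrow> \<rho>"
    unfolding \<rho>_def using sub[OF p2] \<xi> by (intro tendsto_intros) auto
  have "\<xi> ^ 2 \<le> \<pi> 2"
    by (rule LIMSEQ_le[OF tendsto_power[OF \<xi>] \<pi>]) (use x2 in auto)
  hence \<rho>: "0 \<le> \<rho>" "\<rho> ^ 2 = 1/2 - \<xi> ^ 2" using \<pi>2 by (auto simp: \<rho>_def)
  have "\<rho> ^ 2 \<le> \<xi> ^ 2" using \<open>(1/2) ^ 2 \<le> \<xi> ^ 2\<close> \<rho>(2) by (simp add: power2_eq_square)
  hence \<rho>_le: "\<rho> \<le> \<xi>" using \<xi>0 power2_le_imp_le by blast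
  have odd_lower: "\<xi> ^ m - \<rho> ^ m \<le> \<pi> m" if "m \<ge> 3" for m
  proof (rule LIMSEQ_le)
    show "(\<lambda>k. x (s k) ^ m - sqrt (p (s k) 2 - x (s k) ^ 2) ^ m) \<longlonglongrightarrow> \<xi> ^ m - \<rho> ^ m"
      using \<xi> \<rho>_lim by (intro tendsto_intros)
    show "(\<lambda>k. p (s k) m) \<longlonglongrightarrow> \<pi> m" using that by (intro \<pi>) auto
    show "\<exists>N. \<forall>k\<ge>N. x (s k) ^ m - sqrt (p (s k) 2 - x (s k) ^ 2) ^ m \<le> p (s k) m"
      unfolding p_def x_def using odd_powersum_lower[OF fin e(1) that] by blast
  qed
  have "product_powersum m \<le> \<pi> m" if "m \<ge> 2" for m
  proof (cases "even m")
    case True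
    then obtain k where "m = 2 * k" by (auto elim!: evenE)
    hence k: "m = 2 * k" "k \<ge> 1" using that by auto
    have "(\<pi> (2 * j + 2))\<^sup>2 \<le> \<pi> (2 * j) * \<pi> (2 * j + 4)" if "j \<ge> 1" for j
      by (rule LIMSEQ_le[OF tendsto_power[OF \<pi>] tendsto_mult[OF \<pi> \<pi>]])
        (use that powersum_log_convex in \<open>auto simp: p_def\<close>)
    thus ?thesis using even_limit_lower[of \<pi> k] \<pi>2 \<pi>4 k by blast
  next
    case False
    hence "m \<ge> 3" using that by (cases "m = 2") auto
    have "\<rho> ^ m \<le> \<xi> ^ m" using \<rho> \<rho>_le by (intro power_mono)
    thus ?thesis using odd_lower[OF \<open>m \<ge> 3\<close>] False by simp
  qed
  moreover have "moment_coeff \<pi> (2 * r) \<le> moment_coeff product_powersum (2 * r)"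
    using LIMSEQ_unique[OF sub[OF top(1)] tendsto_moment_coeff[OF \<pi>]] top(2) by simp
  ultimately have "\<pi> 3 \<le> 0" using moment_coeff_product_rigid top(3) by blast
  \<comment> \<open>The cube bound is now read in the other direction:
    \<open>\<pi> 3 \<le> 0\<close> forces the top eigenvalue to hold at most half of the mass, hence
    exactly half.\<close>
  moreover have "\<xi> \<le> \<rho>"
  proof -
    have "\<xi> ^ 3 \<le> \<rho> ^ 3" using odd_lower[of 3] \<open>\<pi> 3 \<le> 0\<close> by simp
    thus ?thesis using power_mono_iff[of \<xi> \<rho> 3] \<xi>0 \<rho>(1) by simp
  qed
  hence "\<xi> = \<rho>" using \<rho>_le by simp
  hence "\<xi> ^ 2 = (1/2) ^ 2" using \<rho>(2) by (simp add: power2_eq_square)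
  hence \<xi>_eq: "\<xi> = 1/2" using \<xi>0 power2_eq_iff_nonneg by fastforce
  ultimately have \<pi>3: "\<pi> 3 = 0" using odd_lower[of 3] \<open>\<xi> = \<rho>\<close> by simp

  define R where "R k = p (s k) 2 - x (s k) ^ 2" for k
  have R_sum: "R k = (\<Sum>f\<in>C (s k) - {e (s k)}. l (s k) f ^ 2)" for k
    using fin e(1) by (simp add: R_def p_def x_def sum_diff1)
  have R: "R \<longlonglongrightarrow> 1/4" unfolding R_def
    using tendsto_diff[OF \<pi>[of 2] tendsto_power[OF \<xi>, of 2]] by (simp add: \<pi>2 \<xi>_eq power2_eq_square)
  hence R_pos: "eventually (\<lambda>k. R k > 0) sequentially" by (rule order_tendstoD) simp
  \<comment> \<open>The candidate for -1/2 is the least remaining eigenvalue. It is meaningful only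
    where \<open>R k > 0\<close>, which holds eventually.\<close>
  define e' where "e' k = arg_min_on (l (s k)) (C (s k) - {e (s k)})" for k
  have e': "e' k \<in> C (s k) - {e (s k)}" "\<And>f. f \<in> C (s k) - {e (s k)} \<Longrightarrow> l (s k) (e' k) \<le> l (s k) f"
    if "R k > 0" for k
  proof -
    have "C (s k) - {e (s k)} \<noteq> {}" using that R_sum[of k] by (metis less_irrefl sum.empty)
    thus "e' k \<in> C (s k) - {e (s k)}" "\<And>f. f \<in> C (s k) - {e (s k)} \<Longrightarrow> l (s k) (e' k) \<le> l (s k) f"
      unfolding e'_def using fin arg_min_if_finite(1)[of "C (s k) - {e (s k)}" "l (s k)"]
        arg_min_least[of "C (s k) - {e (s k)}" _ "l (s k)"] by auto
  qed
  define y where "y k = l (s k) (e' k)" for k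
  have y_upper: "eventually (\<lambda>k. - y k \<le> sqrt (R k)) sequentially"
    using R_pos
  proof eventually_elim
    case (elim k)
    have "y k ^ 2 \<le> R k" unfolding R_sum y_def using e'[OF elim] fin by (intro member_le_sum) auto
    thus ?case using real_le_rsqrt[of "- y k" "R k"] by simp
  qed
  \<comment> \<open>The quotient is the mean of the negated remaining eigenvalues with weights
    proportional to their squares, so it is at most their maximum \<open>- y k\<close>. Both it and
    the upper bound \<open>sqrt (R k)\<close> tend to 1/2.\<close>
  have y_lower: "eventually (\<lambda>k. (x (s k) ^ 3 - p (s k) 3) / R k \<le> - y k) sequentially"
    using R_pos
  proof eventually_elim
    case (elim k)
    have "x (s k) ^ 3 - p (s k) 3 = (\<Sum>f\<in>C (s k) - {e (s k)}. - (l (s k) f ^ 3))"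
      using fin e(1) by (simp add: p_def x_def sum_diff1 sum_negf)
    also have "\<dots> \<le> (\<Sum>f\<in>C (s k) - {e (s k)}. - y k * l (s k) f ^ 2)"
    proof (rule sum_mono)
      fix f assume "f \<in> C (s k) - {e (s k)}"
      hence "y k * l (s k) f ^ 2 \<le> l (s k) f * l (s k) f ^ 2"
        unfolding y_def by (intro mult_right_mono e'[OF elim]) auto
      thus "- (l (s k) f ^ 3) \<le> - y k * l (s k) f ^ 2" by (simp add: power3_eq_cube power2_eq_square)
    qed
    also have "\<dots> = - y k * R k" unfolding R_sum by (simp add: sum_distrib_left)
    finally show ?case using elim by (simp add: divide_simps)
  qed
  have "(\<lambda>k. - y k) \<longlonglongrightarrow> 1/2"
  proof (rule tendsto_sandwich[OF y_lower y_upper])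
    have "(\<lambda>k. (x (s k) ^ 3 - p (s k) 3) / R k) \<longlonglongrightarrow> (\<xi> ^ 3 - \<pi> 3) / (1/4)"
      using R by (intro tendsto_divide tendsto_diff tendsto_power \<xi> \<pi>) auto
    thus "(\<lambda>k. (x (s k) ^ 3 - p (s k) 3) / R k) \<longlonglongrightarrow> 1/2" by (simp add: \<xi>_eq \<pi>3 power3_eq_cube)
    show "(\<lambda>k. sqrt (R k)) \<longlonglongrightarrow> 1/2" using tendsto_real_sqrt[OF R] by (simp add: real_sqrt_divide)
  qed
  hence y: "y \<longlonglongrightarrow> - 1/2" using tendsto_minus by fastforce
  \<comment> \<open>The single eigenvalue \<open>y k\<close> exhausts the remaining mass 1/4, so all
    others vanish in the limit.\<close>
  have "(\<lambda>k. R k - y k ^ 2) \<longlonglongrightarrow> 1/4 - (-1/2) ^ 2" using R y by (intro tendsto_intros)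
  hence lim0: "(\<lambda>k. R k - y k ^ 2) \<longlonglongrightarrow> 0" by (simp add: power2_eq_square)
  have "(\<lambda>k. \<Sum>f\<in>C (s k) - {e (s k), e' k}. l (s k) f ^ 2) \<longlonglongrightarrow> 0"
  proof (rule Lim_transform_eventually[OF lim0])
    show "eventually (\<lambda>k. R k - y k ^ 2 = (\<Sum>f\<in>C (s k) - {e (s k), e' k}. l (s k) f ^ 2)) sequentially"
      using R_pos
    proof eventually_elim
      case (elim k)
      have "C (s k) - {e (s k), e' k} = C (s k) - {e (s k)} - {e' k}" by auto
      thus ?case using e'[OF elim] fin by (simp add: R_sum y_def sum_diff1)
    qed
  qed
  moreover have "eventually (\<lambda>k. e' k \<in> C (s k) - {e (s k)}) sequentially"
    using R_pos by eventually_elim (rule e')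
  ultimately show ?thesis using that[OF s] \<xi> y unfolding x_def y_def \<xi>_eq by blast
qed

text \<open>Multiplying all eigenvalues by a sign makes one of largest modulus nonnegative. Even
  power sums and even moments do not notice this, so the signed version applies and the sign is
  undone afterwards.\<close>

lemma limiting_eigenvalues:
  fixes l :: "nat \<Rightarrow> 'b \<Rightarrow> real"
    and C :: "nat \<Rightarrow> 'b set" and p :: "nat \<Rightarrow> nat \<Rightarrow> real"
  assumes p_def: "\<And>n m. p n m = (\<Sum>f\<in>C n. l n f ^ m)"
    and fin: "\<And>n. finite (C n)"
    and p2: "(\<lambda>n. p n 2) \<longlonglongrightarrow> 1/2" and p4: "(\<lambda>n. p n 4) \<longlonglongrightarrow> L" "1/8 \<le> L"
    and top: "(\<lambda>n. moment_coeff (p n) (2 * r)) \<longlonglongrightarrow> B" "B \<le> moment_coeff product_powersum (2 * r)" "3 \<le> r"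
  obtains s a b where "strict_mono s"
    "eventually (\<lambda>k. a k \<in> C (s k) \<and> b k \<in> C (s k) \<and> a k \<noteq> b k) sequentially"
    "(\<lambda>k. l (s k) (a k)) \<longlonglongrightarrow> 1/2" "(\<lambda>k. l (s k) (b k)) \<longlonglongrightarrow> -1/2"
    "(\<lambda>k. \<Sum>f\<in>C (s k) - {a k, b k}. l (s k) f ^ 2) \<longlonglongrightarrow> 0"
proof -
  \<comment> \<open>Positivity makes the index sets nonempty, so that a largest modulus exists; the
    upper bound is a hypothesis of the signed version. Finitely many terms are dropped for
    both.\<close>
  have "eventually (\<lambda>n. p n 2 > 0 \<and> p n 2 < 1) sequentially"
    using order_tendstoD[OF p2, of 0] order_tendstoD[OF p2, of 1] by (simp add: eventually_conj)
  then obtain N where N: "\<And>n. n \<ge> N \<Longrightarrow> p n 2 > 0 \<and> p n 2 < 1" by (auto simp: eventually_sequentially)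
  define C' l' where "C' n = C (n + N)" and "l' n = l (n + N)" for n
  have ne: "C' n \<noteq> {}" for n using N[of "n + N"] by (auto simp: C'_def p_def)
  have "\<exists>f\<in>C' n. \<forall>g\<in>C' n. \<bar>l' n g\<bar> \<le> \<bar>l' n f\<bar>" for n
    using ne[of n] fin[of "n + N"] finite_has_maximal[of "(\<lambda>f. \<bar>l' n f\<bar>) ` C' n"]
    by (fastforce simp: C'_def)
  then obtain e where e: "\<And>n. e n \<in> C' n" "\<And>n f. f \<in> C' n \<Longrightarrow> \<bar>l' n f\<bar> \<le> \<bar>l' n (e n)\<bar>"
    by metis
  define \<sigma> :: "nat \<Rightarrow> real" where "\<sigma> n = (if 0 \<le> l' n (e n) then 1 else -1)" for n
  define p' where "p' n m = (\<Sum>f\<in>C' n. (\<sigma> n * l' n f) ^ m)" for n m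
  have p': "p' n = (\<lambda>m. \<sigma> n ^ m * p (n + N) m)" for n
    by (simp add: fun_eq_iff p'_def p_def C'_def l'_def power_mult_distrib sum_distrib_left)
  have even: "\<sigma> n ^ m = 1" if "even m" for n m using that by (simp add: \<sigma>_def)
  obtain s e' where s: "strict_mono s" and e': "eventually (\<lambda>k. e' k \<in> C' (s k) - {e (s k)}) sequentially"
    and lim: "(\<lambda>k. \<sigma> (s k) * l' (s k) (e (s k))) \<longlonglongrightarrow> 1/2" "(\<lambda>k. \<sigma> (s k) * l' (s k) (e' k)) \<longlonglongrightarrow> -1/2"
    "(\<lambda>k. \<Sum>f\<in>C' (s k) - {e (s k), e' k}. (\<sigma> (s k) * l' (s k) f) ^ 2) \<longlonglongrightarrow> 0"
  proof (rule limiting_eigenvalues_signed[where p = p' and C = C' and l = "\<lambda>n f. \<sigma> n * l' n f"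
        and e = e and L = L and r = r and B = B])
    show "(\<lambda>n. p' n 2) \<longlonglongrightarrow> 1/2" "(\<lambda>n. p' n 4) \<longlonglongrightarrow> L"
      using LIMSEQ_ignore_initial_segment[OF p2, of N] LIMSEQ_ignore_initial_segment[OF p4(1), of N]
      by (simp_all add: p' even)
    show "(\<lambda>n. moment_coeff (p' n) (2 * r)) \<longlonglongrightarrow> B"
      using LIMSEQ_ignore_initial_segment[OF top(1), of N]
      unfolding p' moment_coeff_scale by (simp add: even)
    show "p' n 2 \<le> 1" for n using N[of "n + N"] by (simp add: p' even less_imp_le)
    show "\<bar>\<sigma> n * l' n f\<bar> \<le> \<sigma> n * l' n (e n)" if "f \<in> C' n" for n f
      using e(2)[OF that] by (auto simp: \<sigma>_def)
  qed (use e fin p4 top in \<open>auto simp: p'_def C'_def\<close>)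
  \<comment> \<open>Undoing a flip exchanges the roles of the two eigenvalues. The sign may keep
    changing along the subsequence, so the limits are taken of conditional expressions with equal
    limits on both branches.\<close>
  define a b where "a k = (if 0 \<le> l' (s k) (e (s k)) then e (s k) else e' k)"
    and "b k = (if 0 \<le> l' (s k) (e (s k)) then e' k else e (s k))" for k
  have If_lim: "(\<lambda>k. if Q k then f k else g k) \<longlonglongrightarrow> c"
    if "f \<longlonglongrightarrow> c" "g \<longlonglongrightarrow> c" for f g :: "nat \<Rightarrow> real" and c Q
    using that by (intro filterlim_If tendsto_mono[OF inf_le1])
  have "(\<lambda>k. l' (s k) (a k)) =
      (\<lambda>k. if 0 \<le> l' (s k) (e (s k)) then \<sigma> (s k) * l' (s k) (e (s k)) else - (\<sigma> (s k) * l' (s k) (e' k)))"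
    by (auto simp: a_def \<sigma>_def)
  moreover have "\<dots> \<longlonglongrightarrow> 1/2"
    using lim(1) tendsto_minus[OF lim(2)] by (intro If_lim) simp_all
  ultimately have "(\<lambda>k. l' (s k) (a k)) \<longlonglongrightarrow> 1/2" by simp
  moreover have "(\<lambda>k. l' (s k) (b k)) =
      (\<lambda>k. if 0 \<le> l' (s k) (e (s k)) then \<sigma> (s k) * l' (s k) (e' k) else - (\<sigma> (s k) * l' (s k) (e (s k))))"
    by (auto simp: b_def \<sigma>_def)
  moreover have "\<dots> \<longlonglongrightarrow> -1/2"
    using lim(2) tendsto_minus[OF lim(1)] by (intro If_lim) simp_all
  moreover have "{a k, b k} = {e (s k), e' k}" for k by (auto simp: a_def b_def)
  hence "(\<lambda>k. \<Sum>f\<in>C' (s k) - {a k, b k}. (l' (s k) f) ^ 2) \<longlonglongrightarrow> 0"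
    using lim(3) by (simp add: power_mult_distrib even)
  moreover have "eventually (\<lambda>k. a k \<in> C' (s k) \<and> b k \<in> C' (s k) \<and> a k \<noteq> b k) sequentially"
    using e' by eventually_elim (use e in \<open>auto simp: a_def b_def\<close>)
  moreover have "strict_mono (\<lambda>k. s k + N)" using s by (simp add: strict_mono_def)
  ultimately show ?thesis
    using that[of "\<lambda>k. s k + N" a b] unfolding C'_def l'_def by simp
qed

section \<open>Moments of diagonal quadratic forms\<close>

lemma integrable_std_normal_poly:
  "integrable std_normal_distribution (\<lambda>x. poly p (x\<^sup>2))"
  unfolding poly_altdef using std_normal_distribution_even_moments(2)
  by (intro Bochner_Integration.integrable_sum integrable_mult_right) (simp flip: power_mult)

text \<open>Stein's identity E(X f(X)) = E(f'(X)) for f(x) = x p(x^2). On monomials it is the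
  recursion of the even normal moments; linearity does the rest.\<close>

lemma std_normal_stein:
  "(\<integral>x. poly (pCons 0 p) (x\<^sup>2) \<partial>std_normal_distribution) =
    (\<integral>x. poly p (x\<^sup>2) \<partial>std_normal_distribution) +
    2 * (\<integral>x. poly (pCons 0 (pderiv p)) (x\<^sup>2) \<partial>std_normal_distribution)" (is "?Q p")
proof -
  note int = integrable_std_normal_poly
  have mom: "(\<integral>x. x ^ (2 * Suc k) \<partial>std_normal_distribution) =
      (2 * real k + 1) * (\<integral>x. x ^ (2 * k) \<partial>std_normal_distribution)" for k
  proof -
    have "fact (2 * Suc k) = (2 * (real k + 1)) * ((2 * real k + 1) * fact (2 * k))"
      "fact (Suc k) = (real k + 1) * fact k" by (simp_all add: algebra_simps)
    thus ?thesis unfolding std_normal_distribution_even_moments(1)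
      by (simp add: divide_simps del: fact_Suc)
  qed
  have monom: "?Q (monom c k)" for c k
  proof -
    have "poly (pCons 0 (monom c k)) (x\<^sup>2) = c * x ^ (2 * Suc k)" for x
      by (simp add: poly_monom power_mult power2_eq_square)
    moreover have "poly (monom c k) (x\<^sup>2) = c * x ^ (2 * k)" for x
      by (simp add: poly_monom power_mult)
    moreover have "poly (pCons 0 (pderiv (monom c k))) (x\<^sup>2) = (c * real k) * x ^ (2 * k)" for x
      by (cases k) (simp_all add: poly_monom pderiv_monom power_mult power2_eq_square)
    ultimately show ?thesis using mom[of k] by (simp only: integral_mult_right_zero) (simp add: algebra_simps)
  qed
  have add: "?Q (p + q)" if "?Q p" "?Q q" for p q
  proof -
    have "pCons 0 (p + q) = pCons 0 p + pCons 0 q" "pCons 0 (pderiv (p + q)) = pCons 0 (pderiv p) + pCons 0 (pderiv q)"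
      by (simp_all add: pderiv_add)
    thus ?thesis using that by (simp only: poly_add Bochner_Integration.integral_add int) (simp add: algebra_simps)
  qed
  have "?Q (\<Sum>i\<in>I. monom (coeff p i) i)" if "finite I" for I
    using that
  proof (induction I)
    case empty show ?case by simp
  next
    case (insert i I)
    show ?case unfolding sum.insert[OF insert.hyps] by (rule add[OF monom insert.IH])
  qed
  from this[of "{..degree p}"] show ?thesis unfolding poly_as_sum_of_monoms by simp
qed

text \<open>Stein's identity for p(t) = (t - 1)^(n+1), where the factor x^2 on both sides is written
  as (x^2 - 1) + 1.\<close>

lemma std_normal_hermite_moment_Suc:
  fixes y :: "nat \<Rightarrow> real"
  defines "y \<equiv> \<lambda>n. \<integral>x. (x\<^sup>2 - 1) ^ n \<partial>std_normal_distribution"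
  shows "y 0 = 1" "y (Suc 0) = 0" "y (Suc (Suc n)) = 2 * real (Suc n) * (y (Suc n) + y n)"
    "integrable std_normal_distribution (\<lambda>x. (x\<^sup>2 - 1) ^ n)"
proof -
  interpret N: real_distribution std_normal_distribution by (rule real_dist_normal_dist)
  let ?h = "\<lambda>n. [:-1, 1:] ^ n :: real poly"
  have h: "poly (?h n) (x\<^sup>2) = (x\<^sup>2 - 1) ^ n" for n and x :: real by (simp add: poly_power)
  have int: "integrable std_normal_distribution (\<lambda>x. (x\<^sup>2 - 1) ^ n)" for n
    using integrable_std_normal_poly[of "?h n"] by (simp add: h)
  thus "integrable std_normal_distribution (\<lambda>x. (x\<^sup>2 - 1) ^ n)" .
  show "y 0 = 1" using N.prob_space by (simp add: y_def)
  have yf: "(\<integral>x. (x\<^sup>2 - 1) ^ n \<partial>std_normal_distribution) = y n" for n by (simp add: y_def)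
  have mult: "poly (pCons 0 (?h n)) (x\<^sup>2) = (x\<^sup>2 - 1) ^ Suc n + (x\<^sup>2 - 1) ^ n" for n and x :: real
    by (simp add: h algebra_simps)
  have Ey: "(\<integral>x. poly (pCons 0 (?h n)) (x\<^sup>2) \<partial>std_normal_distribution) = y (Suc n) + y n" for n
    unfolding mult y_def by (intro Bochner_Integration.integral_add int)
  have y0: "y (Suc 0) + y 0 = y 0"
    using std_normal_stein[of "?h 0"] Ey[of 0] by (simp add: pderiv_1 y_def)
  thus "y (Suc 0) = 0" by simp
  have d: "poly (pCons 0 (pderiv (?h (Suc n)))) (x\<^sup>2) = real (Suc n) * poly (pCons 0 (?h n)) (x\<^sup>2)" for x :: real
    unfolding pderiv_power_Suc by (simp add: pderiv_pCons)
  show "y (Suc (Suc n)) = 2 * real (Suc n) * (y (Suc n) + y n)"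
    using std_normal_stein[of "?h (Suc n)"] unfolding Ey d integral_mult_right_zero
    unfolding h yf by simp
qed

text \<open>The moment generating function as a formal power series, so that no question of
  convergence arises.\<close>

definition egf :: "(nat \<Rightarrow> real) \<Rightarrow> real fps" where
  "egf a = Abs_fps (\<lambda>n. a n / fact n)"

text \<open>The expansion of 2 c^2 t / (1 - 2 c t), the logarithmic derivative of the moment
  generating function exp(-c t) (1 - 2 c t)^(-1/2) of c (N^2 - 1).\<close>

definition chi_kernel :: "real \<Rightarrow> real fps" where
  "chi_kernel c = Abs_fps (\<lambda>k. if k = 0 then 0 else 2 ^ k * c ^ Suc k)"

lemma egf_binomial:
  "egf (\<lambda>n. \<Sum>k\<le>n. real (n choose k) * a k * b (n - k)) = egf a * egf b"
proof (rule fps_ext)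
  fix n
  have "(\<Sum>k\<le>n. real (n choose k) * a k * b (n - k)) / fact n = (\<Sum>k\<le>n. (a k / fact k) * (b (n - k) / fact (n - k)))"
    unfolding sum_divide_distrib by (intro sum.cong refl) (simp add: binomial_fact field_simps)
  thus "fps_nth (egf (\<lambda>n. \<Sum>k\<le>n. real (n choose k) * a k * b (n - k))) n = fps_nth (egf a * egf b) n"
    by (simp add: egf_def fps_mult_nth atMost_atLeast0)
qed

text \<open>Multiplying by \<open>U\<close>, which is 1 - 2 c t, turns the kernel into the monomial
  2 c^2 t. The coefficients of the resulting equation are the three-term recursion for the moments
  of N^2 - 1, and \<open>U\<close> can be cancelled as it is nonzero.\<close>

lemma deriv_egf_chi:
  "fps_deriv (egf (\<lambda>n. \<integral>x. (c * (x\<^sup>2 - 1)) ^ n \<partial>std_normal_distribution)) =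
    chi_kernel c * egf (\<lambda>n. \<integral>x. (c * (x\<^sup>2 - 1)) ^ n \<partial>std_normal_distribution)"
proof -
  define y where "y n = (\<integral>x. (x\<^sup>2 - 1) ^ n \<partial>std_normal_distribution)" for n
  note ys = std_normal_hermite_moment_Suc(1-3)[folded y_def]
  define A where "A = Abs_fps (\<lambda>n. c ^ n * y n / fact n)"
  have A: "egf (\<lambda>n. \<integral>x. (c * (x\<^sup>2 - 1)) ^ n \<partial>std_normal_distribution) = A"
    by (simp add: egf_def A_def y_def power_mult_distrib)
  define U where "U = 1 - fps_const (2 * c) * fps_X"
  have U0: "U \<noteq> 0" by (auto simp: U_def fps_eq_iff intro!: exI[of _ 0])
  have K: "U * chi_kernel c = fps_const (2 * c\<^sup>2) * fps_X"
  proof (rule fps_ext)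
    fix n show "fps_nth (U * chi_kernel c) n = fps_nth (fps_const (2 * c\<^sup>2) * fps_X) n"
      by (cases n; cases "n - 1")
         (simp_all add: U_def chi_kernel_def left_diff_distrib mult.assoc power2_eq_square)
  qed
  have "U * fps_deriv A = fps_const (2 * c\<^sup>2) * fps_X * A"
  proof (rule fps_ext)
    fix n
    show "fps_nth (U * fps_deriv A) n = fps_nth (fps_const (2 * c\<^sup>2) * fps_X * A) n"
    proof (cases n)
      case 0
      thus ?thesis by (simp add: U_def A_def left_diff_distrib mult.assoc ys)
    next
      case (Suc m)
      have f: "fact (Suc (Suc m)) = real (Suc (Suc m)) * fact (Suc m)" "fact (Suc m) = real (Suc m) * fact m"
        by simp_all
      have "fps_nth (U * fps_deriv A) n =
          c ^ Suc (Suc m) * y (Suc (Suc m)) / fact (Suc m) - 2 * c * (c ^ Suc m * y (Suc m) / fact m)"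
        unfolding Suc
        by (simp add: U_def A_def left_diff_distrib mult.assoc f(1) del: fact_Suc of_nat_Suc)
           (simp add: f(2) del: fact_Suc of_nat_Suc)
      also have "\<dots> = 2 * c\<^sup>2 * (c ^ m * y m / fact m)"
        unfolding ys f(2) by (simp add: field_simps power2_eq_square del: fact_Suc of_nat_Suc)
      also have "\<dots> = fps_nth (fps_const (2 * c\<^sup>2) * fps_X * A) n"
        by (simp add: Suc A_def mult.assoc)
      finally show ?thesis .
    qed
  qed
  hence "U * fps_deriv A = U * (chi_kernel c * A)" by (simp only: K mult.assoc[symmetric])
  thus ?thesis unfolding A using U0 by simp
qed

context prob_space
begin

text \<open>Binomial expansion, with the mixed moments factorising by independence.\<close>

lemma moments_add_indep:
  fixes Y Z :: "'a \<Rightarrow> real"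
  assumes ind: "indep_var borel Y borel Z"
    and int: "\<And>n. integrable M (\<lambda>\<omega>. Y \<omega> ^ n)" "\<And>n. integrable M (\<lambda>\<omega>. Z \<omega> ^ n)"
  shows "integrable M (\<lambda>\<omega>. (Y \<omega> + Z \<omega>) ^ n)"
    and "egf (\<lambda>n. \<integral>\<omega>. (Y \<omega> + Z \<omega>) ^ n \<partial>M) = egf (\<lambda>n. \<integral>\<omega>. Y \<omega> ^ n \<partial>M) * egf (\<lambda>n. \<integral>\<omega>. Z \<omega> ^ n \<partial>M)"
proof -
  have indp: "indep_var borel (\<lambda>\<omega>. Y \<omega> ^ k) borel (\<lambda>\<omega>. Z \<omega> ^ j)" for k j
    using indep_var_compose[OF ind, of "\<lambda>x. x ^ k" borel "\<lambda>x. x ^ j" borel] by (simp add: o_def)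
  have expand: "(Y \<omega> + Z \<omega>) ^ n = (\<Sum>k\<le>n. real (n choose k) * (Y \<omega> ^ k * Z \<omega> ^ (n - k)))" for \<omega> n
    by (subst binomial_ring) (simp add: mult.assoc)
  have int2: "integrable M (\<lambda>\<omega>. Y \<omega> ^ k * Z \<omega> ^ j)" for k j
    by (rule indep_var_integrable[OF indp int])
  show "integrable M (\<lambda>\<omega>. (Y \<omega> + Z \<omega>) ^ n)" unfolding expand
    by (intro Bochner_Integration.integrable_sum integrable_mult_right int2)
  have "(\<integral>\<omega>. (Y \<omega> + Z \<omega>) ^ n \<partial>M) =
      (\<Sum>k\<le>n. real (n choose k) * (\<integral>\<omega>. Y \<omega> ^ k \<partial>M) * (\<integral>\<omega>. Z \<omega> ^ (n - k) \<partial>M))" for n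
    unfolding expand
    by (subst Bochner_Integration.integral_sum)
       (auto intro!: integrable_mult_right int2 sum.cong simp: indep_var_lebesgue_integral[OF indp int])
  thus "egf (\<lambda>n. \<integral>\<omega>. (Y \<omega> + Z \<omega>) ^ n \<partial>M) = egf (\<lambda>n. \<integral>\<omega>. Y \<omega> ^ n \<partial>M) * egf (\<lambda>n. \<integral>\<omega>. Z \<omega> ^ n \<partial>M)"
    using egf_binomial[of "\<lambda>n. \<integral>\<omega>. Y \<omega> ^ n \<partial>M" "\<lambda>n. \<integral>\<omega>. Z \<omega> ^ n \<partial>M"] by simp
qed

text \<open>Generating functions of independent summands multiply, so their logarithmic derivatives
  add. The coefficients of the summed kernels are 2^k p_(k+1), and comparing coefficients in the
  differential equation gives the recursion of \<open>moment_coeff\<close>.\<close>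

lemma quadratic_form_moments:
  fixes X :: "'i \<Rightarrow> 'a \<Rightarrow> real"
  assumes "finite C" "indep_vars (\<lambda>_. borel) X C"
    and law: "\<And>e. e \<in> C \<Longrightarrow> distr M borel (X e) = std_normal_distribution"
  shows "integrable M (\<lambda>\<omega>. (\<Sum>e\<in>C. l e * ((X e \<omega>)\<^sup>2 - 1)) ^ n)"
    and "(\<integral>\<omega>. (\<Sum>e\<in>C. l e * ((X e \<omega>)\<^sup>2 - 1)) ^ n \<partial>M) = fact n * moment_coeff (\<lambda>m. \<Sum>e\<in>C. l e ^ m) n"
proof -
  let ?Y = "\<lambda>e \<omega>. l e * ((X e \<omega>)\<^sup>2 - 1)"
  have "(\<forall>n. integrable M (\<lambda>\<omega>. (\<Sum>e\<in>C. ?Y e \<omega>) ^ n)) \<and>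
      fps_deriv (egf (\<lambda>n. \<integral>\<omega>. (\<Sum>e\<in>C. ?Y e \<omega>) ^ n \<partial>M)) =
      (\<Sum>e\<in>C. chi_kernel (l e)) * egf (\<lambda>n. \<integral>\<omega>. (\<Sum>e\<in>C. ?Y e \<omega>) ^ n \<partial>M)"
    using assms
  proof (induction C rule: finite_induct)
    case empty
    have "egf (\<lambda>n. \<integral>\<omega>. (0::real) ^ n \<partial>M) = 1"
      by (rule fps_ext) (simp add: egf_def power_0_left prob_space)
    thus ?case by (simp add: power_0_left)
  next
    case (insert e C)
    have Xe [measurable]: "X e \<in> borel_measurable M" using insert.prems(1) unfolding indep_vars_def by auto
    have "indep_vars (\<lambda>_. borel) X C" using indep_vars_subset[OF insert.prems(1)] by blast
    hence IH: "\<And>n. integrable M (\<lambda>\<omega>. (\<Sum>e\<in>C. ?Y e \<omega>) ^ n)"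
      "fps_deriv (egf (\<lambda>n. \<integral>\<omega>. (\<Sum>e\<in>C. ?Y e \<omega>) ^ n \<partial>M)) =
      (\<Sum>e\<in>C. chi_kernel (l e)) * egf (\<lambda>n. \<integral>\<omega>. (\<Sum>e\<in>C. ?Y e \<omega>) ^ n \<partial>M)"
      using insert by auto
    have ind: "indep_var borel (?Y e) borel (\<lambda>\<omega>. \<Sum>e\<in>C. ?Y e \<omega>)"
      by (intro indep_vars_sum insert.hyps indep_vars_compose2[OF insert.prems(1)]) measurable
    have "integrable std_normal_distribution (\<lambda>x. (l e * (x\<^sup>2 - 1)) ^ n)" for n
      unfolding power_mult_distrib by (intro integrable_mult_right std_normal_hermite_moment_Suc)
    hence int: "integrable M (\<lambda>\<omega>. ?Y e \<omega> ^ n)" for n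
      using insert.prems(2)[of e] by (subst (asm) insert.prems(2)[of e, symmetric], simp, subst (asm) integrable_distr_eq) auto
    have "(\<integral>\<omega>. ?Y e \<omega> ^ n \<partial>M) = (\<integral>x. (l e * (x\<^sup>2 - 1)) ^ n \<partial>std_normal_distribution)" for n
      by (subst insert.prems(2)[of e, symmetric], simp, subst integral_distr) auto
    hence De: "fps_deriv (egf (\<lambda>n. \<integral>\<omega>. ?Y e \<omega> ^ n \<partial>M)) = chi_kernel (l e) * egf (\<lambda>n. \<integral>\<omega>. ?Y e \<omega> ^ n \<partial>M)"
      using deriv_egf_chi[of "l e"] by simp
    have "fps_deriv (egf (\<lambda>n. \<integral>\<omega>. (?Y e \<omega> + (\<Sum>e\<in>C. ?Y e \<omega>)) ^ n \<partial>M)) =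
        (chi_kernel (l e) + (\<Sum>e\<in>C. chi_kernel (l e))) * egf (\<lambda>n. \<integral>\<omega>. (?Y e \<omega> + (\<Sum>e\<in>C. ?Y e \<omega>)) ^ n \<partial>M)"
      unfolding moments_add_indep(2)[OF ind int IH(1)] fps_deriv_mult IH(2) De by (simp add: algebra_simps)
    thus ?case using moments_add_indep(1)[OF ind int IH(1)] insert.hyps by simp
  qed
  hence int: "\<And>n. integrable M (\<lambda>\<omega>. (\<Sum>e\<in>C. ?Y e \<omega>) ^ n)"
    and D: "fps_deriv (egf (\<lambda>n. \<integral>\<omega>. (\<Sum>e\<in>C. ?Y e \<omega>) ^ n \<partial>M)) =
      (\<Sum>e\<in>C. chi_kernel (l e)) * egf (\<lambda>n. \<integral>\<omega>. (\<Sum>e\<in>C. ?Y e \<omega>) ^ n \<partial>M)" by auto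
  show "integrable M (\<lambda>\<omega>. (\<Sum>e\<in>C. ?Y e \<omega>) ^ n)" by (rule int)
  define a where "a n = (\<integral>\<omega>. (\<Sum>e\<in>C. ?Y e \<omega>) ^ n \<partial>M) / fact n" for n
  have "a n = moment_coeff (\<lambda>m. \<Sum>e\<in>C. l e ^ m) n"
  proof (rule moment_coeff_unique)
    show "a 0 = 1" by (simp add: a_def prob_space)
    fix n
    have "real (Suc n) * a (Suc n) = fps_nth (fps_deriv (egf (\<lambda>n. \<integral>\<omega>. (\<Sum>e\<in>C. ?Y e \<omega>) ^ n \<partial>M))) n"
      by (simp add: egf_def a_def del: of_nat_Suc fact_Suc)
    also have "\<dots> = (\<Sum>k=0..n. (if k = 0 then 0 else 2 ^ k * (\<Sum>e\<in>C. l e ^ Suc k)) * a (n - k))"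
      unfolding D fps_mult_nth
      by (intro sum.cong refl) (simp add: egf_def a_def chi_kernel_def fps_sum_nth sum_distrib_left)
    also have "\<dots> = (\<Sum>k=1..n. 2 ^ k * (\<Sum>e\<in>C. l e ^ Suc k) * a (n - k))"
      by (intro sum.mono_neutral_cong_right) auto
    finally show "real (Suc n) * a (Suc n) = \<dots>" .
  qed
  thus "(\<integral>\<omega>. (\<Sum>e\<in>C. ?Y e \<omega>) ^ n \<partial>M) = fact n * moment_coeff (\<lambda>m. \<Sum>e\<in>C. l e ^ m) n"
    by (simp add: a_def field_simps)
qed

end

section \<open>Convergence of moments\<close>

lemma abs_power_diff_le:
  fixes a b :: real
  shows "\<bar>a ^ Suc m - b ^ Suc m\<bar> \<le> real (Suc m) * \<bar>a - b\<bar> * (\<bar>a\<bar> ^ m + \<bar>b\<bar> ^ m)"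
proof -
  have "\<bar>a ^ i * b ^ (m - i)\<bar> \<le> \<bar>a\<bar> ^ m + \<bar>b\<bar> ^ m" if "i \<le> m" for i
  proof -
    define c where "c = max \<bar>a\<bar> \<bar>b\<bar>"
    have "\<bar>a ^ i * b ^ (m - i)\<bar> \<le> c ^ i * c ^ (m - i)"
      unfolding abs_mult power_abs c_def by (intro mult_mono power_mono) auto
    also have "\<dots> = c ^ m" using that by (simp flip: power_add)
    also have "\<dots> \<le> \<bar>a\<bar> ^ m + \<bar>b\<bar> ^ m" by (auto simp: c_def max_def)
    finally show ?thesis .
  qed
  hence "\<bar>\<Sum>i\<le>m. a ^ i * b ^ (m - i)\<bar> \<le> (\<Sum>i\<le>m. \<bar>a\<bar> ^ m + \<bar>b\<bar> ^ m)"
    by (intro order_trans[OF sum_abs] sum_mono) auto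
  hence "\<bar>a - b\<bar> * \<bar>\<Sum>i\<le>m. a ^ i * b ^ (m - i)\<bar> \<le> \<bar>a - b\<bar> * (real (Suc m) * (\<bar>a\<bar> ^ m + \<bar>b\<bar> ^ m))"
    by (intro mult_left_mono) auto
  moreover have "a ^ Suc m - b ^ Suc m = (a - b) * (\<Sum>i\<le>m. a ^ i * b ^ (m - i))"
    using power_diff_sumr2[of a "Suc m" b] by (simp add: lessThan_Suc_atMost mult.commute)
  ultimately show ?thesis by (simp add: abs_mult mult_ac)
qed

lemma integrable_mult_of_squares:
  fixes f g :: "'a \<Rightarrow> real"
  assumes [measurable]: "f \<in> borel_measurable M" "g \<in> borel_measurable M"
    and "integrable M (\<lambda>x. (f x)\<^sup>2)" "integrable M (\<lambda>x. (g x)\<^sup>2)"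
  shows "integrable M (\<lambda>x. f x * g x)"
proof (rule Bochner_Integration.integrable_bound)
  show "integrable M (\<lambda>x. (f x)\<^sup>2 + (g x)\<^sup>2)" using assms by simp
  have "\<bar>f x * g x\<bar> \<le> (f x)\<^sup>2 + (g x)\<^sup>2" for x
    using sum_squares_bound[of "\<bar>f x\<bar>" "\<bar>g x\<bar>"] mult_nonneg_nonneg[of "\<bar>f x\<bar>" "\<bar>g x\<bar>"]
    unfolding abs_mult power2_abs by linarith
  thus "AE x in M. norm (f x * g x) \<le> norm ((f x)\<^sup>2 + (g x)\<^sup>2)" by auto
qed simp

text \<open>Cauchy-Schwarz from integrating the inequality between
  \<open>2 * s * t * (\<bar>f x\<bar> * \<bar>g x\<bar>)\<close> and the weighted squares. The
  balanced choice is \<open>s = sqrt B\<close>, \<open>t = sqrt A\<close>; it gives nothing if one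
  of them is 0.\<close>

lemma integral_abs_mult_le:
  fixes f g :: "'a \<Rightarrow> real"
  assumes "integrable M (\<lambda>x. (f x)\<^sup>2)" "integrable M (\<lambda>x. (g x)\<^sup>2)" "integrable M (\<lambda>x. \<bar>f x\<bar> * \<bar>g x\<bar>)"
  shows "(\<integral>x. \<bar>f x\<bar> * \<bar>g x\<bar> \<partial>M) \<le> sqrt (\<integral>x. (f x)\<^sup>2 \<partial>M) * sqrt (\<integral>x. (g x)\<^sup>2 \<partial>M)"
proof -
  define A B I where "A = (\<integral>x. (f x)\<^sup>2 \<partial>M)" and "B = (\<integral>x. (g x)\<^sup>2 \<partial>M)" and "I = (\<integral>x. \<bar>f x\<bar> * \<bar>g x\<bar> \<partial>M)"
  have nn: "0 \<le> A" "0 \<le> B" "0 \<le> I" by (auto simp: A_def B_def I_def)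
  have quad: "2 * s * t * I \<le> s\<^sup>2 * A + t\<^sup>2 * B" for s t
  proof -
    have "(\<integral>x. 2 * s * t * (\<bar>f x\<bar> * \<bar>g x\<bar>) \<partial>M) \<le> (\<integral>x. s\<^sup>2 * (f x)\<^sup>2 + t\<^sup>2 * (g x)\<^sup>2 \<partial>M)"
    proof (rule integral_mono)
      fix x
      show "2 * s * t * (\<bar>f x\<bar> * \<bar>g x\<bar>) \<le> s\<^sup>2 * (f x)\<^sup>2 + t\<^sup>2 * (g x)\<^sup>2"
        using sum_squares_bound[of "s * \<bar>f x\<bar>" "t * \<bar>g x\<bar>"] by (simp add: power_mult_distrib mult_ac)
    qed (use assms in auto)
    thus ?thesis using assms by (simp add: A_def B_def I_def)
  qed
  have "I \<le> sqrt A * sqrt B"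
  proof (cases "A = 0 \<or> B = 0")
    case True
    have "I \<le> 0"
    proof (rule ccontr)
      assume "\<not> I \<le> 0"
      show False
      proof (cases "A = 0")
        case True
        \<comment> \<open>With \<open>A = 0\<close> this weight makes the left side
          \<open>2 * (B + 1)\<close> while the right side is only \<open>B\<close>.\<close>
        have "2 * ((B + 1) / I) * 1 * I \<le> ((B + 1) / I)\<^sup>2 * A + 1\<^sup>2 * B" by (rule quad)
        thus False using True \<open>\<not> I \<le> 0\<close> nn by simp
      next
        case False
        hence "B = 0" using \<open>A = 0 \<or> B = 0\<close> by simp
        have "2 * 1 * ((A + 1) / I) * I \<le> 1\<^sup>2 * A + ((A + 1) / I)\<^sup>2 * B" by (rule quad)
        thus False using \<open>B = 0\<close> \<open>\<not> I \<le> 0\<close> nn by simp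
      qed
    qed
    thus ?thesis using nn by (meson mult_nonneg_nonneg order_trans real_sqrt_ge_zero)
  next
    case False
    hence p: "0 < sqrt A" "0 < sqrt B" using nn by auto
    define a b where "a = sqrt A" and "b = sqrt B"
    have ab: "A = a\<^sup>2" "B = b\<^sup>2" using nn by (simp_all add: a_def b_def)
    have "2 * b * a * I \<le> b\<^sup>2 * A + a\<^sup>2 * B" by (rule quad)
    also have "\<dots> = 2 * b * a * (a * b)" unfolding ab by (simp add: power2_eq_square)
    finally have "I \<le> a * b" using p by (simp add: a_def b_def)
    thus ?thesis by (simp only: a_def b_def)
  qed
  thus ?thesis by (simp add: A_def B_def I_def)
qed

context prob_space
begin

text \<open>Fatou's lemma along a subsequence that converges almost everywhere. It also supplies the
  integrability of the powers of the limit.\<close>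

lemma L2_tendsto_power_integrable:
  fixes Y :: "nat \<Rightarrow> 'a \<Rightarrow> real"
  assumes [measurable]: "\<And>n. Y n \<in> borel_measurable M" "F \<in> borel_measurable M"
    and int: "\<And>n. integrable M (\<lambda>\<omega>. (F \<omega> - Y n \<omega>)\<^sup>2)"
    and lim: "(\<lambda>n. \<integral>\<omega>. (F \<omega> - Y n \<omega>)\<^sup>2 \<partial>M) \<longlonglongrightarrow> 0"
    and intY: "\<And>n. integrable M (\<lambda>\<omega>. Y n \<omega> ^ (2 * m))"
    and B: "\<And>n. (\<integral>\<omega>. Y n \<omega> ^ (2 * m) \<partial>M) \<le> B"
  shows "integrable M (\<lambda>\<omega>. F \<omega> ^ (2 * m))" "(\<integral>\<omega>. F \<omega> ^ (2 * m) \<partial>M) \<le> B"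
proof -
  obtain r :: "nat \<Rightarrow> nat" where "strict_mono r" and r: "AE \<omega> in M. (\<lambda>n. (F \<omega> - Y (r n) \<omega>)\<^sup>2) \<longlonglongrightarrow> 0"
    using tendsto_L1_AE_subseq[of M "\<lambda>n \<omega>. (F \<omega> - Y n \<omega>)\<^sup>2"] int lim by auto
  have lim_pow: "AE \<omega> in M. (\<lambda>n. Y (r n) \<omega> ^ (2 * m)) \<longlonglongrightarrow> F \<omega> ^ (2 * m)"
    using r
  proof eventually_elim
    case (elim \<omega>)
    have "(\<lambda>n. sqrt ((F \<omega> - Y (r n) \<omega>)\<^sup>2)) \<longlonglongrightarrow> sqrt 0" by (intro tendsto_real_sqrt elim)
    hence "(\<lambda>n. \<bar>F \<omega> - Y (r n) \<omega>\<bar>) \<longlonglongrightarrow> 0" by simp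
    hence "(\<lambda>n. F \<omega> - (F \<omega> - Y (r n) \<omega>)) \<longlonglongrightarrow> F \<omega> - 0" by (intro tendsto_diff tendsto_const) (simp add: tendsto_rabs_zero_iff)
    thus ?case by (intro tendsto_power) simp
  qed
  have "0 \<le> B" using B[of 0] by (rule order_trans[rotated]) (simp add: power_mult)
  have "(\<integral>\<^sup>+\<omega>. ennreal (F \<omega> ^ (2 * m)) \<partial>M) \<le> (\<integral>\<^sup>+\<omega>. liminf (\<lambda>n. ennreal (Y (r n) \<omega> ^ (2 * m))) \<partial>M)"
  proof (rule nn_integral_mono_AE)
    show "AE \<omega> in M. ennreal (F \<omega> ^ (2 * m)) \<le> liminf (\<lambda>n. ennreal (Y (r n) \<omega> ^ (2 * m)))"
      using lim_pow
    proof eventually_elim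
      case (elim \<omega>)
      have "(\<lambda>n. ennreal (Y (r n) \<omega> ^ (2 * m))) \<longlonglongrightarrow> ennreal (F \<omega> ^ (2 * m))" using elim by (rule tendsto_ennrealI)
      from lim_imp_Liminf[OF _ this] show ?case by simp
    qed
  qed
  also have "\<dots> \<le> liminf (\<lambda>n. \<integral>\<^sup>+\<omega>. ennreal (Y (r n) \<omega> ^ (2 * m)) \<partial>M)" by (rule nn_integral_liminf) measurable
  also have "\<dots> \<le> liminf (\<lambda>n. ennreal B)"
  proof (intro Liminf_mono always_eventually allI)
    fix n
    have "(\<integral>\<^sup>+\<omega>. ennreal (Y (r n) \<omega> ^ (2 * m)) \<partial>M) = ennreal (\<integral>\<omega>. Y (r n) \<omega> ^ (2 * m) \<partial>M)"
      by (intro nn_integral_eq_integral intY) (simp add: power_mult)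
    thus "(\<integral>\<^sup>+\<omega>. ennreal (Y (r n) \<omega> ^ (2 * m)) \<partial>M) \<le> ennreal B" using B by (simp add: ennreal_leI)
  qed
  finally have le: "(\<integral>\<^sup>+\<omega>. ennreal (F \<omega> ^ (2 * m)) \<partial>M) \<le> ennreal B" by (simp add: Liminf_const)
  show int: "integrable M (\<lambda>\<omega>. F \<omega> ^ (2 * m))"
  proof (rule integrableI_bounded)
    have "(\<integral>\<^sup>+\<omega>. ennreal (norm (F \<omega> ^ (2 * m))) \<partial>M) = (\<integral>\<^sup>+\<omega>. ennreal (F \<omega> ^ (2 * m)) \<partial>M)"
      by (intro nn_integral_cong) (simp add: power_mult)
    also have "\<dots> < \<infinity>" using le ennreal_less_top[of B] by (simp add: less_le_trans le_less_trans)
    finally show "(\<integral>\<^sup>+\<omega>. ennreal (norm (F \<omega> ^ (2 * m))) \<partial>M) < \<infinity>" .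
  qed simp
  show "(\<integral>\<omega>. F \<omega> ^ (2 * m) \<partial>M) \<le> B"
    using le \<open>0 \<le> B\<close> by (subst (asm) nn_integral_eq_integral[OF int]) (auto simp: power_mult)
qed

text \<open>A difference of powers is the difference of the variables times a factor
  \<open>G\<close>, whose L2 norm is controlled by the moments of order \<open>2 * m\<close>.
  Cauchy-Schwarz then gives the moment of order \<open>Suc m\<close>. For \<open>m = 1\<close> only
  second moments must be bounded, which starts the bootstrap in the main argument.\<close>

lemma L2_tendsto_moment:
  fixes Y :: "nat \<Rightarrow> 'a \<Rightarrow> real"
  assumes Y [measurable]: "\<And>n. Y n \<in> borel_measurable M" "F \<in> borel_measurable M"
    and int: "\<And>n. integrable M (\<lambda>\<omega>. (F \<omega> - Y n \<omega>)\<^sup>2)"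
    and lim: "(\<lambda>n. \<integral>\<omega>. (F \<omega> - Y n \<omega>)\<^sup>2 \<partial>M) \<longlonglongrightarrow> 0"
    and intF: "integrable M (\<lambda>\<omega>. (F \<omega>)\<^sup>2)"
    and intY: "\<And>n k. integrable M (\<lambda>\<omega>. Y n \<omega> ^ k)"
    and B: "\<And>n. (\<integral>\<omega>. Y n \<omega> ^ (2 * m) \<partial>M) \<le> B"
  shows "(\<lambda>n. \<integral>\<omega>. Y n \<omega> ^ Suc m \<partial>M) \<longlonglongrightarrow> (\<integral>\<omega>. F \<omega> ^ Suc m \<partial>M)"
proof -
  note F2m = L2_tendsto_power_integrable[OF Y int lim intY B]
  have "0 \<le> B" using B[of 0] by (rule order_trans[rotated]) (simp add: power_mult)
  have intFS: "integrable M (\<lambda>\<omega>. F \<omega> ^ Suc m)"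
    using integrable_mult_of_squares[of F M "\<lambda>\<omega>. F \<omega> ^ m"] intF F2m(1)
    by (simp add: power_mult[symmetric] mult.commute)
  define G where "G n \<omega> = real (Suc m) * (\<bar>F \<omega>\<bar> ^ m + \<bar>Y n \<omega>\<bar> ^ m)" for n \<omega>
  have [measurable]: "G n \<in> borel_measurable M" for n unfolding G_def by measurable
  have G2_le: "(G n \<omega>)\<^sup>2 \<le> (real (Suc m))\<^sup>2 * (2 * (F \<omega> ^ (2 * m) + Y n \<omega> ^ (2 * m)))" for n \<omega>
  proof -
    have "(\<bar>F \<omega>\<bar> ^ m + \<bar>Y n \<omega>\<bar> ^ m)\<^sup>2 \<le> 2 * ((\<bar>F \<omega>\<bar> ^ m)\<^sup>2 + (\<bar>Y n \<omega>\<bar> ^ m)\<^sup>2)"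
      using sum_squares_bound[of "\<bar>F \<omega>\<bar> ^ m" "\<bar>Y n \<omega>\<bar> ^ m"] by (simp add: power2_sum)
    moreover have "(\<bar>x\<bar> ^ m)\<^sup>2 = x ^ (2 * m)" for x :: real
      unfolding power_mult[symmetric] mult.commute[of m 2] by (rule power_even_abs) simp
    ultimately show ?thesis unfolding G_def power_mult_distrib by (intro mult_left_mono) auto
  qed
  have int_bound: "integrable M (\<lambda>\<omega>. (real (Suc m))\<^sup>2 * (2 * (F \<omega> ^ (2 * m) + Y n \<omega> ^ (2 * m))))" for n
    using F2m(1) intY by (intro integrable_mult_right Bochner_Integration.integrable_add)
  have intG: "integrable M (\<lambda>\<omega>. (G n \<omega>)\<^sup>2)" for n
    by (rule Bochner_Integration.integrable_bound[OF int_bound[of n]]) (use order_trans[OF G2_le abs_ge_self] in auto)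
  have G_le: "(\<integral>\<omega>. (G n \<omega>)\<^sup>2 \<partial>M) \<le> (real (Suc m))\<^sup>2 * (2 * (B + B))" for n
  proof -
    have "(\<integral>\<omega>. (G n \<omega>)\<^sup>2 \<partial>M) \<le> (\<integral>\<omega>. (real (Suc m))\<^sup>2 * (2 * (F \<omega> ^ (2 * m) + Y n \<omega> ^ (2 * m))) \<partial>M)"
      by (rule integral_mono[OF intG int_bound G2_le])
    also have "\<dots> = (real (Suc m))\<^sup>2 * (2 * ((\<integral>\<omega>. F \<omega> ^ (2 * m) \<partial>M) + (\<integral>\<omega>. Y n \<omega> ^ (2 * m) \<partial>M)))"
      using F2m(1) intY[of n "2 * m"] by (simp del: of_nat_Suc)
    also have "\<dots> \<le> (real (Suc m))\<^sup>2 * (2 * (B + B))"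
      using F2m(2) B[of n] by (intro mult_left_mono add_mono) auto
    finally show ?thesis .
  qed
  define K where "K = sqrt ((real (Suc m))\<^sup>2 * (2 * (B + B)))"
  have "norm ((\<integral>\<omega>. Y n \<omega> ^ Suc m \<partial>M) - (\<integral>\<omega>. F \<omega> ^ Suc m \<partial>M)) \<le> sqrt (\<integral>\<omega>. (F \<omega> - Y n \<omega>)\<^sup>2 \<partial>M) * K" for n
  proof -
    have intFG: "integrable M (\<lambda>\<omega>. \<bar>F \<omega> - Y n \<omega>\<bar> * \<bar>G n \<omega>\<bar>)" 
      using integrable_mult_of_squares[of "\<lambda>\<omega>. \<bar>F \<omega> - Y n \<omega>\<bar>" M "\<lambda>\<omega>. \<bar>G n \<omega>\<bar>"] int intG by simp
    have "\<bar>(\<integral>\<omega>. Y n \<omega> ^ Suc m \<partial>M) - (\<integral>\<omega>. F \<omega> ^ Suc m \<partial>M)\<bar> = \<bar>\<integral>\<omega>. Y n \<omega> ^ Suc m - F \<omega> ^ Suc m \<partial>M\<bar>"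
      by (subst Bochner_Integration.integral_diff[OF intY intFS]) simp
    also have "\<dots> \<le> (\<integral>\<omega>. \<bar>Y n \<omega> ^ Suc m - F \<omega> ^ Suc m\<bar> \<partial>M)" by (rule integral_abs_bound)
    also have "\<dots> \<le> (\<integral>\<omega>. \<bar>F \<omega> - Y n \<omega>\<bar> * \<bar>G n \<omega>\<bar> \<partial>M)"
    proof (rule integral_mono[OF _ intFG])
      show "integrable M (\<lambda>\<omega>. \<bar>Y n \<omega> ^ Suc m - F \<omega> ^ Suc m\<bar>)"
        by (intro integrable_abs Bochner_Integration.integrable_diff intY intFS)
      fix \<omega>
      have "\<bar>G n \<omega>\<bar> = real (Suc m) * (\<bar>Y n \<omega>\<bar> ^ m + \<bar>F \<omega>\<bar> ^ m)" unfolding G_def by (simp add: add.commute)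
      thus "\<bar>Y n \<omega> ^ Suc m - F \<omega> ^ Suc m\<bar> \<le> \<bar>F \<omega> - Y n \<omega>\<bar> * \<bar>G n \<omega>\<bar>"
        using abs_power_diff_le[of "Y n \<omega>" m "F \<omega>"]
        unfolding abs_minus_commute[of "F \<omega>" "Y n \<omega>"] by (simp only: mult_ac)
    qed
    also have "\<dots> \<le> sqrt (\<integral>\<omega>. (F \<omega> - Y n \<omega>)\<^sup>2 \<partial>M) * sqrt (\<integral>\<omega>. (G n \<omega>)\<^sup>2 \<partial>M)"
      by (rule integral_abs_mult_le[OF int intG intFG])
    also have "\<dots> \<le> sqrt (\<integral>\<omega>. (F \<omega> - Y n \<omega>)\<^sup>2 \<partial>M) * K"
      unfolding K_def by (intro mult_left_mono real_sqrt_le_mono G_le) simp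
    finally show ?thesis by simp
  qed
  hence bound: "eventually (\<lambda>n. norm ((\<integral>\<omega>. Y n \<omega> ^ Suc m \<partial>M) - (\<integral>\<omega>. F \<omega> ^ Suc m \<partial>M)) \<le>
      sqrt (\<integral>\<omega>. (F \<omega> - Y n \<omega>)\<^sup>2 \<partial>M) * K) sequentially" by (rule always_eventually[OF allI])
  have "(\<lambda>n. sqrt (\<integral>\<omega>. (F \<omega> - Y n \<omega>)\<^sup>2 \<partial>M) * K) \<longlonglongrightarrow> sqrt 0 * K"
    by (intro tendsto_mult tendsto_real_sqrt lim tendsto_const)
  hence "(\<lambda>n. sqrt (\<integral>\<omega>. (F \<omega> - Y n \<omega>)\<^sup>2 \<partial>M) * K) \<longlonglongrightarrow> 0" by (simp only: real_sqrt_zero mult_zero_left)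
  from Lim_null_comparison[OF bound this]
  have "(\<lambda>n. (\<integral>\<omega>. Y n \<omega> ^ Suc m \<partial>M) - (\<integral>\<omega>. F \<omega> ^ Suc m \<partial>M)) \<longlonglongrightarrow> 0" .
  thus ?thesis by (rule LIM_zero_cancel)
qed

end

section \<open>The double Wiener integral of an elementary tensor\<close>

lemma elementary_tensor_Cons:
  "elementary_tensor ((c, h) # cs) x y = c * ((h \<bullet> x) * (h \<bullet> y)) + elementary_tensor cs x y"
  by (simp add: elementary_tensor_def)

lemma bounded_bilinear_elementary_tensor:
  fixes cs :: "(real \<times> 'h::real_inner) list"
  shows "bounded_bilinear (elementary_tensor cs)"
proof (induction cs)
  case Nil
  have "elementary_tensor ([] :: (real \<times> 'h) list) = (\<lambda>x y. 0)" by (simp add: elementary_tensor_def fun_eq_iff)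
  moreover have "bounded_bilinear (\<lambda>(x::'h) (y::'h). 0::real)"
    by (rule bounded_bilinear.intro) (auto intro: exI[of _ 0])
  ultimately show ?case by simp
next
  case (Cons a cs)
  obtain c h where a: "a = (c, h)" by force
  interpret bounded_bilinear "elementary_tensor cs" by (rule Cons.IH)
  obtain K where K: "\<And>x y. norm (elementary_tensor cs x y) \<le> norm x * norm y * K" using bounded by blast
  show ?case unfolding a
  proof
    have "norm (elementary_tensor ((c, h) # cs) x y) \<le> norm x * norm y * (\<bar>c\<bar> * (norm h * norm h) + K)" for x y
    proof -
      have "\<bar>c * ((h \<bullet> x) * (h \<bullet> y))\<bar> \<le> \<bar>c\<bar> * ((norm h * norm x) * (norm h * norm y))"
        unfolding abs_mult by (intro mult_left_mono mult_mono Cauchy_Schwarz_ineq2) auto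
      moreover have "\<bar>c\<bar> * ((norm h * norm x) * (norm h * norm y)) + norm x * norm y * K =
          norm x * norm y * (\<bar>c\<bar> * (norm h * norm h) + K)" by (simp add: algebra_simps)
      ultimately show ?thesis using K[of x y] unfolding elementary_tensor_Cons real_norm_def by linarith
    qed
    thus "\<exists>K. \<forall>x y. norm (elementary_tensor ((c, h) # cs) x y) \<le> norm x * norm y * K" by blast
  qed (simp_all add: elementary_tensor_Cons inner_add_right add_left add_right scaleR_left scaleR_right distrib_left distrib_right
      mult.left_commute)
qed

lemma elementary_tensor_sym: "elementary_tensor cs x y = elementary_tensor cs y x"
  by (simp add: elementary_tensor_def mult.commute mult.left_commute)

text \<open>Parseval writes the subtracted squared norm as the same double sum with the products
  replaced by Kronecker deltas. The expansion of \<open>W h\<close> is assumed at one fixed point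
  because it holds only almost surely.\<close>

lemma elementary_integral_expand:
  assumes C: "finite C" "pairwise orthogonal C" "\<forall>e\<in>C. norm e = 1"
    and W: "\<And>c h. (c, h) \<in> set cs \<Longrightarrow> W h \<omega> = (\<Sum>e\<in>C. (h \<bullet> e) * W e \<omega>)"
    and span: "\<And>c h. (c, h) \<in> set cs \<Longrightarrow> h \<in> span C"
  shows "elementary_integral W cs \<omega> =
    (\<Sum>e\<in>C. \<Sum>f\<in>C. elementary_tensor cs e f * (W e \<omega> * W f \<omega> - (if e = f then 1 else 0)))"
  using W span
proof (induction cs)
  case Nil
  show ?case by (simp add: elementary_integral_def elementary_tensor_def)
next
  case (Cons a cs)
  obtain c h where a: "a = (c, h)" by force
  have h: "h = (\<Sum>e\<in>C. (h \<bullet> e) *\<^sub>R e)"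
    using orthonormal_basis_expand[OF C(2) _ _ C(1), of h] C(3) Cons.prems(2)[of c h] a by simp
  have "(norm h)\<^sup>2 = h \<bullet> (\<Sum>e\<in>C. (h \<bullet> e) *\<^sub>R e)" unfolding h[symmetric] by (rule power2_norm_eq_inner)
  also have "\<dots> = (\<Sum>e\<in>C. (h \<bullet> e) * (h \<bullet> e))" by (simp add: inner_sum_right)
  also have "\<dots> = (\<Sum>e\<in>C. \<Sum>f\<in>C. (h \<bullet> e) * (h \<bullet> f) * (if e = f then 1 else 0))"
    using C(1) by (intro sum.cong refl) (simp add: if_distrib cong: if_cong)
  finally have n: "(norm h)\<^sup>2 = \<dots>" .
  have "(W h \<omega>)\<^sup>2 = (\<Sum>e\<in>C. \<Sum>f\<in>C. (h \<bullet> e) * (h \<bullet> f) * (W e \<omega> * W f \<omega>))"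
    using Cons.prems(1)[of c h] a by (simp add: power2_eq_square sum_product mult_ac)
  hence "c * ((W h \<omega>)\<^sup>2 - (norm h)\<^sup>2) =
      (\<Sum>e\<in>C. \<Sum>f\<in>C. c * ((h \<bullet> e) * (h \<bullet> f)) * (W e \<omega> * W f \<omega> - (if e = f then 1 else 0)))"
    by (simp only: n sum_subtractf sum_distrib_left right_diff_distrib mult.assoc)
  moreover have "elementary_integral W (a # cs) \<omega> = c * ((W h \<omega>)\<^sup>2 - (norm h)\<^sup>2) + elementary_integral W cs \<omega>"
    by (simp add: a elementary_integral_def)
  moreover have "elementary_integral W cs \<omega> =
    (\<Sum>e\<in>C. \<Sum>f\<in>C. elementary_tensor cs e f * (W e \<omega> * W f \<omega> - (if e = f then 1 else 0)))"
    using Cons by auto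
  ultimately show ?case unfolding a elementary_tensor_Cons
    by (simp add: distrib_right sum.distrib)
qed

text \<open>The characteristic function is expressed by the second moment instead of the parameter
  \<open>\<sigma>\<close>, so that it can be computed from covariances. The degenerate Dirac case is
  covered by the same formula.\<close>

lemma (in prob_space) centered_normal_law:
  assumes [measurable]: "Y \<in> borel_measurable M" and law: "distr M borel Y = normal_law \<mu> \<sigma>" "0 \<le> \<sigma>"
  shows "integrable M (\<lambda>\<omega>. (Y \<omega>)\<^sup>2)"
    and "expectation Y = 0 \<Longrightarrow> (\<integral>\<omega>. iexp (Y \<omega>) \<partial>M) = complex_of_real (exp (- expectation (\<lambda>\<omega>. (Y \<omega>)\<^sup>2) / 2))"
proof -
  have "integrable M (\<lambda>\<omega>. (Y \<omega>)\<^sup>2) \<and> (expectation Y = 0 \<longrightarrow>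
      (\<integral>\<omega>. iexp (Y \<omega>) \<partial>M) = complex_of_real (exp (- expectation (\<lambda>\<omega>. (Y \<omega>)\<^sup>2) / 2)))"
  proof (cases "\<sigma> = 0")
    case True
    have "AE x in return borel \<mu>. x = \<mu>" by (subst AE_return) auto
    moreover have "distr M borel Y = return borel \<mu>" using law True by (simp add: normal_law_def)
    ultimately have "AE x in distr M borel Y. x = \<mu>" by (simp only:)
    hence ae: "AE \<omega> in M. Y \<omega> = \<mu>" by (subst (asm) AE_distr_iff) auto
    have "integrable M (\<lambda>\<omega>. (Y \<omega>)\<^sup>2) = integrable M (\<lambda>\<omega>. \<mu>\<^sup>2)"
      by (rule integrable_cong_AE) (use ae in auto)
    moreover have "expectation Y = expectation (\<lambda>_. \<mu>)" by (rule integral_cong_AE) (use ae in auto)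
    moreover have "expectation (\<lambda>\<omega>. (Y \<omega>)\<^sup>2) = expectation (\<lambda>_. \<mu>\<^sup>2)" by (rule integral_cong_AE) (use ae in auto)
    moreover have "(\<integral>\<omega>. iexp (Y \<omega>) \<partial>M) = (\<integral>\<omega>. iexp \<mu> \<partial>M)" by (rule integral_cong_AE) (use ae in auto)
    ultimately show ?thesis by (simp add: prob_space)
  next
    case False
    hence \<sigma>: "0 < \<sigma>" using law by simp
    have D: "distributed M lborel Y (normal_density \<mu> \<sigma>)"
      using law False by (simp add: distributed_def normal_law_def cong: distr_cong)
    define Z where "Z = (\<lambda>\<omega>. (Y \<omega> - \<mu>) / \<sigma>)"
    have DZ: "distributed M lborel Z std_normal_density"
      using D unfolding normal_standard_normal_convert[OF \<sigma>] Z_def .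
    have [measurable]: "Z \<in> borel_measurable M" by (simp add: Z_def)
    have Y: "Y \<omega> = \<mu> + \<sigma> * Z \<omega>" for \<omega> using \<sigma> by (simp add: Z_def)
    have lawZ: "distr M borel Z = std_normal_distribution"
      using DZ by (simp add: distributed_def cong: distr_cong)
    have intZ: "integrable M (\<lambda>\<omega>. Z \<omega> ^ n)" for n
      using integrable_std_normal_distribution_moment[of n] unfolding lawZ[symmetric]
      by (subst (asm) integrable_distr_eq) auto
    have "integrable M (\<lambda>\<omega>. \<mu>\<^sup>2 + (2 * \<mu> * \<sigma>) * Z \<omega> ^ 1 + \<sigma>\<^sup>2 * Z \<omega> ^ 2)"
      by (intro Bochner_Integration.integrable_add integrable_mult_right intZ) simp
    hence int: "integrable M (\<lambda>\<omega>. (Y \<omega>)\<^sup>2)" by (simp add: Y power2_eq_square algebra_simps)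
    have "(\<integral>\<omega>. iexp (Y \<omega>) \<partial>M) = complex_of_real (exp (- expectation (\<lambda>\<omega>. (Y \<omega>)\<^sup>2) / 2))" if "expectation Y = 0"
    proof -
      have \<mu>: "\<mu> = 0" using normal_distributed_expectation[OF \<sigma> D] that by simp
      have "expectation (\<lambda>\<omega>. (Y \<omega>)\<^sup>2) = \<sigma>\<^sup>2"
        using normal_distributed_variance[OF \<sigma> D] that by simp
      moreover have "(\<integral>\<omega>. iexp (Y \<omega>) \<partial>M) = char (distr M borel Z) \<sigma>"
        unfolding char_def by (subst integral_distr) (auto simp: Y \<mu>)
      ultimately show ?thesis by (simp add: lawZ char_std_normal_distribution)
    qed
    thus ?thesis using int by blast
  qed
  thus "integrable M (\<lambda>\<omega>. (Y \<omega>)\<^sup>2)"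
    "expectation Y = 0 \<Longrightarrow> (\<integral>\<omega>. iexp (Y \<omega>) \<partial>M) = complex_of_real (exp (- expectation (\<lambda>\<omega>. (Y \<omega>)\<^sup>2) / 2))"
    by auto
qed

lemma sum_orthonormal:
  assumes "finite C" "pairwise orthogonal C" "\<forall>e\<in>C. norm e = 1"
  shows "(\<Sum>h\<in>C. \<Sum>k\<in>C. c h * d k * (h \<bullet> k)) = (\<Sum>h\<in>C. c h * d h)"
proof (intro sum.cong refl)
  fix h assume h: "h \<in> C"
  have "(\<Sum>k\<in>C. c h * d k * (h \<bullet> k)) = (\<Sum>k\<in>C. if k = h then c h * d h else 0)"
    using assms h by (intro sum.cong) (auto simp: pairwise_def orthogonal_def power2_norm_eq_inner[symmetric])
  thus "(\<Sum>k\<in>C. c h * d k * (h \<bullet> k)) = c h * d h" using assms(1) h by simp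
qed

context isonormal_gaussian_process
begin

declare measurable_W [measurable]

lemma square_integrable_W: "integrable M (\<lambda>\<omega>. (W h \<omega>)\<^sup>2)"
proof -
  obtain \<mu> \<sigma> where "0 \<le> \<sigma>" "distr M borel (\<lambda>\<omega>. \<Sum>k\<in>{h}. 1 * W k \<omega>) = normal_law \<mu> \<sigma>"
    using gaussian_W[of "{h}" "\<lambda>_. 1"] by auto
  thus ?thesis using centered_normal_law(1)[of "W h" \<mu> \<sigma>] by simp
qed

lemma integrable_W: "integrable M (W h)"
  using integrable_mult_of_squares[of "W h" M "\<lambda>_. 1"] square_integrable_W by simp

lemma integrable_W_mult: "integrable M (\<lambda>\<omega>. W h \<omega> * W k \<omega>)"
  by (intro integrable_mult_of_squares square_integrable_W) auto

lemma char_W_sum: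
  assumes "finite S"
  shows "(\<integral>\<omega>. iexp (\<Sum>h\<in>S. c h * W h \<omega>) \<partial>M) =
    complex_of_real (exp (- (\<Sum>h\<in>S. \<Sum>k\<in>S. c h * c k * (h \<bullet> k)) / 2))"
proof -
  obtain \<mu> \<sigma> where "0 \<le> \<sigma>" "distr M borel (\<lambda>\<omega>. \<Sum>h\<in>S. c h * W h \<omega>) = normal_law \<mu> \<sigma>"
    using gaussian_W[OF assms] by blast
  moreover have "expectation (\<lambda>\<omega>. \<Sum>h\<in>S. c h * W h \<omega>) = 0"
    by (subst Bochner_Integration.integral_sum) (auto intro!: integrable_mult_right integrable_W simp: centered_W)
  moreover have "expectation (\<lambda>\<omega>. (\<Sum>h\<in>S. c h * W h \<omega>)\<^sup>2) = (\<Sum>h\<in>S. \<Sum>k\<in>S. c h * c k * (h \<bullet> k))"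
  proof -
    have "(\<Sum>h\<in>S. c h * W h \<omega>)\<^sup>2 = (\<Sum>h\<in>S. \<Sum>k\<in>S. (c h * c k) * (W h \<omega> * W k \<omega>))" for \<omega>
      by (simp add: power2_eq_square sum_product mult_ac)
    thus ?thesis
      by (simp add: Bochner_Integration.integral_sum integrable_W_mult covariance_W
          Bochner_Integration.integrable_sum)
  qed
  ultimately show ?thesis using centered_normal_law(2)[of "\<lambda>\<omega>. \<Sum>h\<in>S. c h * W h \<omega>" \<mu> \<sigma>] by simp
qed

lemma W_orthonormal:
  assumes "finite C" "pairwise orthogonal C" "\<forall>e\<in>C. norm e = 1"
  shows "\<And>e. e \<in> C \<Longrightarrow> distr M borel (W e) = std_normal_distribution"
    and "indep_vars (\<lambda>_. borel) W C"
proof -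
  have "(\<integral>\<omega>. iexp (\<Sum>i\<in>C. c i * W i \<omega>) \<partial>M) = complex_of_real (exp (- (\<Sum>i\<in>C. (c i)\<^sup>2) / 2))" for c
    unfolding char_W_sum[OF assms(1)] sum_orthonormal[OF assms] by (simp add: power2_eq_square)
  from jointly_std_normal[OF assms(1) measurable_W this]
  show "\<And>e. e \<in> C \<Longrightarrow> distr M borel (W e) = std_normal_distribution" "indep_vars (\<lambda>_. borel) W C" by auto
qed

text \<open>Linearity of \<open>W\<close> follows from its covariance, but only almost surely: the
  difference of the two sides has second moment 0.\<close>

lemma W_orthonormal_expand:
  assumes C: "finite C" "pairwise orthogonal C" "\<forall>e\<in>C. norm e = 1" and h: "h \<in> span C"
  shows "AE \<omega> in M. W h \<omega> = (\<Sum>e\<in>C. (h \<bullet> e) * W e \<omega>)"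
proof -
  let ?S = "\<lambda>\<omega>. \<Sum>e\<in>C. (h \<bullet> e) * W e \<omega>"
  have hh: "h \<bullet> h = (\<Sum>e\<in>C. (h \<bullet> e) * (h \<bullet> e))"
  proof -
    have "h \<bullet> h = h \<bullet> (\<Sum>e\<in>C. (h \<bullet> e) *\<^sub>R e)"
      using orthonormal_basis_expand[OF C(2) _ h C(1)] C(3) by simp
    thus ?thesis by (simp add: inner_sum_right)
  qed
  have eq: "(W h \<omega> - ?S \<omega>)\<^sup>2 = W h \<omega> * W h \<omega> - 2 * (\<Sum>e\<in>C. (h \<bullet> e) * (W h \<omega> * W e \<omega>))
      + (\<Sum>e\<in>C. \<Sum>f\<in>C. ((h \<bullet> e) * (h \<bullet> f)) * (W e \<omega> * W f \<omega>))" for \<omega>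
  proof -
    have "?S \<omega> * ?S \<omega> = (\<Sum>e\<in>C. \<Sum>f\<in>C. ((h \<bullet> e) * (h \<bullet> f)) * (W e \<omega> * W f \<omega>))"
      unfolding sum_product by (intro sum.cong refl) (simp only: mult_ac)
    moreover have "W h \<omega> * ?S \<omega> = (\<Sum>e\<in>C. (h \<bullet> e) * (W h \<omega> * W e \<omega>))"
      unfolding sum_distrib_left by (intro sum.cong refl) (simp only: mult_ac)
    moreover have "(a - b)\<^sup>2 = a * a - 2 * (a * b) + b * b" for a b :: real
      by (simp add: power2_eq_square algebra_simps)
    ultimately show ?thesis by (simp only:)
  qed
  have int: "integrable M (\<lambda>\<omega>. (W h \<omega> - ?S \<omega>)\<^sup>2)" unfolding eq
    by (intro Bochner_Integration.integrable_add Bochner_Integration.integrable_diff integrable_mult_right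
        Bochner_Integration.integrable_sum integrable_W_mult)
  have "expectation (\<lambda>\<omega>. (W h \<omega> - ?S \<omega>)\<^sup>2) = h \<bullet> h - 2 * (\<Sum>e\<in>C. (h \<bullet> e) * (h \<bullet> e))
      + (\<Sum>e\<in>C. \<Sum>f\<in>C. ((h \<bullet> e) * (h \<bullet> f)) * (e \<bullet> f))"
    unfolding eq
    by (simp only: Bochner_Integration.integral_sum Bochner_Integration.integrable_sum integrable_W_mult
        covariance_W integrable_mult_right Bochner_Integration.integral_add Bochner_Integration.integral_diff
        Bochner_Integration.integrable_diff integral_mult_right_zero)
  also have "\<dots> = 0" unfolding sum_orthonormal[OF C] hh by simp
  finally have "AE \<omega> in M. (W h \<omega> - ?S \<omega>)\<^sup>2 = 0"
    using integral_nonneg_eq_0_iff_AE[OF int] by simp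
  thus ?thesis by (auto elim: eventually_mono)
qed

text \<open>Diagonalising the tensor on the span of its vectors removes all mixed products. The
  coefficients are its values \<open>elementary_tensor cs e e\<close> on the diagonal.\<close>

lemma elementary_integral_diagonal:
  obtains C l where "finite C" "pairwise orthogonal C" "\<forall>e\<in>C. norm e = 1"
    "AE \<omega> in M. elementary_integral W cs \<omega> = (\<Sum>e\<in>C. l e * ((W e \<omega>)\<^sup>2 - 1))"
proof -
  obtain C where C: "finite C" "pairwise orthogonal C" "\<forall>e\<in>C. norm e = 1"
    and span: "span C = span (snd ` set cs)" and diag: "pairwise (\<lambda>x y. elementary_tensor cs x y = 0) C"
    using orthonormal_diagonalization[OF bounded_bilinear_elementary_tensor elementary_tensor_sym, of "snd ` set cs" cs] by auto
  have hC: "h \<in> span C" if "(c, h) \<in> set cs" for c h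
    unfolding span using that by (force intro: span_base)
  have "AE \<omega> in M. \<forall>a\<in>set cs. W (snd a) \<omega> = (\<Sum>e\<in>C. (snd a \<bullet> e) * W e \<omega>)"
  proof (rule AE_finite_allI)
    fix a assume "a \<in> set cs"
    hence "snd a \<in> span C" using hC[of "fst a" "snd a"] by simp
    thus "AE \<omega> in M. W (snd a) \<omega> = (\<Sum>e\<in>C. (snd a \<bullet> e) * W e \<omega>)" by (rule W_orthonormal_expand[OF C])
  qed simp
  hence "AE \<omega> in M. elementary_integral W cs \<omega> = (\<Sum>e\<in>C. elementary_tensor cs e e * ((W e \<omega>)\<^sup>2 - 1))"
  proof eventually_elim
    case (elim \<omega>)
    have "elementary_integral W cs \<omega> =
        (\<Sum>e\<in>C. \<Sum>f\<in>C. elementary_tensor cs e f * (W e \<omega> * W f \<omega> - (if e = f then 1 else 0)))"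
    proof (rule elementary_integral_expand[OF C])
      show "W h \<omega> = (\<Sum>e\<in>C. (h \<bullet> e) * W e \<omega>)" if "(c, h) \<in> set cs" for c h
        using bspec[OF elim that] by simp
    qed (rule hC)
    also have "\<dots> = (\<Sum>e\<in>C. elementary_tensor cs e e * ((W e \<omega>)\<^sup>2 - 1))"
    proof (rule sum.cong[OF refl])
      fix e assume e: "e \<in> C"
      have "(\<Sum>f\<in>C. elementary_tensor cs e f * (W e \<omega> * W f \<omega> - (if e = f then 1 else 0))) =
          (\<Sum>f\<in>C. if e = f then elementary_tensor cs e e * ((W e \<omega>)\<^sup>2 - 1) else 0)"
      proof (rule sum.cong[OF refl])
        fix f assume "f \<in> C"
        hence "e \<noteq> f \<Longrightarrow> elementary_tensor cs e f = 0" using diag e by (auto dest: pairwiseD)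
        thus "elementary_tensor cs e f * (W e \<omega> * W f \<omega> - (if e = f then 1 else 0)) =
            (if e = f then elementary_tensor cs e e * ((W e \<omega>)\<^sup>2 - 1) else 0)"
          by (cases "e = f") (simp_all add: power2_eq_square)
      qed
      thus "(\<Sum>f\<in>C. elementary_tensor cs e f * (W e \<omega> * W f \<omega> - (if e = f then 1 else 0))) =
          elementary_tensor cs e e * ((W e \<omega>)\<^sup>2 - 1)" using C(1) e by simp
    qed
    finally show ?case .
  qed
  from that[OF C this] show ?thesis .
qed

end

section \<open>The limiting law\<close>

lemma norm_iexp_diff_le: "cmod (iexp x - iexp y) \<le> \<bar>x - y\<bar>"
proof -
  have "iexp x - iexp y = iexp y * (iexp (x - y) - 1)"
    by (simp add: right_diff_distrib exp_add[symmetric] algebra_simps)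
  thus ?thesis using iexp_approx1[of "x - y" 0] by (simp add: norm_mult)
qed

text \<open>A target independent of both probability spaces, through which the law of
  \<open>F\<close> and that of \<open>N1 * N2\<close> are compared.\<close>

abbreviation "half_diff_squares_law \<equiv>
  distr (std_normal_distribution \<Otimes>\<^sub>M std_normal_distribution) borel (\<lambda>(x, y). (x\<^sup>2 - y\<^sup>2) / 2)"

context prob_space
begin

text \<open>The map \<open>iexp\<close> is 1-Lipschitz on the reals, and on a probability space the
  L1 norm is at most the L2 norm.\<close>

lemma char_diff_le_L2:
  assumes [measurable]: "F \<in> borel_measurable M" "V \<in> borel_measurable M"
    and int: "integrable M (\<lambda>\<omega>. (F \<omega> - V \<omega>)\<^sup>2)"
  shows "cmod (char (distr M borel F) t - char (distr M borel V) t) \<le>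
    \<bar>t\<bar> * sqrt (\<integral>\<omega>. (F \<omega> - V \<omega>)\<^sup>2 \<partial>M)"
proof -
  have int1: "integrable M (\<lambda>\<omega>. \<bar>F \<omega> - V \<omega>\<bar>)"
    using square_integrable_imp_integrable[OF _ int] by auto
  have ii: "integrable M (\<lambda>\<omega>. iexp (t * G \<omega>))" if [measurable]: "G \<in> borel_measurable M" for G
    by (intro integrable_const_bound[of _ 1]) auto
  have "char (distr M borel F) t - char (distr M borel V) t = (\<integral>\<omega>. iexp (t * F \<omega>) - iexp (t * V \<omega>) \<partial>M)"
    unfolding char_def by (subst Bochner_Integration.integral_diff) (auto simp: integral_distr ii simp del: of_real_mult)
  hence "cmod (char (distr M borel F) t - char (distr M borel V) t) \<le>
      (\<integral>\<omega>. cmod (iexp (t * F \<omega>) - iexp (t * V \<omega>)) \<partial>M)"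
    by (simp only: integral_norm_bound)
  also have "\<dots> \<le> (\<integral>\<omega>. \<bar>t\<bar> * \<bar>F \<omega> - V \<omega>\<bar> \<partial>M)"
  proof (rule integral_mono)
    show "integrable M (\<lambda>\<omega>. cmod (iexp (t * F \<omega>) - iexp (t * V \<omega>)))"
      by (intro integrable_norm Bochner_Integration.integrable_diff ii) auto
    show "cmod (iexp (t * F \<omega>) - iexp (t * V \<omega>)) \<le> \<bar>t\<bar> * \<bar>F \<omega> - V \<omega>\<bar>" for \<omega>
      using norm_iexp_diff_le[of "t * F \<omega>" "t * V \<omega>"] by (simp add: right_diff_distrib[symmetric] abs_mult)
  qed (use int1 in simp)
  also have "\<dots> = \<bar>t\<bar> * (\<integral>\<omega>. \<bar>F \<omega> - V \<omega>\<bar> * \<bar>1\<bar> \<partial>M)" by simp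
  also have "\<dots> \<le> \<bar>t\<bar> * (sqrt (\<integral>\<omega>. (F \<omega> - V \<omega>)\<^sup>2 \<partial>M) * sqrt (\<integral>\<omega>. 1\<^sup>2 \<partial>M))"
    by (intro mult_left_mono integral_abs_mult_le int) (use int1 in auto)
  finally show ?thesis by (simp add: prob_space)
qed

lemma half_diff_squares_law:
  fixes X Y :: "'a \<Rightarrow> real"
  assumes ind: "indep_var borel X borel Y"
    and "distr M borel X = std_normal_distribution" "distr M borel Y = std_normal_distribution"
  shows "distr M borel (\<lambda>\<omega>. ((X \<omega>)\<^sup>2 - (Y \<omega>)\<^sup>2) / 2) = half_diff_squares_law"
proof -
  have [measurable]: "X \<in> borel_measurable M" "Y \<in> borel_measurable M"
    using indep_var_rv1[OF ind] indep_var_rv2[OF ind] by auto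
  have "std_normal_distribution \<Otimes>\<^sub>M std_normal_distribution = distr M (borel \<Otimes>\<^sub>M borel) (\<lambda>\<omega>. (X \<omega>, Y \<omega>))"
    using ind assms(2,3) unfolding indep_var_distribution_eq by simp
  hence "half_diff_squares_law =
      distr (distr M (borel \<Otimes>\<^sub>M borel) (\<lambda>\<omega>. (X \<omega>, Y \<omega>))) borel (\<lambda>(x, y). (x\<^sup>2 - y\<^sup>2) / 2)" by simp
  also have "\<dots> = distr M borel (\<lambda>\<omega>. ((X \<omega>)\<^sup>2 - (Y \<omega>)\<^sup>2) / 2)"
    by (subst distr_distr) (auto simp: o_def)
  finally show ?thesis ..
qed

lemma indep_var_of_indep_vars:
  fixes X :: "'i \<Rightarrow> 'a \<Rightarrow> real"
  assumes "indep_vars (\<lambda>_. borel) X I" "a \<in> I" "b \<in> I" "a \<noteq> b"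
  shows "indep_var borel (X a) borel (X b)"
proof -
  have "indep_vars (\<lambda>_. borel) X (insert a {b})" using assms by (intro indep_vars_subset[OF assms(1)]) auto
  \<comment> \<open>The sum over the singleton is \<open>X b\<close> itself.\<close>
  from indep_vars_sum[OF _ _ this] assms(4) show ?thesis by simp
qed

text \<open>Rotation by \<open>\<pi>/4\<close>: \<open>N\<^sub>1 N\<^sub>2 = (U\<^sup>2 - V\<^sup>2) / 2\<close> with \<open>U, V = (N\<^sub>1 \<plusminus> N\<^sub>2) / \<surd>2\<close>.\<close>

lemma product_std_normal_law:
  assumes N1: "distributed M lborel N1 std_normal_density" and N2: "distributed M lborel N2 std_normal_density"
    and ind: "indep_var borel N1 borel N2"
  shows "distr M borel (\<lambda>\<omega>. N1 \<omega> * N2 \<omega>) = half_diff_squares_law"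
proof -
  have [measurable]: "N1 \<in> borel_measurable M" "N2 \<in> borel_measurable M"
    using indep_var_rv1[OF ind] indep_var_rv2[OF ind] by auto
  have law: "distr M borel N1 = std_normal_distribution" "distr M borel N2 = std_normal_distribution"
    using N1 N2 by (simp_all add: distributed_def cong: distr_cong)
  define X where "X i \<omega> = (if i then N1 \<omega> + N2 \<omega> else N1 \<omega> - N2 \<omega>) / sqrt 2" for i \<omega>
  have [measurable]: "X i \<in> borel_measurable M" for i unfolding X_def by (cases i) simp_all
  have char: "(\<integral>\<omega>. iexp (\<Sum>i\<in>UNIV. c i * X i \<omega>) \<partial>M) = complex_of_real (exp (- (\<Sum>i\<in>UNIV. (c i)\<^sup>2) / 2))" for c
  proof -
    \<comment> \<open>The coefficients of \<open>N1\<close> and \<open>N2\<close> in the rotated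
      combination. A rotation preserves the sum of squares, which is all that the characteristic
      function sees.\<close>
    define u v where "u = (c True + c False) / sqrt 2" and "v = (c True - c False) / sqrt 2"
    have uv: "u\<^sup>2 + v\<^sup>2 = (c True)\<^sup>2 + (c False)\<^sup>2"
      by (simp add: u_def v_def power_divide) (simp add: power2_sum power2_diff field_simps)
    have "indep_var borel (\<lambda>\<omega>. u * N1 \<omega>) borel (\<lambda>\<omega>. v * N2 \<omega>)"
      using indep_var_compose[OF ind, of "\<lambda>x. u * x" borel "\<lambda>x. v * x" borel] by (simp add: o_def)
    from char_distr_add[OF this, of 1]
    have "(\<integral>\<omega>. iexp (u * N1 \<omega> + v * N2 \<omega>) \<partial>M) = (\<integral>\<omega>. iexp (u * N1 \<omega>) \<partial>M) * (\<integral>\<omega>. iexp (v * N2 \<omega>) \<partial>M)"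
      by (simp add: char_def integral_distr)
    also have "(\<integral>\<omega>. iexp (u * N1 \<omega>) \<partial>M) = char (distr M borel N1) u" by (simp add: char_def integral_distr)
    also have "(\<integral>\<omega>. iexp (v * N2 \<omega>) \<partial>M) = char (distr M borel N2) v" by (simp add: char_def integral_distr)
    also have "char (distr M borel N1) u * char (distr M borel N2) v = complex_of_real (exp (- (u\<^sup>2 + v\<^sup>2) / 2))"
      unfolding law char_std_normal_distribution of_real_mult[symmetric] exp_add[symmetric]
      by (simp add: field_simps)
    finally have "(\<integral>\<omega>. iexp (u * N1 \<omega> + v * N2 \<omega>) \<partial>M) = \<dots>" .
    moreover have "(\<Sum>i\<in>UNIV. c i * X i \<omega>) = u * N1 \<omega> + v * N2 \<omega>" for \<omega>
      by (simp add: UNIV_bool X_def u_def v_def add_divide_distrib diff_divide_distrib algebra_simps)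
    ultimately show ?thesis unfolding uv by (simp add: UNIV_bool add.commute)
  qed
  note X = jointly_std_normal[OF finite _ char]
  have "distr M borel (\<lambda>\<omega>. ((X True \<omega>)\<^sup>2 - (X False \<omega>)\<^sup>2) / 2) = half_diff_squares_law"
    by (intro half_diff_squares_law indep_var_of_indep_vars[of _ UNIV] X) auto
  moreover have "((X True \<omega>)\<^sup>2 - (X False \<omega>)\<^sup>2) / 2 = N1 \<omega> * N2 \<omega>" for \<omega>
    by (simp add: X_def power_divide) (simp add: power2_sum power2_diff field_simps)
  ultimately show ?thesis by simp
qed

end

context isonormal_gaussian_process
begin

lemma quadratic_form_W_moments:
  assumes C: "finite C" "pairwise orthogonal C" "\<forall>e\<in>C. norm e = 1"
  shows "integrable M (\<lambda>\<omega>. (\<Sum>e\<in>C. l e * ((W e \<omega>)\<^sup>2 - 1)) ^ n)"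
    and "(\<integral>\<omega>. (\<Sum>e\<in>C. l e * ((W e \<omega>)\<^sup>2 - 1)) ^ n \<partial>M) = fact n * moment_coeff (\<lambda>m. \<Sum>e\<in>C. l e ^ m) n"
  using quadratic_form_moments[OF C(1) W_orthonormal(2)[OF C], of l n] W_orthonormal(1)[OF C] by auto

text \<open>The constants cancel in the half-difference, so it is a diagonal form with eigenvalues
  1/2 and -1/2 and the difference \<open>Z\<close> is a diagonal form too. Its second moment is
  twice the sum of its squared eigenvalues.\<close>

lemma quadratic_form_near_product:
  fixes C :: "'h set" and l :: "'h \<Rightarrow> real" and a b :: 'h
  defines "Z \<equiv> \<lambda>\<omega>. (\<Sum>e\<in>C. l e * ((W e \<omega>)\<^sup>2 - 1)) - ((W a \<omega>)\<^sup>2 - (W b \<omega>)\<^sup>2) / 2"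
  assumes C: "finite C" "pairwise orthogonal C" "\<forall>e\<in>C. norm e = 1" and ab: "a \<in> C" "b \<in> C" "a \<noteq> b"
  shows "integrable M (\<lambda>\<omega>. (Z \<omega>)\<^sup>2)"
    and "(\<integral>\<omega>. (Z \<omega>)\<^sup>2 \<partial>M) = 2 * ((l a - 1/2)\<^sup>2 + (l b + 1/2)\<^sup>2 + (\<Sum>e\<in>C - {a, b}. (l e)\<^sup>2))"
proof -
  define d where "d e = l e - (if e = a then 1/2 else 0) + (if e = b then 1/2 else 0)" for e
  have Z: "Z \<omega> = (\<Sum>e\<in>C. d e * ((W e \<omega>)\<^sup>2 - 1))" for \<omega>
  proof -
    have "(\<Sum>e\<in>C. d e * ((W e \<omega>)\<^sup>2 - 1)) = (\<Sum>e\<in>C. l e * ((W e \<omega>)\<^sup>2 - 1))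
        - (\<Sum>e\<in>C. if e = a then (1/2) * ((W a \<omega>)\<^sup>2 - 1) else 0)
        + (\<Sum>e\<in>C. if e = b then (1/2) * ((W b \<omega>)\<^sup>2 - 1) else 0)"
      unfolding sum_subtractf[symmetric] sum.distrib[symmetric]
      by (intro sum.cong refl) (auto simp: d_def left_diff_distrib distrib_right)
    moreover have "(\<Sum>e\<in>C. if e = a then (1/2) * ((W a \<omega>)\<^sup>2 - 1) else 0) = (1/2) * ((W a \<omega>)\<^sup>2 - 1)"
      "(\<Sum>e\<in>C. if e = b then (1/2) * ((W b \<omega>)\<^sup>2 - 1) else 0) = (1/2) * ((W b \<omega>)\<^sup>2 - 1)"
      using C(1) ab by simp_all
    moreover have "u - (1/2) * (x - 1) + (1/2) * (y - 1) = u - (x - y) / 2" for u x y :: real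
      by (simp add: field_simps)
    ultimately show ?thesis unfolding Z_def by (simp only:)
  qed
  note moments = quadratic_form_W_moments[OF C, where l = d and n = 2]
  show "integrable M (\<lambda>\<omega>. (Z \<omega>)\<^sup>2)" unfolding Z by (rule moments)
  have "C = insert a (insert b (C - {a, b}))" using ab by auto
  hence "(\<Sum>e\<in>C. (d e)\<^sup>2) = (d a)\<^sup>2 + ((d b)\<^sup>2 + (\<Sum>e\<in>C - {a, b}. (d e)\<^sup>2))"
    using C(1) ab(3) by (metis (no_types, lifting) DiffD2 finite_Diff finite_insert insert_iff sum.insert)
  also have "(\<Sum>e\<in>C - {a, b}. (d e)\<^sup>2) = (\<Sum>e\<in>C - {a, b}. (l e)\<^sup>2)" by (intro sum.cong) (auto simp: d_def)
  finally have "(\<Sum>e\<in>C. (d e)\<^sup>2) = (l a - 1/2)\<^sup>2 + (l b + 1/2)\<^sup>2 + (\<Sum>e\<in>C - {a, b}. (l e)\<^sup>2)"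
    using ab by (simp add: d_def)
  thus "(\<integral>\<omega>. (Z \<omega>)\<^sup>2 \<partial>M) = 2 * ((l a - 1/2)\<^sup>2 + (l b + 1/2)\<^sup>2 + (\<Sum>e\<in>C - {a, b}. (l e)\<^sup>2))"
    unfolding Z moments(2) moment_coeff_2 by (simp add: fact_2)
qed

text \<open>A bootstrap: L2 convergence alone gives the limit of \<open>p n 2\<close>; this bounds
  all moments uniformly, so the fourth and the top moment converge as well and the eigenvalues can
  be located. The forms are then replaced by their two dominant terms at a vanishing L2
  cost.\<close>

lemma L2_limit_of_quadratic_forms:
  assumes F [measurable]: "F \<in> borel_measurable M" and F2: "integrable M (\<lambda>\<omega>. (F \<omega>)\<^sup>2)"
    and var: "(\<integral>\<omega>. F \<omega> ^ 2 \<partial>M) = 1" and fourth: "9 \<le> (\<integral>\<omega>. F \<omega> ^ 4 \<partial>M)"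
    and r: "3 \<le> r" and top: "(\<integral>\<omega>. F \<omega> ^ (2 * r) \<partial>M) \<le> (real (double_fact (2 * r - 1)))\<^sup>2"
    and C: "\<And>n. finite (C n)" "\<And>n. pairwise orthogonal (C n)" "\<And>n. \<forall>e\<in>C n. norm e = 1"
    and Y: "\<And>n \<omega>. Y n \<omega> = (\<Sum>e\<in>C n. l n e * ((W e \<omega>)\<^sup>2 - 1))"
    and lim: "(\<lambda>n. \<integral>\<omega>. (F \<omega> - Y n \<omega>)\<^sup>2 \<partial>M) \<longlonglongrightarrow> 0"
  shows "distr M borel F = half_diff_squares_law"
proof -
  have Ym [measurable]: "Y n \<in> borel_measurable M" for n unfolding Y[abs_def] by measurable
  define p where "p n m = (\<Sum>e\<in>C n. l n e ^ m)" for n m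
  note mom = quadratic_form_W_moments[OF C]
  have intY: "integrable M (\<lambda>\<omega>. Y n \<omega> ^ k)" for n k unfolding Y by (rule mom)
  have EY: "(\<integral>\<omega>. Y n \<omega> ^ k \<partial>M) = fact k * moment_coeff (p n) k" for n k
    unfolding Y mom(2) p_def[abs_def] ..
  have int_diff: "integrable M (\<lambda>\<omega>. (F \<omega> - Y n \<omega>)\<^sup>2)" for n
  proof -
    have "integrable M (\<lambda>\<omega>. (F \<omega>)\<^sup>2 - 2 * (F \<omega> * Y n \<omega>) + (Y n \<omega>)\<^sup>2)"
      using F2 intY[of n 2] integrable_mult_of_squares[OF F Ym F2 intY, of n]
      by (intro Bochner_Integration.integrable_add Bochner_Integration.integrable_diff integrable_mult_right)
    moreover have "(F \<omega> - Y n \<omega>)\<^sup>2 = (F \<omega>)\<^sup>2 - 2 * (F \<omega> * Y n \<omega>) + (Y n \<omega>)\<^sup>2" for \<omega>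
      by (simp add: power2_diff)
    ultimately show ?thesis by simp
  qed
  obtain B where "\<And>n. norm (\<integral>\<omega>. (F \<omega> - Y n \<omega>)\<^sup>2 \<partial>M) \<le> B"
    using BseqE[OF convergent_imp_Bseq[OF convergentI[OF lim]]] by blast
  hence B: "(\<integral>\<omega>. (F \<omega> - Y n \<omega>)\<^sup>2 \<partial>M) \<le> B" for n by (simp only: real_norm_def abs_le_iff)
  have "(\<integral>\<omega>. Y n \<omega> ^ (2 * 1) \<partial>M) \<le> 2 * 1 + 2 * B" for n
  proof -
    have "(\<integral>\<omega>. (Y n \<omega>)\<^sup>2 \<partial>M) \<le> (\<integral>\<omega>. 2 * (F \<omega>)\<^sup>2 + 2 * (F \<omega> - Y n \<omega>)\<^sup>2 \<partial>M)"
    proof (rule integral_mono)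
      \<comment> \<open>This square is exactly the right side minus the left side of the inequality
        below.\<close>
      have "0 \<le> (2 * F \<omega> - Y n \<omega>)\<^sup>2" for \<omega> by simp
      thus "(Y n \<omega>)\<^sup>2 \<le> 2 * (F \<omega>)\<^sup>2 + 2 * (F \<omega> - Y n \<omega>)\<^sup>2" for \<omega>
        by (simp add: power2_eq_square algebra_simps)
    qed (use intY[of n 2] F2 int_diff in auto)
    also have "\<dots> = 2 * 1 + 2 * (\<integral>\<omega>. (F \<omega> - Y n \<omega>)\<^sup>2 \<partial>M)" using F2 int_diff var by simp
    also have "\<dots> \<le> 2 * 1 + 2 * B" using B[of n] by simp
    finally show ?thesis by simp
  qed
  from L2_tendsto_moment[OF Ym F int_diff lim F2 intY this]
  have "(\<lambda>n. 2 * p n 2) \<longlonglongrightarrow> 1" by (simp add: EY moment_coeff_2 var numeral_2_eq_2[symmetric] fact_2)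
  from tendsto_divide[OF this tendsto_const[of 2]] have p2: "(\<lambda>n. p n 2) \<longlonglongrightarrow> 1/2" by simp
  then obtain N where N: "\<And>n. n \<ge> N \<Longrightarrow> p n 2 < 1"
    using order_tendstoD(2)[OF p2, of 1] by (auto simp: eventually_sequentially)

  \<comment> \<open>The moment bounds need a second power sum of at most 1 at every index, so the
    sequence starts at \<open>N\<close>.\<close>
  define C' l' Y' p' where "C' n = C (n + N)" and "l' n = l (n + N)" and "Y' n = Y (n + N)" and "p' n = p (n + N)" for n
  have p'_def2: "p' n m = (\<Sum>e\<in>C' n. l' n e ^ m)" for n m by (simp add: p'_def p_def C'_def l'_def)
  have Y'm [measurable]: "Y' n \<in> borel_measurable M" for n by (simp add: Y'_def)
  have lim': "(\<lambda>n. \<integral>\<omega>. (F \<omega> - Y' n \<omega>)\<^sup>2 \<partial>M) \<longlonglongrightarrow> 0"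
    unfolding Y'_def by (rule LIMSEQ_ignore_initial_segment[OF lim])
  have int_diff': "integrable M (\<lambda>\<omega>. (F \<omega> - Y' n \<omega>)\<^sup>2)" for n unfolding Y'_def by (rule int_diff)
  have intY': "integrable M (\<lambda>\<omega>. Y' n \<omega> ^ k)" for n k unfolding Y'_def by (rule intY)
  have EY': "(\<integral>\<omega>. Y' n \<omega> ^ k \<partial>M) = fact k * moment_coeff (p' n) k" for n k
    unfolding Y'_def p'_def by (rule EY)
  have bound: "(\<integral>\<omega>. Y' n \<omega> ^ (2 * m) \<partial>M) \<le> fact (2 * m) * 2 ^ (2 * m)" for n m
  proof -
    have "\<bar>p' n j\<bar> \<le> 1" if "j \<ge> 2" for j
      using abs_powersum_le[OF C(1)[of "n + N"], of "l (n + N)" j] N[of "n + N"] that by (simp add: p'_def p_def)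
    from abs_moment_coeff_le[of "p' n", OF this, of "2 * m"]
    show ?thesis unfolding EY' by (intro mult_left_mono) auto
  qed
  have conv: "(\<lambda>n. moment_coeff (p' n) (Suc m)) \<longlonglongrightarrow> (\<integral>\<omega>. F \<omega> ^ Suc m \<partial>M) / fact (Suc m)" for m
  proof -
    have "(\<lambda>n. (\<integral>\<omega>. Y' n \<omega> ^ Suc m \<partial>M) / fact (Suc m)) \<longlonglongrightarrow> (\<integral>\<omega>. F \<omega> ^ Suc m \<partial>M) / fact (Suc m)"
      by (intro tendsto_divide tendsto_const L2_tendsto_moment[OF Y'm F int_diff' lim' F2 intY' bound]) simp
    thus ?thesis unfolding EY' by simp
  qed
  have p2': "(\<lambda>n. p' n 2) \<longlonglongrightarrow> 1/2" unfolding p'_def by (rule LIMSEQ_ignore_initial_segment[OF p2])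
  \<comment> \<open>The formula for the fourth moment solved for the fourth power sum, with the
    second one at its limit 1/2. The value 9 gives exactly 1/8.\<close>
  define L where "L = ((\<integral>\<omega>. F \<omega> ^ 4 \<partial>M) / 24 - (1/2)\<^sup>2 / 2) / 2"
  have p4': "(\<lambda>n. p' n 4) \<longlonglongrightarrow> L"
  proof -
    have "(\<lambda>n. moment_coeff (p' n) 4) \<longlonglongrightarrow> (\<integral>\<omega>. F \<omega> ^ 4 \<partial>M) / 24"
      using conv[of 3] by (simp add: fact_numeral)
    hence "(\<lambda>n. (moment_coeff (p' n) 4 - (p' n 2)\<^sup>2 / 2) / 2) \<longlonglongrightarrow> L"
      unfolding L_def by (intro tendsto_intros p2') auto
    thus ?thesis by (simp add: moment_coeff_4)
  qed
  have L: "1/8 \<le> L" using fourth by (simp add: L_def power2_eq_square field_simps)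
  have "Suc (2 * r - 1) = 2 * r" using r by simp
  hence top': "(\<lambda>n. moment_coeff (p' n) (2 * r)) \<longlonglongrightarrow> (\<integral>\<omega>. F \<omega> ^ (2 * r) \<partial>M) / fact (2 * r)"
    using conv[of "2 * r - 1"] by (simp only:)
  have top_le: "(\<integral>\<omega>. F \<omega> ^ (2 * r) \<partial>M) / fact (2 * r) \<le> moment_coeff product_powersum (2 * r)"
    unfolding moment_coeff_product_even by (intro divide_right_mono top) simp
  have finC': "finite (C' n)" for n unfolding C'_def by (rule C(1))
  obtain s a b where s: "strict_mono s"
    and ab: "eventually (\<lambda>k. a k \<in> C' (s k) \<and> b k \<in> C' (s k) \<and> a k \<noteq> b k) sequentially"
    and eig: "(\<lambda>k. l' (s k) (a k)) \<longlonglongrightarrow> 1/2" "(\<lambda>k. l' (s k) (b k)) \<longlonglongrightarrow> -1/2"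
      "(\<lambda>k. \<Sum>f\<in>C' (s k) - {a k, b k}. l' (s k) f ^ 2) \<longlonglongrightarrow> 0"
    by (rule limiting_eigenvalues[OF p'_def2 finC' p2' p4' L top' top_le r])

  \<comment> \<open>The pair of normals varies with \<open>k\<close>, but the law of
    \<open>V k\<close> does not as long as the two vectors are distinct members of the orthonormal
    set.\<close>
  define V where "V k \<omega> = ((W (a k) \<omega>)\<^sup>2 - (W (b k) \<omega>)\<^sup>2) / 2" for k \<omega>
  have [measurable]: "V k \<in> borel_measurable M" for k unfolding V_def by measurable
  \<comment> \<open>Twice each of the two squared L2 distances, from \<open>F\<close> to the form
    and from the form to \<open>V k\<close>.\<close>
  define \<delta> where "\<delta> k = 2 * (\<integral>\<omega>. (F \<omega> - Y' (s k) \<omega>)\<^sup>2 \<partial>M) + 2 * (2 * ((l' (s k) (a k) - 1/2)\<^sup>2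
      + (l' (s k) (b k) + 1/2)\<^sup>2 + (\<Sum>f\<in>C' (s k) - {a k, b k}. l' (s k) f ^ 2)))" for k
  have "\<delta> \<longlonglongrightarrow> 2 * 0 + 2 * (2 * ((1/2 - 1/2)\<^sup>2 + (-1/2 + 1/2)\<^sup>2 + 0))"
    unfolding \<delta>_def using LIMSEQ_subseq_LIMSEQ[OF lim' s, unfolded o_def] eig by (intro tendsto_intros)
  hence \<delta>: "\<delta> \<longlonglongrightarrow> 0" by simp
  have near: "eventually (\<lambda>k. integrable M (\<lambda>\<omega>. (F \<omega> - V k \<omega>)\<^sup>2) \<and> (\<integral>\<omega>. (F \<omega> - V k \<omega>)\<^sup>2 \<partial>M) \<le> \<delta> k
      \<and> distr M borel (V k) = half_diff_squares_law) sequentially"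
    using ab
  proof eventually_elim
    case (elim k)
    let ?n = "s k + N"
    have abk: "a k \<in> C ?n" "b k \<in> C ?n" "a k \<noteq> b k" using elim by (auto simp: C'_def)
    note q = quadratic_form_near_product[OF C abk, where l = "l' (s k)"]
    have YV: "(\<Sum>e\<in>C ?n. l' (s k) e * ((W e \<omega>)\<^sup>2 - 1)) - ((W (a k) \<omega>)\<^sup>2 - (W (b k) \<omega>)\<^sup>2) / 2 = Y' (s k) \<omega> - V k \<omega>" for \<omega>
      by (simp add: Y'_def Y l'_def V_def)
    have int_YV: "integrable M (\<lambda>\<omega>. (Y' (s k) \<omega> - V k \<omega>)\<^sup>2)" using q(1) unfolding YV .
    have E_YV: "(\<integral>\<omega>. (Y' (s k) \<omega> - V k \<omega>)\<^sup>2 \<partial>M) = 2 * ((l' (s k) (a k) - 1/2)\<^sup>2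
      + (l' (s k) (b k) + 1/2)\<^sup>2 + (\<Sum>f\<in>C' (s k) - {a k, b k}. l' (s k) f ^ 2))"
      using q(2) unfolding YV C'_def .
    have le: "(F \<omega> - V k \<omega>)\<^sup>2 \<le> 2 * (F \<omega> - Y' (s k) \<omega>)\<^sup>2 + 2 * (Y' (s k) \<omega> - V k \<omega>)\<^sup>2" for \<omega>
      using sum_squares_bound[of "F \<omega> - Y' (s k) \<omega>" "Y' (s k) \<omega> - V k \<omega>"]
        power2_sum[of "F \<omega> - Y' (s k) \<omega>" "Y' (s k) \<omega> - V k \<omega>"] by simp
    have int_sum: "integrable M (\<lambda>\<omega>. 2 * (F \<omega> - Y' (s k) \<omega>)\<^sup>2 + 2 * (Y' (s k) \<omega> - V k \<omega>)\<^sup>2)"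
      by (intro Bochner_Integration.integrable_add integrable_mult_right int_diff' int_YV)
    have int_FV: "integrable M (\<lambda>\<omega>. (F \<omega> - V k \<omega>)\<^sup>2)"
      by (rule Bochner_Integration.integrable_bound[OF int_sum]) (use le in auto)
    have "(\<integral>\<omega>. (F \<omega> - V k \<omega>)\<^sup>2 \<partial>M) \<le> (\<integral>\<omega>. 2 * (F \<omega> - Y' (s k) \<omega>)\<^sup>2 + 2 * (Y' (s k) \<omega> - V k \<omega>)\<^sup>2 \<partial>M)"
      by (rule integral_mono[OF int_FV int_sum le])
    also have "\<dots> = \<delta> k" unfolding \<delta>_def E_YV[symmetric] using int_diff' int_YV by simp
    finally have "(\<integral>\<omega>. (F \<omega> - V k \<omega>)\<^sup>2 \<partial>M) \<le> \<delta> k" .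
    moreover have "distr M borel (V k) = half_diff_squares_law"
      unfolding V_def[abs_def] using abk W_orthonormal[OF C[of ?n]]
      by (intro half_diff_squares_law indep_var_of_indep_vars[of W "C ?n"]) auto
    ultimately show ?case using int_FV by blast
  qed
  have "char (distr M borel F) t = char half_diff_squares_law t" for t
  proof -
    \<comment> \<open>The left side does not depend on \<open>k\<close>, since \<open>V k\<close>
      has the target law; letting \<open>k\<close> grow makes it 0.\<close>
    have "eventually (\<lambda>k. cmod (char (distr M borel F) t - char half_diff_squares_law t) \<le> \<bar>t\<bar> * sqrt (\<delta> k)) sequentially"
      using near
    proof eventually_elim
      case (elim k)
      have "cmod (char (distr M borel F) t - char (distr M borel (V k)) t) \<le>
          \<bar>t\<bar> * sqrt (\<integral>\<omega>. (F \<omega> - V k \<omega>)\<^sup>2 \<partial>M)"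
        using elim by (intro char_diff_le_L2) auto
      also have "\<dots> \<le> \<bar>t\<bar> * sqrt (\<delta> k)" using elim by (intro mult_left_mono real_sqrt_le_mono) auto
      finally show ?case using elim by simp
    qed
    moreover have "(\<lambda>k. \<bar>t\<bar> * sqrt (\<delta> k)) \<longlonglongrightarrow> \<bar>t\<bar> * sqrt 0" by (intro tendsto_intros \<delta>)
    ultimately have "cmod (char (distr M borel F) t - char half_diff_squares_law t) \<le> \<bar>t\<bar> * sqrt 0"
      by (intro tendsto_lowerbound[OF _ _ trivial_limit_sequentially])
    thus ?thesis by simp
  qed
  moreover have "real_distribution (distr M borel F)" by (rule real_distribution_distr) simp
  moreover have "real_distribution half_diff_squares_law"
  proof -
    obtain k where "distr M borel (V k) = half_diff_squares_law"
      using eventually_happens[OF near] by auto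
    moreover have "real_distribution (distr M borel (V k))" by (rule real_distribution_distr) simp
    ultimately show ?thesis by simp
  qed
  ultimately show ?thesis by (intro Levy_uniqueness) auto
qed

text \<open>The elementary integrals approximating \<open>F\<close> are replaced by diagonal forms
  that agree with them almost everywhere, which leaves their L2 distances to \<open>F\<close>
  unchanged.\<close>

lemma second_chaos_law:
  assumes "F \<in> second_wiener_chaos M W"
    and "(\<integral>\<omega>. F \<omega> ^ 2 \<partial>M) = 1" "9 \<le> (\<integral>\<omega>. F \<omega> ^ 4 \<partial>M)"
    and "3 \<le> r" "(\<integral>\<omega>. F \<omega> ^ (2 * r) \<partial>M) \<le> (real (double_fact (2 * r - 1)))\<^sup>2"
  shows "distr M borel F = half_diff_squares_law"
proof -
  obtain cs where F [measurable]: "F \<in> borel_measurable M" and F2: "integrable M (\<lambda>\<omega>. (F \<omega>)\<^sup>2)"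
    and lim: "(\<lambda>n. \<integral>\<omega>. (F \<omega> - elementary_integral W (cs n) \<omega>)\<^sup>2 \<partial>M) \<longlonglongrightarrow> 0"
    using assms(1) unfolding second_wiener_chaos_def double_wiener_integral_def by auto
  have "\<forall>n. \<exists>C l. finite C \<and> pairwise orthogonal C \<and> (\<forall>e\<in>C. norm e = 1) \<and>
      (AE \<omega> in M. elementary_integral W (cs n) \<omega> = (\<Sum>e\<in>C. l e * ((W e \<omega>)\<^sup>2 - 1)))"
  proof
    fix n
    obtain C l where "finite C" "pairwise orthogonal C" "\<forall>e\<in>C. norm e = 1"
      "AE \<omega> in M. elementary_integral W (cs n) \<omega> = (\<Sum>e\<in>C. l e * ((W e \<omega>)\<^sup>2 - 1))"
      by (rule elementary_integral_diagonal[of "cs n"])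
    thus "\<exists>C l. finite C \<and> pairwise orthogonal C \<and> (\<forall>e\<in>C. norm e = 1) \<and>
      (AE \<omega> in M. elementary_integral W (cs n) \<omega> = (\<Sum>e\<in>C. l e * ((W e \<omega>)\<^sup>2 - 1)))" by (intro exI[of _ C] exI[of _ l] conjI)
  qed
  from choice[OF this] obtain C where "\<forall>n. \<exists>l. finite (C n) \<and> pairwise orthogonal (C n) \<and> (\<forall>e\<in>C n. norm e = 1) \<and>
      (AE \<omega> in M. elementary_integral W (cs n) \<omega> = (\<Sum>e\<in>C n. l e * ((W e \<omega>)\<^sup>2 - 1)))" ..
  from choice[OF this] obtain l where "\<forall>n. finite (C n) \<and> pairwise orthogonal (C n) \<and> (\<forall>e\<in>C n. norm e = 1) \<and>
      (AE \<omega> in M. elementary_integral W (cs n) \<omega> = (\<Sum>e\<in>C n. l n e * ((W e \<omega>)\<^sup>2 - 1)))" ..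
  hence C: "finite (C n)" "pairwise orthogonal (C n)" "\<forall>e\<in>C n. norm e = 1"
    and ae: "AE \<omega> in M. elementary_integral W (cs n) \<omega> = (\<Sum>e\<in>C n. l n e * ((W e \<omega>)\<^sup>2 - 1))" for n
    by auto
  have [measurable]: "elementary_integral W c \<in> borel_measurable M" for c
  proof (induction c)
    case Nil
    have "elementary_integral W [] = (\<lambda>\<omega>. 0)" by (simp add: elementary_integral_def fun_eq_iff)
    thus ?case by simp
  next
    case (Cons x c)
    obtain k h where x: "x = (k, h)" by force
    have "elementary_integral W (x # c) = (\<lambda>\<omega>. k * ((W h \<omega>)\<^sup>2 - (norm h)\<^sup>2) + elementary_integral W c \<omega>)"
      by (simp add: elementary_integral_def fun_eq_iff x)
    thus ?case using Cons by simp
  qed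
  have "(\<integral>\<omega>. (F \<omega> - elementary_integral W (cs n) \<omega>)\<^sup>2 \<partial>M) =
      (\<integral>\<omega>. (F \<omega> - (\<Sum>e\<in>C n. l n e * ((W e \<omega>)\<^sup>2 - 1)))\<^sup>2 \<partial>M)" for n
    by (rule integral_cong_AE) (use ae[of n] in auto)
  with lim have "(\<lambda>n. \<integral>\<omega>. (F \<omega> - (\<Sum>e\<in>C n. l n e * ((W e \<omega>)\<^sup>2 - 1)))\<^sup>2 \<partial>M) \<longlonglongrightarrow> 0" by simp
  from L2_limit_of_quadratic_forms[OF F F2 assms(2-5) C refl this] show ?thesis .
qed

end

theorem corollary3p2:
  fixes M :: "'a measure"
    and W :: "'h::{real_inner, polish_space} \<Rightarrow> 'a \<Rightarrow> real"
    and F :: "'a \<Rightarrow> real"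
    and r :: nat
    and P :: "'b measure"
    and N1 N2 :: "'b \<Rightarrow> real"
  assumes "isonormal_gaussian_process M W"
    and "F \<in> second_wiener_chaos M W"
    and "(\<integral>\<omega>. F \<omega> ^ 2 \<partial>M) = 1"
    and "(\<integral>\<omega>. F \<omega> ^ 4 \<partial>M) \<ge> 9"
    and "r \<ge> 3"
    and "(\<integral>\<omega>. F \<omega> ^ (2 * r) \<partial>M) \<le> (real (double_fact (2 * r - 1)))\<^sup>2"
    and "prob_space P"
    and "distributed P lborel N1 std_normal_density"
    and "distributed P lborel N2 std_normal_density"
    and "prob_space.indep_var P borel N1 borel N2"
  shows "distr M borel F = distr P borel (\<lambda>\<omega>. N1 \<omega> * N2 \<omega>)"
  using isonormal_gaussian_process.second_chaos_law[OF assms(1-6)]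
    prob_space.product_std_normal_law[OF assms(7-10)] by simp

end
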